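(* Suppose $\mathcal{M}$ is a closed symmetric monoidal category with all finite colimits and limits, $E,E'$ are monoids in $\mathcal{M}$, and $F:\mathrm{Mod}\text{-}E\to\mathrm{Mod}\text{-}E'$ is a strict $\mathcal{M}$-functor that preserves coequalizers. Then the natural map $$\tau_X: X\otimes_E FE\to FX$$ is an isomorphism for all $X\in\mathrm{Mod}\text{-}E$. Similarly, if $F:\mathrm{Mod}\text{-}E\to\mathrm{Mod}\text{-}E'$ is a contravariant strict $\mathcal{M}$-functor that takes coequalizers to equalizers, then the natural map $$FX\to\mathrm{Hom}_E(X,FE)$$ is an isomorphism for all $X\in\mathrm{Mod}\text{-}E$.
   Context: $\otimes$, $\mathrm{Hom}$, $S$ denote the monoidal product, internal hom and unit of $\mathcal{M}$. $\mathrm{Mod}\text{-}E$ is the category of right $E$-modules. For $K\in\mathcal{M}$ and $X\in\mathrm{Mod}\text{-}E$, $K\otimes X$ and $\mathrm{Hom}(K,X)$ are $E$-modules via the action on $X$. $\mathrm{Hom}_E(X,Y)\in\mathcal{M}$ is the equalizer of the two maps $\mathrm{Hom}(X,Y)\rightrightarrows\mathrm{Hom}(X\otimes E,Y)$; $X\otimes_E Y$ is the coequalizer of $X\otimes E\otimes Y\rightrightarrows X\otimes Y$ for $X$ a right and $Y$ a left $E$-module. If $Y$ is an $E\text{-}E'$-bimodule (resp. right $E\otimes E'$-module) then $X\otimes_E Y$ (resp. $\mathrm{Hom}_E(X,Y)$) is a right $E'$-module. A (covariant) $\mathcal{M}$-functor is an $\mathcal{M}$-enriched functor, with maps $\mathrm{Hom}_E(X,Y)\to\mathrm{Hom}_{E'}(FX,FY)$,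 equivalently coherent natural maps $K\otimes FX\to F(K\otimes X)$. A contravariant $\mathcal{M}$-functor is a contravariant enriched functor, with maps $\mathrm{Hom}_E(X,Y)\to\mathrm{Hom}_{E'}(FY,FX)$, equivalently coherent natural maps $F(K\otimes X)\to\mathrm{Hom}(K,FX)$. $F$ is strict if the structure map $K\otimes FX\to F(K\otimes X)$ (resp. $F(K\otimes X)\to\mathrm{Hom}(K,FX)$ in the contravariant case) is an isomorphism for all $K\in\mathcal{M}$, $X\in\mathrm{Mod}\text{-}E$. In the covariant case $FE$ is an $E\text{-}E'$-bimodule via the adjoint of $E\cong\mathrm{Hom}_E(E,E)\to\mathrm{Hom}_{E'}(FE,FE)$, and $\tau_X$ is induced by the adjoint $X\otimes FE\to FX$ of $X\cong\mathrm{Hom}_E(E,X)\to\mathrm{Hom}_{E'}(FE,FX)$. In the contravariant case $FE$ is an $E\otimes E'$-module via $E^{\mathrm{op}}\cong\mathrm{Hom}_E(E,E)^{\mathrm{op}}\to\mathrm{Hom}_{E'}(FE,FE)$, and the natural map $FX\to\mathrm{Hom}_E(X,FE)$ is the one through which factors the adjoint $FX\to\mathrm{Hom}(X,FE)$ of $X\cong\mathrm{Hom}_E(E,X)\to\mathrm{Hom}_{E'}(FX,FE)$. *)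

theory Defs
  imports Main
begin

section \<open>Categories\<close>

record ('o, 'a) cat =
  Ob :: "'o set"
  Ar :: "'a set"
  src :: "'a \<Rightarrow> 'o"
  tgt :: "'a \<Rightarrow> 'o"
  idt :: "'o \<Rightarrow> 'a"
  cmp :: "'a \<Rightarrow> 'a \<Rightarrow> 'a"  (infixl "\<cdot>\<index>" 55)

definition hom :: "('o, 'a, 'z) cat_scheme \<Rightarrow> 'o \<Rightarrow> 'o \<Rightarrow> 'a set" where
  "hom C A B = {f \<in> Ar C. src C f = A \<and> tgt C f = B}"

locale category =
  fixes C :: "('o, 'a, 'z) cat_scheme" (structure)
  assumes src_Ob: "f \<in> Ar C \<Longrightarrow> src C f \<in> Ob C"
    and tgt_Ob: "f \<in> Ar C \<Longrightarrow> tgt C f \<in> Ob C"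
    and idt_hom: "A \<in> Ob C \<Longrightarrow> idt C A \<in> hom C A A"
    and cmp_hom: "\<lbrakk>f \<in> hom C A B; g \<in> hom C B D\<rbrakk> \<Longrightarrow> g \<cdot> f \<in> hom C A D"
    and cmp_idt: "f \<in> hom C A B \<Longrightarrow> f \<cdot> idt C A = f"
    and idt_cmp: "f \<in> hom C A B \<Longrightarrow> idt C B \<cdot> f = f"
    and cmp_assoc: "\<lbrakk>f \<in> hom C A B; g \<in> hom C B D; h \<in> hom C D E\<rbrakk>
      \<Longrightarrow> h \<cdot> g \<cdot> f = h \<cdot> (g \<cdot> f)"

definition inverse_arrows :: "('o, 'a, 'z) cat_scheme \<Rightarrow> 'a \<Rightarrow> 'a \<Rightarrow> bool" where
  "inverse_arrows C f g \<longleftrightarrow> f \<in> Ar C \<and> g \<in> hom C (tgt C f) (src C f) \<and>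
     g \<cdot>\<^bsub>C\<^esub> f = idt C (src C f) \<and> f \<cdot>\<^bsub>C\<^esub> g = idt C (tgt C f)"

definition is_iso :: "('o, 'a, 'z) cat_scheme \<Rightarrow> 'a \<Rightarrow> bool" where
  "is_iso C f \<longleftrightarrow> (\<exists>g. inverse_arrows C f g)"

definition inv_arr :: "('o, 'a, 'z) cat_scheme \<Rightarrow> 'a \<Rightarrow> 'a" where
  "inv_arr C f = (THE g. inverse_arrows C f g)"

definition is_equalizer :: "('o, 'a, 'z) cat_scheme \<Rightarrow> 'a \<Rightarrow> 'a \<Rightarrow> 'a \<Rightarrow> bool" where
  "is_equalizer C f g e \<longleftrightarrow>
     f \<in> Ar C \<and> g \<in> hom C (src C f) (tgt C f) \<and> e \<in> Ar C \<and> tgt C e = src C f \<and>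
     f \<cdot>\<^bsub>C\<^esub> e = g \<cdot>\<^bsub>C\<^esub> e \<and>
     (\<forall>h\<in>Ar C. tgt C h = src C f \<and> f \<cdot>\<^bsub>C\<^esub> h = g \<cdot>\<^bsub>C\<^esub> h \<longrightarrow>
        (\<exists>!k. k \<in> hom C (src C h) (src C e) \<and> e \<cdot>\<^bsub>C\<^esub> k = h))"

definition is_coequalizer :: "('o, 'a, 'z) cat_scheme \<Rightarrow> 'a \<Rightarrow> 'a \<Rightarrow> 'a \<Rightarrow> bool" where
  "is_coequalizer C f g q \<longleftrightarrow>
     f \<in> Ar C \<and> g \<in> hom C (src C f) (tgt C f) \<and> q \<in> Ar C \<and> src C q = tgt C f \<and>
     q \<cdot>\<^bsub>C\<^esub> f = q \<cdot>\<^bsub>C\<^esub> g \<and>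
     (\<forall>h\<in>Ar C. src C h = tgt C f \<and> h \<cdot>\<^bsub>C\<^esub> f = h \<cdot>\<^bsub>C\<^esub> g \<longrightarrow>
        (\<exists>!k. k \<in> hom C (tgt C q) (tgt C h) \<and> k \<cdot>\<^bsub>C\<^esub> q = h))"

text \<open>A choice of equalizer and coequalizer; nothing is known about them beyond the universal
  property, so a statement about them holds for every choice.\<close>

definition equ :: "('o, 'a, 'z) cat_scheme \<Rightarrow> 'a \<Rightarrow> 'a \<Rightarrow> 'a" where
  "equ C f g = (SOME e. is_equalizer C f g e)"

definition coequ :: "('o, 'a, 'z) cat_scheme \<Rightarrow> 'a \<Rightarrow> 'a \<Rightarrow> 'a" where
  "coequ C f g = (SOME q. is_coequalizer C f g q)"

definition is_diagram ::
  "('j, 'k, 'y) cat_scheme \<Rightarrow> ('o, 'a, 'z) cat_scheme \<Rightarrow> ('j \<Rightarrow> 'o) \<Rightarrow> ('k \<Rightarrow> 'a) \<Rightarrow> bool" where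
  "is_diagram J C D0 D1 \<longleftrightarrow>
     (\<forall>j\<in>Ob J. D0 j \<in> Ob C \<and> D1 (idt J j) = idt C (D0 j)) \<and>
     (\<forall>u\<in>Ar J. D1 u \<in> hom C (D0 (src J u)) (D0 (tgt J u))) \<and>
     (\<forall>u\<in>Ar J. \<forall>v\<in>Ar J. src J v = tgt J u \<longrightarrow> D1 (v \<cdot>\<^bsub>J\<^esub> u) = D1 v \<cdot>\<^bsub>C\<^esub> D1 u)"

definition is_cone where
  "is_cone J C D0 D1 L p \<longleftrightarrow>
     L \<in> Ob C \<and> (\<forall>j\<in>Ob J. p j \<in> hom C L (D0 j)) \<and>
     (\<forall>u\<in>Ar J. D1 u \<cdot>\<^bsub>C\<^esub> p (src J u) = p (tgt J u))"

definition is_cocone where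
  "is_cocone J C D0 D1 L i \<longleftrightarrow>
     L \<in> Ob C \<and> (\<forall>j\<in>Ob J. i j \<in> hom C (D0 j) L) \<and>
     (\<forall>u\<in>Ar J. i (tgt J u) \<cdot>\<^bsub>C\<^esub> D1 u = i (src J u))"

definition is_limit where
  "is_limit J C D0 D1 L p \<longleftrightarrow> is_cone J C D0 D1 L p \<and>
     (\<forall>L' p'. is_cone J C D0 D1 L' p' \<longrightarrow>
        (\<exists>!h. h \<in> hom C L' L \<and> (\<forall>j\<in>Ob J. p j \<cdot>\<^bsub>C\<^esub> h = p' j)))"

definition is_colimit where
  "is_colimit J C D0 D1 L i \<longleftrightarrow> is_cocone J C D0 D1 L i \<and>
     (\<forall>L' i'. is_cocone J C D0 D1 L' i' \<longrightarrow>
        (\<exists>!h. h \<in> hom C L L' \<and> (\<forall>j\<in>Ob J. h \<cdot>\<^bsub>C\<^esub> i j = i' j)))"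

text \<open>Every finite category is isomorphic to one whose objects and arrows are natural numbers, so it
  suffices to take index categories of this type.\<close>

definition has_finite_limits :: "('o, 'a, 'z) cat_scheme \<Rightarrow> bool" where
  "has_finite_limits C \<longleftrightarrow>
     (\<forall>(J :: (nat, nat) cat) D0 D1.
        category J \<and> finite (Ob J) \<and> finite (Ar J) \<and> is_diagram J C D0 D1 \<longrightarrow>
        (\<exists>L p. is_limit J C D0 D1 L p))"

definition has_finite_colimits :: "('o, 'a, 'z) cat_scheme \<Rightarrow> bool" where
  "has_finite_colimits C \<longleftrightarrow>
     (\<forall>(J :: (nat, nat) cat) D0 D1.
        category J \<and> finite (Ob J) \<and> finite (Ar J) \<and> is_diagram J C D0 D1 \<longrightarrow>
        (\<exists>L i. is_colimit J C D0 D1 L i))"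


section \<open>Closed symmetric monoidal categories\<close>

record ('o, 'a) csmc = "('o, 'a) cat" +
  ten :: "'o \<Rightarrow> 'o \<Rightarrow> 'o"  (infixl "\<otimes>\<index>" 70)
  tena :: "'a \<Rightarrow> 'a \<Rightarrow> 'a"  (infixl "\<boxtimes>\<index>" 70)
  unt :: "'o"
  asc :: "'o \<Rightarrow> 'o \<Rightarrow> 'o \<Rightarrow> 'a"
  lun :: "'o \<Rightarrow> 'a"
  run :: "'o \<Rightarrow> 'a"
  sym :: "'o \<Rightarrow> 'o \<Rightarrow> 'a"
  ihom :: "'o \<Rightarrow> 'o \<Rightarrow> 'o"
  ev :: "'o \<Rightarrow> 'o \<Rightarrow> 'a"

locale closed_symmetric_monoidal_category =
  category M for M :: "('o, 'a, 'z) csmc_scheme" (structure) +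
  assumes ten_Ob: "\<lbrakk>A \<in> Ob M; B \<in> Ob M\<rbrakk> \<Longrightarrow> A \<otimes> B \<in> Ob M"
    and tena_hom: "\<lbrakk>f \<in> hom M A B; g \<in> hom M A' B'\<rbrakk> \<Longrightarrow> f \<boxtimes> g \<in> hom M (A \<otimes> A') (B \<otimes> B')"
    and tena_idt: "\<lbrakk>A \<in> Ob M; B \<in> Ob M\<rbrakk> \<Longrightarrow> idt M A \<boxtimes> idt M B = idt M (A \<otimes> B)"
    and tena_cmp: "\<lbrakk>f \<in> hom M A B; g \<in> hom M B D; f' \<in> hom M A' B'; g' \<in> hom M B' D'\<rbrakk>
      \<Longrightarrow> (g \<cdot> f) \<boxtimes> (g' \<cdot> f') = (g \<boxtimes> g') \<cdot> (f \<boxtimes> f')"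
    and unt_Ob: "unt M \<in> Ob M"
    and asc_hom: "\<lbrakk>A \<in> Ob M; B \<in> Ob M; D \<in> Ob M\<rbrakk>
      \<Longrightarrow> asc M A B D \<in> hom M (A \<otimes> B \<otimes> D) (A \<otimes> (B \<otimes> D))"
    and asc_iso: "\<lbrakk>A \<in> Ob M; B \<in> Ob M; D \<in> Ob M\<rbrakk> \<Longrightarrow> is_iso M (asc M A B D)"
    and asc_nat: "\<lbrakk>f \<in> hom M A A'; g \<in> hom M B B'; h \<in> hom M D D'\<rbrakk>
      \<Longrightarrow> asc M A' B' D' \<cdot> (f \<boxtimes> g \<boxtimes> h) = (f \<boxtimes> (g \<boxtimes> h)) \<cdot> asc M A B D"
    and lun_hom: "A \<in> Ob M \<Longrightarrow> lun M A \<in> hom M (unt M \<otimes> A) A"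
    and lun_iso: "A \<in> Ob M \<Longrightarrow> is_iso M (lun M A)"
    and lun_nat: "f \<in> hom M A B \<Longrightarrow> lun M B \<cdot> (idt M (unt M) \<boxtimes> f) = f \<cdot> lun M A"
    and run_hom: "A \<in> Ob M \<Longrightarrow> run M A \<in> hom M (A \<otimes> unt M) A"
    and run_iso: "A \<in> Ob M \<Longrightarrow> is_iso M (run M A)"
    and run_nat: "f \<in> hom M A B \<Longrightarrow> run M B \<cdot> (f \<boxtimes> idt M (unt M)) = f \<cdot> run M A"
    and pentagon: "\<lbrakk>A \<in> Ob M; B \<in> Ob M; D \<in> Ob M; E \<in> Ob M\<rbrakk>
      \<Longrightarrow> asc M A B (D \<otimes> E) \<cdot> asc M (A \<otimes> B) D E =
          (idt M A \<boxtimes> asc M B D E) \<cdot> asc M A (B \<otimes> D) E \<cdot> (asc M A B D \<boxtimes> idt M E)"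
    and triangle: "\<lbrakk>A \<in> Ob M; B \<in> Ob M\<rbrakk>
      \<Longrightarrow> (idt M A \<boxtimes> lun M B) \<cdot> asc M A (unt M) B = run M A \<boxtimes> idt M B"
    and sym_hom: "\<lbrakk>A \<in> Ob M; B \<in> Ob M\<rbrakk> \<Longrightarrow> sym M A B \<in> hom M (A \<otimes> B) (B \<otimes> A)"
    and sym_nat: "\<lbrakk>f \<in> hom M A A'; g \<in> hom M B B'\<rbrakk>
      \<Longrightarrow> sym M A' B' \<cdot> (f \<boxtimes> g) = (g \<boxtimes> f) \<cdot> sym M A B"
    and sym_sym: "\<lbrakk>A \<in> Ob M; B \<in> Ob M\<rbrakk> \<Longrightarrow> sym M B A \<cdot> sym M A B = idt M (A \<otimes> B)"
    and hexagon: "\<lbrakk>A \<in> Ob M; B \<in> Ob M; D \<in> Ob M\<rbrakk>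
      \<Longrightarrow> asc M B D A \<cdot> sym M A (B \<otimes> D) \<cdot> asc M A B D =
          (idt M B \<boxtimes> sym M A D) \<cdot> asc M B A D \<cdot> (sym M A B \<boxtimes> idt M D)"
    \<comment> \<open>internal hom, right adjoint to tensoring on the right\<close>
    and ihom_Ob: "\<lbrakk>A \<in> Ob M; B \<in> Ob M\<rbrakk> \<Longrightarrow> ihom M A B \<in> Ob M"
    and ev_hom: "\<lbrakk>A \<in> Ob M; B \<in> Ob M\<rbrakk> \<Longrightarrow> ev M A B \<in> hom M (ihom M A B \<otimes> A) B"
    and ev_universal: "\<lbrakk>A \<in> Ob M; B \<in> Ob M; D \<in> Ob M; f \<in> hom M (D \<otimes> A) B\<rbrakk>
      \<Longrightarrow> \<exists>!g. g \<in> hom M D (ihom M A B) \<and> ev M A B \<cdot> (g \<boxtimes> idt M A) = f"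


section \<open>Monoids and modules\<close>

datatype ('o, 'a) mon = Monoid (mon_car: 'o) (mon_mul: 'a) (mon_unit: 'a)

datatype ('o, 'a) rmod = RMod (car: 'o) (act: 'a)

text \<open>Left action, then right action.\<close>

datatype ('o, 'a) bimod = Bimod (bcar: 'o) (lact: 'a) (ract: 'a)

text \<open>Arrows of a module category carry their source and target modules, because an arrow of the
  underlying category may be a module map for several module structures.\<close>

datatype ('o, 'a) mhom = MHom (msrc: "('o, 'a) rmod") (marr: 'a) (mtgt: "('o, 'a) rmod")

context
  fixes M :: "('o, 'a) csmc" (structure)
begin

text \<open>The adjoint \<open>D \<rightarrow> Hom(A, B)\<close> of \<open>f : D \<otimes> A \<rightarrow> B\<close>.\<close>

definition cur :: "'o \<Rightarrow> 'o \<Rightarrow> 'o \<Rightarrow> 'a \<Rightarrow> 'a" where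
  "cur D A B f = (THE g. g \<in> hom M D (ihom M A B) \<and> ev M A B \<cdot> (g \<boxtimes> idt M A) = f)"

text \<open>\<open>(A \<otimes> B) \<otimes> D \<rightarrow> (A \<otimes> D) \<otimes> B\<close>\<close>

definition swap :: "'o \<Rightarrow> 'o \<Rightarrow> 'o \<Rightarrow> 'a" where
  "swap A B D = inv_arr M (asc M A D B) \<cdot> (idt M A \<boxtimes> sym M B D) \<cdot> asc M A B D"

definition is_monoid :: "('o, 'a) mon \<Rightarrow> bool" where
  "is_monoid E \<longleftrightarrow>
     mon_car E \<in> Ob M \<and>
     mon_mul E \<in> hom M (mon_car E \<otimes> mon_car E) (mon_car E) \<and>
     mon_unit E \<in> hom M (unt M) (mon_car E) \<and>
     mon_mul E \<cdot> (mon_mul E \<boxtimes> idt M (mon_car E)) =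
       mon_mul E \<cdot> (idt M (mon_car E) \<boxtimes> mon_mul E) \<cdot> asc M (mon_car E) (mon_car E) (mon_car E) \<and>
     mon_mul E \<cdot> (mon_unit E \<boxtimes> idt M (mon_car E)) = lun M (mon_car E) \<and>
     mon_mul E \<cdot> (idt M (mon_car E) \<boxtimes> mon_unit E) = run M (mon_car E)"

definition is_rmod :: "('o, 'a) mon \<Rightarrow> ('o, 'a) rmod \<Rightarrow> bool" where
  "is_rmod E X \<longleftrightarrow>
     car X \<in> Ob M \<and>
     act X \<in> hom M (car X \<otimes> mon_car E) (car X) \<and>
     act X \<cdot> (act X \<boxtimes> idt M (mon_car E)) =
       act X \<cdot> (idt M (car X) \<boxtimes> mon_mul E) \<cdot> asc M (car X) (mon_car E) (mon_car E) \<and>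
     act X \<cdot> (idt M (car X) \<boxtimes> mon_unit E) = run M (car X)"

definition Mod_cat :: "('o, 'a) mon \<Rightarrow> (('o, 'a) rmod, ('o, 'a) mhom) cat" where
  "Mod_cat E = \<lparr>
     Ob = {X. is_rmod E X},
     Ar = {MHom X f Y | X f Y. is_rmod E X \<and> is_rmod E Y \<and> f \<in> hom M (car X) (car Y) \<and>
             act Y \<cdot> (f \<boxtimes> idt M (mon_car E)) = f \<cdot> act X},
     src = msrc,
     tgt = mtgt,
     idt = (\<lambda>X. MHom X (idt M (car X)) X),
     cmp = (\<lambda>g f. MHom (msrc f) (marr g \<cdot> marr f) (mtgt g))\<rparr>"

definition reg_mod :: "('o, 'a) mon \<Rightarrow> ('o, 'a) rmod" where
  "reg_mod E = RMod (mon_car E) (mon_mul E)"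

text \<open>The modules \<open>K \<otimes> X\<close> and \<open>Hom(K, X)\<close>; the second action is the adjoint of
  \<open>(Hom(K, X) \<otimes> E) \<otimes> K \<rightarrow> (Hom(K, X) \<otimes> K) \<otimes> E \<rightarrow> X \<otimes> E \<rightarrow> X\<close>.\<close>

definition ten_mod :: "('o, 'a) mon \<Rightarrow> 'o \<Rightarrow> ('o, 'a) rmod \<Rightarrow> ('o, 'a) rmod" where
  "ten_mod E K X = RMod (K \<otimes> car X) ((idt M K \<boxtimes> act X) \<cdot> asc M K (car X) (mon_car E))"

definition ihom_mod :: "('o, 'a) mon \<Rightarrow> 'o \<Rightarrow> ('o, 'a) rmod \<Rightarrow> ('o, 'a) rmod" where
  "ihom_mod E K X = RMod (ihom M K (car X))
     (cur (ihom M K (car X) \<otimes> mon_car E) K (car X)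
        (act X \<cdot> (ev M K (car X) \<boxtimes> idt M (mon_car E)) \<cdot> swap (ihom M K (car X)) (mon_car E) K))"

text \<open>The monoid \<open>E \<otimes> E'\<close> meant by right \<open>E \<otimes> E'\<close>-modules below; the multiplication is
  \<open>(E \<otimes> E') \<otimes> (E \<otimes> E') \<rightarrow> ((E \<otimes> E') \<otimes> E) \<otimes> E' \<rightarrow> ((E \<otimes> E) \<otimes> E') \<otimes> E' \<rightarrow> (E \<otimes> E) \<otimes> (E' \<otimes> E') \<rightarrow> E \<otimes> E'\<close>.\<close>

definition ten_mon :: "('o, 'a) mon \<Rightarrow> ('o, 'a) mon \<Rightarrow> ('o, 'a) mon" where
  "ten_mon E E' = Monoid (mon_car E \<otimes> mon_car E')
     ((mon_mul E \<boxtimes> mon_mul E') \<cdot>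
        asc M (mon_car E \<otimes> mon_car E) (mon_car E') (mon_car E') \<cdot>
        (swap (mon_car E) (mon_car E') (mon_car E) \<boxtimes> idt M (mon_car E')) \<cdot>
        inv_arr M (asc M (mon_car E \<otimes> mon_car E') (mon_car E) (mon_car E')))
     ((mon_unit E \<boxtimes> mon_unit E') \<cdot> inv_arr M (lun M (unt M)))"

text \<open>The \<open>E\<close>- and \<open>E'\<close>-module underlying a right \<open>E \<otimes> E'\<close>-module, by restriction along
  \<open>E \<cong> E \<otimes> S \<rightarrow> E \<otimes> E'\<close> and \<open>E' \<cong> S \<otimes> E' \<rightarrow> E \<otimes> E'\<close>.\<close>

definition restrict_fst :: "('o, 'a) mon \<Rightarrow> ('o, 'a) mon \<Rightarrow> ('o, 'a) rmod \<Rightarrow> ('o, 'a) rmod" where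
  "restrict_fst E E' Y = RMod (car Y)
     (act Y \<cdot> (idt M (car Y) \<boxtimes>
        ((idt M (mon_car E) \<boxtimes> mon_unit E') \<cdot> inv_arr M (run M (mon_car E)))))"

definition restrict_snd :: "('o, 'a) mon \<Rightarrow> ('o, 'a) mon \<Rightarrow> ('o, 'a) rmod \<Rightarrow> ('o, 'a) rmod" where
  "restrict_snd E E' Y = RMod (car Y)
     (act Y \<cdot> (idt M (car Y) \<boxtimes>
        ((mon_unit E \<boxtimes> idt M (mon_car E')) \<cdot> inv_arr M (lun M (mon_car E')))))"


section \<open>The enrichment of modules: \<open>Hom\<^sub>E\<close> and \<open>\<otimes>\<^sub>E\<close>\<close>

text \<open>The inclusion \<open>Hom\<^sub>E(X, Y) \<rightarrow> Hom(X, Y)\<close>. The two parallel maps are the adjoints of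
  \<open>Hom(X, Y) \<otimes> (X \<otimes> E) \<rightarrow> Hom(X, Y) \<otimes> X \<rightarrow> Y\<close> and
  \<open>Hom(X, Y) \<otimes> (X \<otimes> E) \<rightarrow> (Hom(X, Y) \<otimes> X) \<otimes> E \<rightarrow> Y \<otimes> E \<rightarrow> Y\<close>.\<close>

definition homE_incl :: "('o, 'a) mon \<Rightarrow> ('o, 'a) rmod \<Rightarrow> ('o, 'a) rmod \<Rightarrow> 'a" where
  "homE_incl E X Y = equ M
     (cur (ihom M (car X) (car Y)) (car X \<otimes> mon_car E) (car Y)
        (ev M (car X) (car Y) \<cdot> (idt M (ihom M (car X) (car Y)) \<boxtimes> act X)))
     (cur (ihom M (car X) (car Y)) (car X \<otimes> mon_car E) (car Y)
        (act Y \<cdot> (ev M (car X) (car Y) \<boxtimes> idt M (mon_car E)) \<cdot>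
           inv_arr M (asc M (ihom M (car X) (car Y)) (car X) (mon_car E))))"

definition homE :: "('o, 'a) mon \<Rightarrow> ('o, 'a) rmod \<Rightarrow> ('o, 'a) rmod \<Rightarrow> 'o" where
  "homE E X Y = src M (homE_incl E X Y)"

definition evE :: "('o, 'a) mon \<Rightarrow> ('o, 'a) rmod \<Rightarrow> ('o, 'a) rmod \<Rightarrow> 'a" where
  "evE E X Y = ev M (car X) (car Y) \<cdot> (homE_incl E X Y \<boxtimes> idt M (car X))"

text \<open>For a map of modules \<open>f : K \<otimes> X \<rightarrow> Y\<close>, the factorization \<open>K \<rightarrow> Hom\<^sub>E(X, Y)\<close> of its adjoint
  \<open>K \<rightarrow> Hom(X, Y)\<close>.\<close>

definition curE :: "('o, 'a) mon \<Rightarrow> 'o \<Rightarrow> ('o, 'a) rmod \<Rightarrow> ('o, 'a) rmod \<Rightarrow> 'a \<Rightarrow> 'a" where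
  "curE E K X Y f = (THE h. h \<in> hom M K (homE E X Y) \<and>
     homE_incl E X Y \<cdot> h = cur K (car X) (car Y) f)"

text \<open>The adjoint \<open>K \<otimes> X \<rightarrow> Y\<close> of \<open>h : K \<rightarrow> Hom\<^sub>E(X, Y)\<close>.\<close>

definition uncurE :: "('o, 'a) mon \<Rightarrow> ('o, 'a) rmod \<Rightarrow> ('o, 'a) rmod \<Rightarrow> 'a \<Rightarrow> 'a" where
  "uncurE E X Y h = evE E X Y \<cdot> (h \<boxtimes> idt M (car X))"

definition idE :: "('o, 'a) mon \<Rightarrow> ('o, 'a) rmod \<Rightarrow> 'a" where
  "idE E X = curE E (unt M) X X (lun M (car X))"

definition compE :: "('o, 'a) mon \<Rightarrow> ('o, 'a) rmod \<Rightarrow> ('o, 'a) rmod \<Rightarrow> ('o, 'a) rmod \<Rightarrow> 'a" where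
  "compE E X Y Z = curE E (homE E Y Z \<otimes> homE E X Y) X Z
     (evE E Y Z \<cdot> (idt M (homE E Y Z) \<boxtimes> evE E X Y) \<cdot> asc M (homE E Y Z) (homE E X Y) (car X))"

text \<open>The arrow \<open>S \<rightarrow> Hom\<^sub>E(X, Y)\<close> corresponding to a map of modules.\<close>

definition nameE :: "('o, 'a) mon \<Rightarrow> ('o, 'a) mhom \<Rightarrow> 'a" where
  "nameE E f = curE E (unt M) (msrc f) (mtgt f) (marr f \<cdot> lun M (car (msrc f)))"

text \<open>The map of modules corresponding to an arrow \<open>S \<rightarrow> Hom\<^sub>E(X, Y)\<close>.\<close>

definition unnameE :: "('o, 'a) mon \<Rightarrow> ('o, 'a) rmod \<Rightarrow> ('o, 'a) rmod \<Rightarrow> 'a \<Rightarrow> ('o, 'a) mhom" where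
  "unnameE E X Y h = MHom X (uncurE E X Y h \<cdot> inv_arr M (lun M (car X))) Y"

text \<open>The canonical isomorphism \<open>X \<rightarrow> Hom\<^sub>E(E, X)\<close>, adjoint to the action \<open>X \<otimes> E \<rightarrow> X\<close>.\<close>

definition yonE :: "('o, 'a) mon \<Rightarrow> ('o, 'a) rmod \<Rightarrow> 'a" where
  "yonE E X = curE E (car X) (reg_mod E) X (act X)"

text \<open>The quotient map \<open>X \<otimes> B \<rightarrow> X \<otimes>\<^sub>E B\<close> for a right \<open>E\<close>-module \<open>X\<close> and an \<open>E\<close>-\<open>E'\<close>-bimodule \<open>B\<close>,
  and the right \<open>E'\<close>-module \<open>X \<otimes>\<^sub>E B\<close>.\<close>

definition tenE_proj :: "('o, 'a) mon \<Rightarrow> ('o, 'a) rmod \<Rightarrow> ('o, 'a) bimod \<Rightarrow> 'a" where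
  "tenE_proj E X B = coequ M
     (act X \<boxtimes> idt M (bcar B))
     ((idt M (car X) \<boxtimes> lact B) \<cdot> asc M (car X) (mon_car E) (bcar B))"

definition tenE_mod ::
  "('o, 'a) mon \<Rightarrow> ('o, 'a) mon \<Rightarrow> ('o, 'a) rmod \<Rightarrow> ('o, 'a) bimod \<Rightarrow> ('o, 'a) rmod" where
  "tenE_mod E E' X B =
     (let q = tenE_proj E X B; T = tgt M q in
      RMod T (THE a. a \<in> hom M (T \<otimes> mon_car E') T \<and>
        a \<cdot> (q \<boxtimes> idt M (mon_car E')) =
          q \<cdot> (idt M (car X) \<boxtimes> ract B) \<cdot> asc M (car X) (bcar B) (mon_car E')))"

text \<open>The right \<open>E'\<close>-module \<open>Hom\<^sub>E(X, Y)\<close> for a right \<open>E\<close>-module \<open>X\<close> and a right \<open>E \<otimes> E'\<close>-module \<open>Y\<close>;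
  the action is the adjoint of
  \<open>(Hom\<^sub>E(X, Y) \<otimes> E') \<otimes> X \<rightarrow> (Hom\<^sub>E(X, Y) \<otimes> X) \<otimes> E' \<rightarrow> Y \<otimes> E' \<rightarrow> Y\<close>.\<close>

definition homE_mod ::
  "('o, 'a) mon \<Rightarrow> ('o, 'a) mon \<Rightarrow> ('o, 'a) rmod \<Rightarrow> ('o, 'a) rmod \<Rightarrow> ('o, 'a) rmod" where
  "homE_mod E E' X Y =
     (let Y1 = restrict_fst E E' Y; Y2 = restrict_snd E E' Y; H = homE E X Y1 in
      RMod H (curE E (H \<otimes> mon_car E') X Y1
        (act Y2 \<cdot> (evE E X Y1 \<boxtimes> idt M (mon_car E')) \<cdot> swap H (mon_car E') (car X))))"

end


section \<open>Enriched functors between module categories\<close>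

text \<open>The action on objects, and on hom objects: \<open>Hom\<^sub>E(X, Y) \<rightarrow> Hom\<^sub>E\<^sub>'(FX, FY)\<close> in the covariant case,
  \<open>Hom\<^sub>E(X, Y) \<rightarrow> Hom\<^sub>E\<^sub>'(FY, FX)\<close> in the contravariant case.\<close>

datatype ('o, 'a) mfun =
  MFun (fob: "('o, 'a) rmod \<Rightarrow> ('o, 'a) rmod") (fhom: "('o, 'a) rmod \<Rightarrow> ('o, 'a) rmod \<Rightarrow> 'a")

context
  fixes M :: "('o, 'a) csmc" (structure)
    and E E' :: "('o, 'a) mon"
begin

subsection \<open>Covariant\<close>

definition M_functor :: "('o, 'a) mfun \<Rightarrow> bool" where
  "M_functor F \<longleftrightarrow>
     (\<forall>X. is_rmod M E X \<longrightarrow> is_rmod M E' (fob F X)) \<and>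
     (\<forall>X Y. is_rmod M E X \<and> is_rmod M E Y \<longrightarrow>
        fhom F X Y \<in> hom M (homE M E X Y) (homE M E' (fob F X) (fob F Y))) \<and>
     (\<forall>X. is_rmod M E X \<longrightarrow> fhom F X X \<cdot> idE M E X = idE M E' (fob F X)) \<and>
     (\<forall>X Y Z. is_rmod M E X \<and> is_rmod M E Y \<and> is_rmod M E Z \<longrightarrow>
        fhom F X Z \<cdot> compE M E X Y Z =
          compE M E' (fob F X) (fob F Y) (fob F Z) \<cdot> (fhom F Y Z \<boxtimes> fhom F X Y))"

text \<open>The underlying functor: \<open>f : X \<rightarrow> Y\<close> is sent to the map corresponding to
  \<open>S \<rightarrow> Hom\<^sub>E(X, Y) \<rightarrow> Hom\<^sub>E\<^sub>'(FX, FY)\<close>.\<close>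

definition fmap :: "('o, 'a) mfun \<Rightarrow> ('o, 'a) mhom \<Rightarrow> ('o, 'a) mhom" where
  "fmap F f = unnameE M E' (fob F (msrc f)) (fob F (mtgt f))
     (fhom F (msrc f) (mtgt f) \<cdot> nameE M E f)"

definition preserves_coequalizers :: "('o, 'a) mfun \<Rightarrow> bool" where
  "preserves_coequalizers F \<longleftrightarrow>
     (\<forall>f g q. is_coequalizer (Mod_cat M E) f g q \<longrightarrow>
        is_coequalizer (Mod_cat M E') (fmap F f) (fmap F g) (fmap F q))"

text \<open>\<open>K \<otimes> FX \<rightarrow> F(K \<otimes> X)\<close>, adjoint to \<open>K \<rightarrow> Hom\<^sub>E(X, K \<otimes> X) \<rightarrow> Hom\<^sub>E\<^sub>'(FX, F(K \<otimes> X))\<close>.\<close>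

definition str_map :: "('o, 'a) mfun \<Rightarrow> 'o \<Rightarrow> ('o, 'a) rmod \<Rightarrow> ('o, 'a) mhom" where
  "str_map F K X =
     (let KX = ten_mod M E K X in
      MHom (ten_mod M E' K (fob F X))
        (uncurE M E' (fob F X) (fob F KX) (fhom F X KX \<cdot> curE M E K X KX (idt M (K \<otimes> car X))))
        (fob F KX))"

definition strict_M_functor :: "('o, 'a) mfun \<Rightarrow> bool" where
  "strict_M_functor F \<longleftrightarrow> M_functor F \<and>
     (\<forall>K X. K \<in> Ob M \<and> is_rmod M E X \<longrightarrow> is_iso (Mod_cat M E') (str_map F K X))"

text \<open>The \<open>E\<close>-\<open>E'\<close>-bimodule \<open>FE\<close>.\<close>

definition fun_bimod :: "('o, 'a) mfun \<Rightarrow> ('o, 'a) bimod" where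
  "fun_bimod F =
     (let R = reg_mod E in
      Bimod (car (fob F R))
        (uncurE M E' (fob F R) (fob F R) (fhom F R R \<cdot> yonE M E R))
        (act (fob F R)))"

text \<open>The map induced on the coequalizer by the adjoint \<open>X \<otimes> FE \<rightarrow> FX\<close> of
  \<open>X \<cong> Hom\<^sub>E(E, X) \<rightarrow> Hom\<^sub>E\<^sub>'(FE, FX)\<close>.\<close>

definition tau_map :: "('o, 'a) mfun \<Rightarrow> ('o, 'a) rmod \<Rightarrow> ('o, 'a) mhom" where
  "tau_map F X =
     (let R = reg_mod E; B = fun_bimod F; T = tenE_mod M E E' X B in
      MHom T
        (THE t. t \<in> hom M (car T) (car (fob F X)) \<and>
           t \<cdot> tenE_proj M E X B = uncurE M E' (fob F R) (fob F X) (fhom F R X \<cdot> yonE M E X))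
        (fob F X))"

subsection \<open>Contravariant\<close>

definition contra_M_functor :: "('o, 'a) mfun \<Rightarrow> bool" where
  "contra_M_functor F \<longleftrightarrow>
     (\<forall>X. is_rmod M E X \<longrightarrow> is_rmod M E' (fob F X)) \<and>
     (\<forall>X Y. is_rmod M E X \<and> is_rmod M E Y \<longrightarrow>
        fhom F X Y \<in> hom M (homE M E X Y) (homE M E' (fob F Y) (fob F X))) \<and>
     (\<forall>X. is_rmod M E X \<longrightarrow> fhom F X X \<cdot> idE M E X = idE M E' (fob F X)) \<and>
     (\<forall>X Y Z. is_rmod M E X \<and> is_rmod M E Y \<and> is_rmod M E Z \<longrightarrow>
        fhom F X Z \<cdot> compE M E X Y Z =
          compE M E' (fob F Z) (fob F Y) (fob F X) \<cdot> (fhom F X Y \<boxtimes> fhom F Y Z) \<cdot>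
            sym M (homE M E Y Z) (homE M E X Y))"

definition contra_fmap :: "('o, 'a) mfun \<Rightarrow> ('o, 'a) mhom \<Rightarrow> ('o, 'a) mhom" where
  "contra_fmap F f = unnameE M E' (fob F (mtgt f)) (fob F (msrc f))
     (fhom F (msrc f) (mtgt f) \<cdot> nameE M E f)"

definition coequalizers_to_equalizers :: "('o, 'a) mfun \<Rightarrow> bool" where
  "coequalizers_to_equalizers F \<longleftrightarrow>
     (\<forall>f g q. is_coequalizer (Mod_cat M E) f g q \<longrightarrow>
        is_equalizer (Mod_cat M E') (contra_fmap F f) (contra_fmap F g) (contra_fmap F q))"

text \<open>\<open>F(K \<otimes> X) \<rightarrow> Hom(K, FX)\<close>, adjoint (after the symmetry) to the adjoint \<open>K \<otimes> F(K \<otimes> X) \<rightarrow> FX\<close> of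
  \<open>K \<rightarrow> Hom\<^sub>E(X, K \<otimes> X) \<rightarrow> Hom\<^sub>E\<^sub>'(F(K \<otimes> X), FX)\<close>.\<close>

definition contra_str_map :: "('o, 'a) mfun \<Rightarrow> 'o \<Rightarrow> ('o, 'a) rmod \<Rightarrow> ('o, 'a) mhom" where
  "contra_str_map F K X =
     (let KX = ten_mod M E K X in
      MHom (fob F KX)
        (cur M (car (fob F KX)) K (car (fob F X))
           (uncurE M E' (fob F KX) (fob F X) (fhom F X KX \<cdot> curE M E K X KX (idt M (K \<otimes> car X))) \<cdot>
              sym M (car (fob F KX)) K))
        (ihom_mod M E' K (fob F X)))"

definition strict_contra_M_functor :: "('o, 'a) mfun \<Rightarrow> bool" where
  "strict_contra_M_functor F \<longleftrightarrow> contra_M_functor F \<and>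
     (\<forall>K X. K \<in> Ob M \<and> is_rmod M E X \<longrightarrow> is_iso (Mod_cat M E') (contra_str_map F K X))"

text \<open>The right \<open>E \<otimes> E'\<close>-module \<open>FE\<close>. The map \<open>E \<cong> Hom\<^sub>E(E, E) \<rightarrow> Hom\<^sub>E\<^sub>'(FE, FE)\<close> reverses
  multiplication, so its adjoint \<open>E \<otimes> FE \<rightarrow> FE\<close> composed with the symmetry is a right action of \<open>E\<close>,
  and \<open>E \<otimes> E'\<close> acts by \<open>FE \<otimes> (E \<otimes> E') \<rightarrow> (FE \<otimes> E) \<otimes> E' \<rightarrow> FE \<otimes> E' \<rightarrow> FE\<close>.\<close>

definition contra_fun_mod :: "('o, 'a) mfun \<Rightarrow> ('o, 'a) rmod" where
  "contra_fun_mod F =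
     (let R = reg_mod E; FE = fob F R;
          a = uncurE M E' FE FE (fhom F R R \<cdot> yonE M E R) \<cdot> sym M (car FE) (mon_car E) in
      RMod (car FE)
        (act FE \<cdot> (a \<boxtimes> idt M (mon_car E')) \<cdot>
           inv_arr M (asc M (car FE) (mon_car E) (mon_car E'))))"

text \<open>The factorization through \<open>Hom\<^sub>E(X, FE)\<close> of the adjoint \<open>FX \<rightarrow> Hom(X, FE)\<close> of
  \<open>X \<cong> Hom\<^sub>E(E, X) \<rightarrow> Hom\<^sub>E\<^sub>'(FX, FE)\<close>.\<close>

definition contra_tau_map :: "('o, 'a) mfun \<Rightarrow> ('o, 'a) rmod \<Rightarrow> ('o, 'a) mhom" where
  "contra_tau_map F X =
     (let R = reg_mod E; Y = contra_fun_mod F in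
      MHom (fob F X)
        (curE M E (car (fob F X)) X (restrict_fst M E E' Y)
           (uncurE M E' (fob F X) (fob F R) (fhom F R X \<cdot> yonE M E X) \<cdot>
              sym M (car (fob F X)) (car X)))
        (homE_mod M E E' X Y))"

end

end

theory Submission
  imports Defs
begin

text \<open>An enriched functor \<open>F\<close> acts on families of maps \<open>K \<otimes> X \<rightarrow> Y\<close> indexed by an object \<open>K\<close>, and this action is
  natural in \<open>K\<close> and compatible with composition. Every module \<open>X\<close> is the coequalizer of its bar
  resolution \<open>(X \<otimes> E) \<otimes> E \<rightrightarrows> X \<otimes> E\<close>, which splits in the underlying category. Applying \<open>F\<close> and replacing
  \<open>F(K \<otimes> E)\<close> by \<open>K \<otimes> FE\<close> exhibits \<open>FX\<close> as the coequalizer of \<open>(X \<otimes> E) \<otimes> FE \<rightrightarrows> X \<otimes> FE\<close> in modules; the two maps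
  are the ones defining \<open>X \<otimes>\<^sub>E FE\<close>, because \<open>F\<close> respects composition of families. Since \<open>- \<otimes> E'\<close>
  preserves coequalizers, \<open>X \<otimes>\<^sub>E FE\<close> is also a coequalizer in modules, so \<open>\<tau>\<close> compares two coequalizers of
  the same pair. The contravariant case is dual, with \<open>F(K \<otimes> E)\<close> replaced by \<open>Hom(K, FE)\<close>.\<close>

section \<open>Equalizers and coequalizers\<close>

text \<open>The hom objects have no elements, so identities between maps into
  \<open>Hom\<^sub>E\<^sub>'(FX, FY)\<close> are tested on adjoints
  \<open>K \<otimes> FX \<rightarrow> FY\<close>. There the axioms of an enriched functor give two
  rules, naturality in \<open>K\<close> and compatibility with composition. In the bar resolution
  the action on \<open>X\<close> is a change of index, treated by naturality, whereas the
  multiplication is a composition of families; this is where the action of \<open>E\<close> on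
  \<open>FE\<close> enters. Two obstacles shape the contravariant half. Reversing composition
  exchanges the index objects, so one square closes only through a coherence law for the symmetry.
  And the action of \<open>E'\<close> on \<open>Hom(K, FE)\<close> is awkward to compute with;
  strictness provides an isomorphism of modules onto \<open>Hom(K, FE)\<close>, and along it the
  linearity of the two parallel maps is inherited from \<open>F\<close> of the bar resolution. In
  both halves the natural map is specified by a unique description, and the isomorphism between the
  two universal objects is recognised by satisfying it.\<close>

lemma mem_hom [simp]: "f \<in> hom C A B \<longleftrightarrow> f \<in> Ar C \<and> src C f = A \<and> tgt C f = B"
  by (auto simp: hom_def)

context category
begin

declare src_Ob [simp] tgt_Ob [simp]

lemma idt_arr [simp]:
  assumes "A \<in> Ob C"
  shows "idt C A \<in> Ar C" "src C (idt C A) = A" "tgt C (idt C A) = A"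
  using idt_hom[OF assms] by auto

lemma cmp_arr [simp]:
  assumes "f \<in> Ar C" "g \<in> Ar C" "src C g = tgt C f"
  shows "g \<cdot> f \<in> Ar C" "src C (g \<cdot> f) = src C f" "tgt C (g \<cdot> f) = tgt C g"
  using cmp_hom[of f "src C f" "tgt C f" g "tgt C g"] assms by auto

lemma cmp_idt_arr [simp]: "\<lbrakk>f \<in> Ar C; src C f = A\<rbrakk> \<Longrightarrow> f \<cdot> idt C A = f"
  using cmp_idt[of f A "tgt C f"] by auto

lemma idt_cmp_arr [simp]: "\<lbrakk>f \<in> Ar C; tgt C f = A\<rbrakk> \<Longrightarrow> idt C A \<cdot> f = f"
  using idt_cmp[of f "src C f" A] by auto

lemma cmp_assoc_arr [simp]:
  "\<lbrakk>f \<in> Ar C; g \<in> Ar C; h \<in> Ar C; src C g = tgt C f; src C h = tgt C g\<rbrakk>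
    \<Longrightarrow> h \<cdot> g \<cdot> f = h \<cdot> (g \<cdot> f)"
  using cmp_assoc[of f "src C f" "tgt C f" g "tgt C g" h "tgt C h"] by auto

text \<open>The simplifier nests composites to the right, which hides \<open>g \<cdot> f\<close>
  inside \<open>g \<cdot> (f \<cdot> k)\<close>; this form lets an equation for
  \<open>g \<cdot> f\<close> act there.\<close>

lemma cmp_cmp_eq:
  assumes "g \<cdot> f = h" "k \<in> Ar C" "f \<in> Ar C" "g \<in> Ar C" "tgt C k = src C f" "src C g = tgt C f"
  shows "g \<cdot> (f \<cdot> k) = h \<cdot> k"
  using assms by (metis cmp_assoc_arr)

lemma inverse_arrows_unique:
  assumes "inverse_arrows C f g" "inverse_arrows C f h"
  shows "g = h"
proof -
  have "g = g \<cdot> (f \<cdot> h)" using assms by (simp add: inverse_arrows_def)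
  also have "\<dots> = (g \<cdot> f) \<cdot> h"
    by (rule cmp_assoc_arr[symmetric]) (use assms in \<open>auto simp: inverse_arrows_def\<close>)
  also have "\<dots> = h" using assms by (auto simp: inverse_arrows_def)
  finally show ?thesis .
qed

lemma inverse_arrows_inv_arr: "is_iso C f \<Longrightarrow> inverse_arrows C f (inv_arr C f)"
  unfolding is_iso_def inv_arr_def by (metis inverse_arrows_unique theI')

lemma is_iso_arr: "is_iso C f \<Longrightarrow> f \<in> Ar C"
  by (auto simp: is_iso_def inverse_arrows_def)

lemma inv_arr [simp]:
  assumes "is_iso C f"
  shows "inv_arr C f \<in> Ar C" "src C (inv_arr C f) = tgt C f" "tgt C (inv_arr C f) = src C f"
  using inverse_arrows_inv_arr[OF assms] by (auto simp: inverse_arrows_def)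

lemma inv_arr_cmp [simp]: "is_iso C f \<Longrightarrow> inv_arr C f \<cdot> f = idt C (src C f)"
  using inverse_arrows_inv_arr by (auto simp: inverse_arrows_def)

lemma cmp_inv_arr [simp]: "is_iso C f \<Longrightarrow> f \<cdot> inv_arr C f = idt C (tgt C f)"
  using inverse_arrows_inv_arr by (auto simp: inverse_arrows_def)

lemma inv_arr_cmp_cmp [simp]:
  "\<lbrakk>is_iso C f; k \<in> Ar C; tgt C k = src C f\<rbrakk> \<Longrightarrow> inv_arr C f \<cdot> (f \<cdot> k) = k"
  by (subst cmp_assoc_arr[symmetric]) (auto simp: is_iso_arr)

lemma cmp_inv_arr_cmp [simp]:
  "\<lbrakk>is_iso C f; k \<in> Ar C; tgt C k = tgt C f\<rbrakk> \<Longrightarrow> f \<cdot> (inv_arr C f \<cdot> k) = k"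
  by (subst cmp_assoc_arr[symmetric]) (auto simp: is_iso_arr)

lemma is_isoI:
  assumes "f \<in> Ar C" "g \<in> Ar C" "src C g = tgt C f" "tgt C g = src C f"
    "g \<cdot> f = idt C (src C f)" "f \<cdot> g = idt C (tgt C f)"
  shows "is_iso C f"
  using assms unfolding is_iso_def inverse_arrows_def by auto

lemma iso_cancel_right:
  assumes "is_iso C e" "f \<in> Ar C" "g \<in> Ar C" "src C f = tgt C e" "src C g = tgt C e"
    "f \<cdot> e = g \<cdot> e"
  shows "f = g"
proof -
  have "f = f \<cdot> e \<cdot> inv_arr C e" "g = g \<cdot> e \<cdot> inv_arr C e"
    using assms(1-5) is_iso_arr[OF assms(1)] by simp_all
  then show ?thesis using assms(6) by metis
qed

lemma iso_cancel_left:
  assumes "is_iso C e" "f \<in> Ar C" "g \<in> Ar C" "tgt C f = src C e" "tgt C g = src C e"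
    "e \<cdot> f = e \<cdot> g"
  shows "f = g"
  by (metis assms inv_arr_cmp_cmp)

text \<open>Reverses the two isomorphisms of a commuting square, which yields naturality of inverse
  associators and unitors.\<close>

lemma inv_arr_commute:
  assumes "is_iso C i" "is_iso C j" "f \<in> Ar C" "g \<in> Ar C"
    "src C f = src C j" "tgt C f = src C i" "src C g = tgt C j" "tgt C g = tgt C i"
    "i \<cdot> f = g \<cdot> j"
  shows "inv_arr C i \<cdot> g = f \<cdot> inv_arr C j"
proof (rule iso_cancel_left[OF assms(1)])
  have "i \<cdot> (f \<cdot> inv_arr C j) = (i \<cdot> f) \<cdot> inv_arr C j"
    using assms(1-8) by (simp add: is_iso_arr)
  also have "\<dots> = g" using assms by (simp add: is_iso_arr)
  finally show "i \<cdot> (inv_arr C i \<cdot> g) = i \<cdot> (f \<cdot> inv_arr C j)"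
    using assms by simp
qed (use assms in auto)

section \<open>Universal properties and their transport along isomorphisms\<close>

lemma coequalizer_arr:
  assumes "is_coequalizer C f g q"
  shows "f \<in> Ar C" "g \<in> Ar C" "q \<in> Ar C" "src C g = src C f" "tgt C g = tgt C f"
    "src C q = tgt C f" "q \<cdot> f = q \<cdot> g"
  using assms by (auto simp: is_coequalizer_def)

lemma coequalizer_factor:
  assumes "is_coequalizer C f g q" "h \<in> Ar C" "src C h = tgt C f" "h \<cdot> f = h \<cdot> g"
  obtains k where "k \<in> Ar C" "src C k = tgt C q" "tgt C k = tgt C h" "k \<cdot> q = h"
  using assms unfolding is_coequalizer_def mem_hom by metis

lemma coequalizer_epi:
  assumes "is_coequalizer C f g q" "h \<in> Ar C" "k \<in> Ar C" "src C h = tgt C q" "src C k = tgt C q"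
    "h \<cdot> q = k \<cdot> q"
  shows "h = k"
proof -
  note c = coequalizer_arr[OF assms(1)]
  \<comment> \<open>The uniqueness clause only compares maps with the same target, so the targets
    are matched before it is applied to the common composite with \<open>q\<close>.\<close>
  have "tgt C h = tgt C k" using assms c by (metis cmp_arr(3))
  moreover have "(h \<cdot> q) \<cdot> f = (h \<cdot> q) \<cdot> g" using c assms(2-5) by simp
  ultimately show ?thesis
    using assms c unfolding is_coequalizer_def mem_hom by (metis cmp_arr)
qed

lemma is_coequalizerI:
  assumes "f \<in> Ar C" "g \<in> Ar C" "q \<in> Ar C" "src C g = src C f" "tgt C g = tgt C f"
    "src C q = tgt C f" "q \<cdot> f = q \<cdot> g"
    "\<And>h. \<lbrakk>h \<in> Ar C; src C h = tgt C f; h \<cdot> f = h \<cdot> g\<rbrakk>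
      \<Longrightarrow> \<exists>k. k \<in> Ar C \<and> src C k = tgt C q \<and> tgt C k = tgt C h \<and> k \<cdot> q = h"
    "\<And>h k. \<lbrakk>h \<in> Ar C; k \<in> Ar C; src C h = tgt C q; src C k = tgt C q; h \<cdot> q = k \<cdot> q\<rbrakk> \<Longrightarrow> h = k"
  shows "is_coequalizer C f g q"
  unfolding is_coequalizer_def mem_hom using assms by metis

lemma equalizer_arr:
  assumes "is_equalizer C f g e"
  shows "f \<in> Ar C" "g \<in> Ar C" "e \<in> Ar C" "src C g = src C f" "tgt C g = tgt C f"
    "tgt C e = src C f" "f \<cdot> e = g \<cdot> e"
  using assms by (auto simp: is_equalizer_def)

lemma equalizer_factor:
  assumes "is_equalizer C f g e" "h \<in> Ar C" "tgt C h = src C f" "f \<cdot> h = g \<cdot> h"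
  obtains k where "k \<in> Ar C" "src C k = src C h" "tgt C k = src C e" "e \<cdot> k = h"
  using assms unfolding is_equalizer_def mem_hom by metis

lemma equalizer_mono:
  assumes "is_equalizer C f g e" "h \<in> Ar C" "k \<in> Ar C" "tgt C h = src C e" "tgt C k = src C e"
    "e \<cdot> h = e \<cdot> k"
  shows "h = k"
proof -
  note c = equalizer_arr[OF assms(1)]
  have "src C h = src C k" using assms c by (metis cmp_arr(2))
  moreover have "f \<cdot> (e \<cdot> h) = g \<cdot> (e \<cdot> h)"
    using c assms(2-5) by (simp add: cmp_cmp_eq[OF c(7)])
  ultimately show ?thesis
    using assms c unfolding is_equalizer_def mem_hom by (metis cmp_arr)
qed

lemma is_equalizerI:
  assumes "f \<in> Ar C" "g \<in> Ar C" "e \<in> Ar C" "src C g = src C f" "tgt C g = tgt C f"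
    "tgt C e = src C f" "f \<cdot> e = g \<cdot> e"
    "\<And>h. \<lbrakk>h \<in> Ar C; tgt C h = src C f; f \<cdot> h = g \<cdot> h\<rbrakk>
      \<Longrightarrow> \<exists>k. k \<in> Ar C \<and> src C k = src C h \<and> tgt C k = src C e \<and> e \<cdot> k = h"
    "\<And>h k. \<lbrakk>h \<in> Ar C; k \<in> Ar C; tgt C h = src C e; tgt C k = src C e; e \<cdot> h = e \<cdot> k\<rbrakk> \<Longrightarrow> h = k"
  shows "is_equalizer C f g e"
  unfolding is_equalizer_def mem_hom using assms by metis

text \<open>The clause \<open>t \<cdot> q = r\<close> matters as much as invertibility: it later
  identifies \<open>t\<close> with the map that a description by \<open>THE\<close> singles
  out.\<close>

lemma coequalizers_iso:
  assumes "is_coequalizer C f g q" "is_coequalizer C f g r"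
  obtains t where "is_iso C t" "src C t = tgt C q" "tgt C t = tgt C r" "t \<cdot> q = r"
proof -
  note q = coequalizer_arr[OF assms(1)] and r = coequalizer_arr[OF assms(2)]
  obtain t where t: "t \<in> Ar C" "src C t = tgt C q" "tgt C t = tgt C r" "t \<cdot> q = r"
    using coequalizer_factor[OF assms(1)] r by metis
  obtain s where s: "s \<in> Ar C" "src C s = tgt C r" "tgt C s = tgt C q" "s \<cdot> r = q"
    using coequalizer_factor[OF assms(2)] q by metis
  have "s \<cdot> t = idt C (src C t)"
    by (rule coequalizer_epi[OF assms(1)]) (use q r s t in auto)
  moreover have "t \<cdot> s = idt C (tgt C t)"
    by (rule coequalizer_epi[OF assms(2)]) (use q r s t in auto)
  ultimately show thesis using that is_isoI[of t s] s t by auto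
qed

lemma equalizers_iso:
  assumes "is_equalizer C f g d" "is_equalizer C f g e"
  obtains t where "is_iso C t" "src C t = src C d" "tgt C t = src C e" "e \<cdot> t = d"
proof -
  note d = equalizer_arr[OF assms(1)] and e = equalizer_arr[OF assms(2)]
  obtain t where t: "t \<in> Ar C" "src C t = src C d" "tgt C t = src C e" "e \<cdot> t = d"
    using equalizer_factor[OF assms(2)] d by metis
  obtain s where s: "s \<in> Ar C" "src C s = src C e" "tgt C s = src C d" "d \<cdot> s = e"
    using equalizer_factor[OF assms(1)] e by metis
  have "s \<cdot> t = idt C (src C t)"
    by (rule equalizer_mono[OF assms(1)]) (use d e s t in \<open>auto simp: cmp_cmp_eq[OF t(4)] cmp_cmp_eq[OF s(4)]\<close>)
  moreover have "t \<cdot> s = idt C (tgt C t)"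
    by (rule equalizer_mono[OF assms(2)]) (use d e s t in \<open>auto simp: cmp_cmp_eq[OF t(4)] cmp_cmp_eq[OF s(4)]\<close>)
  ultimately show thesis using that is_isoI[of t s] s t by auto
qed

text \<open>The isomorphisms point into the given pair because the covariant strength maps
  \<open>K \<otimes> FE \<rightarrow> F(K \<otimes> E)\<close> point into \<open>F\<close> of the
  bar resolution.\<close>

lemma coequalizer_transport:
  assumes co: "is_coequalizer C f g q"
    and i: "is_iso C i" "tgt C i = src C q" and j: "is_iso C j" "tgt C j = src C f"
    and f': "f' \<in> Ar C" "src C f' = src C j" "tgt C f' = src C i" "i \<cdot> f' = f \<cdot> j"
    and g': "g' \<in> Ar C" "src C g' = src C j" "tgt C g' = src C i" "i \<cdot> g' = g \<cdot> j"
  shows "is_coequalizer C f' g' (q \<cdot> i)"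
proof -
  note q = coequalizer_arr[OF co] and [simp] = is_iso_arr[OF i(1)] is_iso_arr[OF j(1)]
  note s = q i j f' g'
  have inv: "inv_arr C i \<cdot> f = f' \<cdot> inv_arr C j" "inv_arr C i \<cdot> g = g' \<cdot> inv_arr C j"
    by (rule inv_arr_commute; use s in simp)+
  show ?thesis
  proof (rule is_coequalizerI)
    show "q \<cdot> i \<cdot> f' = q \<cdot> i \<cdot> g'" using s by (simp add: cmp_cmp_eq[OF q(7)])
  next
    fix h assume h: "h \<in> Ar C" "src C h = tgt C f'" "h \<cdot> f' = h \<cdot> g'"
    have "(h \<cdot> f') \<cdot> inv_arr C j = (h \<cdot> g') \<cdot> inv_arr C j" using h by simp
    then have "(h \<cdot> inv_arr C i) \<cdot> f = (h \<cdot> inv_arr C i) \<cdot> g"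
      using h(1,2) s inv by (simp add: cmp_cmp_eq[OF h(3)])
    then obtain k where k: "k \<in> Ar C" "src C k = tgt C q" "tgt C k = tgt C (h \<cdot> inv_arr C i)"
      "k \<cdot> q = h \<cdot> inv_arr C i"
      using coequalizer_factor[OF co, of "h \<cdot> inv_arr C i"] h s by auto
    show "\<exists>k. k \<in> Ar C \<and> src C k = tgt C (q \<cdot> i) \<and> tgt C k = tgt C h \<and> k \<cdot> (q \<cdot> i) = h"
      using h(1,2) s k by (intro exI[of _ k]) (simp add: cmp_cmp_eq[OF k(4)])
  next
    fix h k assume h: "h \<in> Ar C" "k \<in> Ar C" "src C h = tgt C (q \<cdot> i)" "src C k = tgt C (q \<cdot> i)"
      "h \<cdot> (q \<cdot> i) = k \<cdot> (q \<cdot> i)"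
    have "h \<cdot> q = k \<cdot> q"
      by (rule iso_cancel_right[OF i(1)]) (use h s(1-11) in \<open>simp_all\<close>)
    then show "h = k" by (rule coequalizer_epi[OF co, rotated -1]) (use h s(1-11) in auto)
  qed (use s in auto)
qed

text \<open>Here the isomorphisms leave the given pair, as the contravariant strength maps
  \<open>F(K \<otimes> E) \<rightarrow> Hom(K, FE)\<close> do.\<close>

lemma equalizer_transport:
  assumes co: "is_equalizer C f g e"
    and i: "is_iso C i" "src C i = tgt C e" and j: "is_iso C j" "src C j = tgt C f"
    and f': "f' \<in> Ar C" "src C f' = tgt C i" "tgt C f' = tgt C j" "f' \<cdot> i = j \<cdot> f"
    and g': "g' \<in> Ar C" "src C g' = tgt C i" "tgt C g' = tgt C j" "g' \<cdot> i = j \<cdot> g"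
  shows "is_equalizer C f' g' (i \<cdot> e)"
proof -
  note q = equalizer_arr[OF co] and [simp] = is_iso_arr[OF i(1)] is_iso_arr[OF j(1)]
  note s = q i j f' g'
  have inv: "inv_arr C j \<cdot> f' = f \<cdot> inv_arr C i" "inv_arr C j \<cdot> g' = g \<cdot> inv_arr C i"
    by (rule inv_arr_commute; use s in simp)+
  show ?thesis
  proof (rule is_equalizerI)
    show "f' \<cdot> (i \<cdot> e) = g' \<cdot> (i \<cdot> e)"
      using s by (simp add: cmp_cmp_eq[OF f'(4)] cmp_cmp_eq[OF g'(4)])
  next
    fix h assume h: "h \<in> Ar C" "tgt C h = src C f'" "f' \<cdot> h = g' \<cdot> h"
    have "(inv_arr C j \<cdot> f') \<cdot> h = (inv_arr C j \<cdot> g') \<cdot> h" using h s by simp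
    then have "f \<cdot> (inv_arr C i \<cdot> h) = g \<cdot> (inv_arr C i \<cdot> h)" using h s unfolding inv by simp
    then obtain k where k: "k \<in> Ar C" "src C k = src C h" "tgt C k = src C e"
      "e \<cdot> k = inv_arr C i \<cdot> h"
      using equalizer_factor[OF co, of "inv_arr C i \<cdot> h"] h s by auto
    have "(i \<cdot> e) \<cdot> k = h" using h s k by simp
    then show "\<exists>k. k \<in> Ar C \<and> src C k = src C h \<and> tgt C k = src C (i \<cdot> e) \<and> i \<cdot> e \<cdot> k = h"
      using h s k by (intro exI[of _ k]) simp
  next
    fix h k assume h: "h \<in> Ar C" "k \<in> Ar C" "tgt C h = src C (i \<cdot> e)" "tgt C k = src C (i \<cdot> e)"
      "i \<cdot> e \<cdot> h = i \<cdot> e \<cdot> k"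
    have "e \<cdot> h = e \<cdot> k" by (rule iso_cancel_left[OF i(1)]) (use h s in auto)
    then show "h = k" by (rule equalizer_mono[OF co, rotated -1]) (use h s in auto)
  qed (use s in auto)
qed

end

text \<open>The index category of a parallel pair: the objects \<open>0\<close>, \<open>1\<close> have the identity arrows \<open>0\<close>, \<open>1\<close>, and
  the arrows \<open>2\<close>, \<open>3\<close> go from \<open>0\<close> to \<open>1\<close>.\<close>

definition parallel_pair :: "(nat, nat) cat" where
  "parallel_pair = \<lparr>Ob = {0, 1}, Ar = {0, 1, 2, 3},
     src = (\<lambda>u. if u = 1 then 1 else 0), tgt = (\<lambda>u. if u = 0 then 0 else 1),
     idt = (\<lambda>j. j), cmp = (\<lambda>v u. if u < 2 then v else u)\<rparr>"

lemma category_parallel_pair: "category parallel_pair"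
proof unfold_locales
  fix f g A B D assume "f \<in> hom parallel_pair A B" "g \<in> hom parallel_pair B D"
  then show "g \<cdot>\<^bsub>parallel_pair\<^esub> f \<in> hom parallel_pair A D"
    by (auto simp: parallel_pair_def)
next
  fix f g h A B D E
  assume "f \<in> hom parallel_pair A B" "g \<in> hom parallel_pair B D" "h \<in> hom parallel_pair D E"
  show "h \<cdot>\<^bsub>parallel_pair\<^esub> g \<cdot>\<^bsub>parallel_pair\<^esub> f = h \<cdot>\<^bsub>parallel_pair\<^esub> (g \<cdot>\<^bsub>parallel_pair\<^esub> f)"
    by (simp add: parallel_pair_def)
qed (auto simp: parallel_pair_def)

context category
begin

definition pair_diagram :: "'a \<Rightarrow> 'a \<Rightarrow> nat \<Rightarrow> 'a" where
  "pair_diagram f g u =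
     (if u = 0 then idt C (src C f) else if u = 1 then idt C (tgt C f) else if u = 2 then f else g)"

lemma is_diagram_pair:
  assumes "f \<in> Ar C" "g \<in> Ar C" "src C g = src C f" "tgt C g = tgt C f"
  shows "is_diagram parallel_pair C (\<lambda>j. if j = 0 then src C f else tgt C f) (pair_diagram f g)"
  using assms by (simp add: is_diagram_def parallel_pair_def pair_diagram_def split del: if_split)

lemma has_equalizers:
  assumes lim: "has_finite_limits C"
    and fg: "f \<in> Ar C" "g \<in> Ar C" "src C g = src C f" "tgt C g = tgt C f"
  shows "is_equalizer C f g (equ C f g)"
proof -
  let ?D0 = "\<lambda>j. if j = (0::nat) then src C f else tgt C f" and ?D1 = "pair_diagram f g"
  \<comment> \<open>The leg at \<open>1\<close> is forced to be the common composite with the leg at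
    \<open>0\<close>, so a cone is the same as a map equalizing the pair.\<close>
  have cone: "is_cone parallel_pair C ?D0 ?D1 L p \<longleftrightarrow>
      L \<in> Ob C \<and> p 0 \<in> hom C L (src C f) \<and> p 1 \<in> hom C L (tgt C f) \<and> f \<cdot> p 0 = p 1 \<and> g \<cdot> p 0 = p 1"
    for L p
    using fg by (auto simp: is_cone_def parallel_pair_def pair_diagram_def)
  have fin: "finite (Ob parallel_pair)" "finite (Ar parallel_pair)"
    by (auto simp: parallel_pair_def)
  obtain L p where L: "is_limit parallel_pair C ?D0 ?D1 L p"
    using lim category_parallel_pair fin is_diagram_pair[OF fg] unfolding has_finite_limits_def by blast
  note c = L[unfolded is_limit_def, THEN conjunct1, unfolded cone mem_hom]
  have univ: "\<exists>!h. h \<in> hom C L' L \<and> p 0 \<cdot> h = p' 0 \<and> p 1 \<cdot> h = p' 1"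
    if "is_cone parallel_pair C ?D0 ?D1 L' p'" for L' p'
    using L that by (simp add: is_limit_def parallel_pair_def)
  have "is_equalizer C f g (p 0)"
    unfolding is_equalizer_def
  proof (intro conjI ballI impI)
    fix h assume h: "h \<in> Ar C" "tgt C h = src C f \<and> f \<cdot> h = g \<cdot> h"
    let ?p = "\<lambda>j. if j = (0::nat) then h else f \<cdot> h"
    have "is_cone parallel_pair C ?D0 ?D1 (src C h) ?p"
      unfolding cone using h fg by simp
    from univ[OF this] have "\<exists>!k. k \<in> hom C (src C h) L \<and> p 0 \<cdot> k = h \<and> p 1 \<cdot> k = f \<cdot> h" by simp
    \<comment> \<open>The limit gives uniqueness among maps compatible with both legs; compatibility
      at \<open>1\<close> follows from compatibility at \<open>0\<close>, so the uniqueness claim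
      can drop it.\<close>
    moreover have "p 1 \<cdot> k = f \<cdot> h" if "k \<in> hom C (src C h) L" "p 0 \<cdot> k = h" for k
    proof -
      have "p 1 \<cdot> k = (f \<cdot> p 0) \<cdot> k" using c by simp
      also have "\<dots> = f \<cdot> (p 0 \<cdot> k)" by (rule cmp_assoc_arr) (use c that fg in auto)
      also have "\<dots> = f \<cdot> h" using that by simp
      finally show ?thesis .
    qed
    ultimately show "\<exists>!k. k \<in> hom C (src C h) (src C (p 0)) \<and> p 0 \<cdot> k = h"
      using c by metis
  qed (use c fg in auto)
  then show ?thesis unfolding equ_def by (rule someI)
qed

lemma has_coequalizers:
  assumes lim: "has_finite_colimits C"
    and fg: "f \<in> Ar C" "g \<in> Ar C" "src C g = src C f" "tgt C g = tgt C f"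
  shows "is_coequalizer C f g (coequ C f g)"
proof -
  let ?D0 = "\<lambda>j. if j = (0::nat) then src C f else tgt C f" and ?D1 = "pair_diagram f g"
  \<comment> \<open>Dually, the leg at \<open>1\<close> determines the cocone, so \<open>p 1\<close>
    becomes the coequalizer.\<close>
  have cocone: "is_cocone parallel_pair C ?D0 ?D1 L p \<longleftrightarrow>
      L \<in> Ob C \<and> p 0 \<in> hom C (src C f) L \<and> p 1 \<in> hom C (tgt C f) L \<and> p 1 \<cdot> f = p 0 \<and> p 1 \<cdot> g = p 0"
    for L p
    using fg by (auto simp: is_cocone_def parallel_pair_def pair_diagram_def)
  have fin: "finite (Ob parallel_pair)" "finite (Ar parallel_pair)"
    by (auto simp: parallel_pair_def)
  obtain L p where L: "is_colimit parallel_pair C ?D0 ?D1 L p"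
    using lim category_parallel_pair fin is_diagram_pair[OF fg] unfolding has_finite_colimits_def by blast
  note c = L[unfolded is_colimit_def, THEN conjunct1, unfolded cocone mem_hom]
  have univ: "\<exists>!h. h \<in> hom C L L' \<and> h \<cdot> p 0 = p' 0 \<and> h \<cdot> p 1 = p' 1"
    if "is_cocone parallel_pair C ?D0 ?D1 L' p'" for L' p'
    using L that by (simp add: is_colimit_def parallel_pair_def)
  have "is_coequalizer C f g (p 1)"
    unfolding is_coequalizer_def
  proof (intro conjI ballI impI)
    fix h assume h: "h \<in> Ar C" "src C h = tgt C f \<and> h \<cdot> f = h \<cdot> g"
    let ?p = "\<lambda>j. if j = (1::nat) then h else h \<cdot> f"
    have "is_cocone parallel_pair C ?D0 ?D1 (tgt C h) ?p"
      unfolding cocone using h fg by simp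
    from univ[OF this] have "\<exists>!k. k \<in> hom C L (tgt C h) \<and> k \<cdot> p 0 = h \<cdot> f \<and> k \<cdot> p 1 = h" by simp
    moreover have "k \<cdot> p 0 = h \<cdot> f" if "k \<in> hom C L (tgt C h)" "k \<cdot> p 1 = h" for k
    proof -
      have "k \<cdot> p 0 = k \<cdot> (p 1 \<cdot> f)" using c by simp
      also have "\<dots> = (k \<cdot> p 1) \<cdot> f"
        by (rule cmp_assoc_arr[symmetric]) (use c that fg in auto)
      finally show ?thesis using that by simp
    qed
    ultimately show "\<exists>!k. k \<in> hom C (tgt C (p 1)) (tgt C h) \<and> k \<cdot> p 1 = h"
      using c by metis
  qed (use c fg in auto)
  then show ?thesis unfolding coequ_def by (rule someI)
qed

end

section \<open>Coherence in symmetric monoidal categories\<close>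

context closed_symmetric_monoidal_category
begin

declare ten_Ob [simp] tena_idt [simp] unt_Ob [simp] asc_iso [simp] lun_iso [simp] run_iso [simp]
  sym_sym [simp] ihom_Ob [simp]

lemma tena_arr [simp]:
  assumes "f \<in> Ar M" "g \<in> Ar M"
  shows "f \<boxtimes> g \<in> Ar M" "src M (f \<boxtimes> g) = src M f \<otimes> src M g" "tgt M (f \<boxtimes> g) = tgt M f \<otimes> tgt M g"
  using tena_hom[of f "src M f" "tgt M f" g "src M g" "tgt M g"] assms by auto

lemma asc_arr [simp]:
  assumes "A \<in> Ob M" "B \<in> Ob M" "D \<in> Ob M"
  shows "asc M A B D \<in> Ar M" "src M (asc M A B D) = A \<otimes> B \<otimes> D" "tgt M (asc M A B D) = A \<otimes> (B \<otimes> D)"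
  using asc_hom[OF assms] by auto

lemma lun_arr [simp]:
  assumes "A \<in> Ob M"
  shows "lun M A \<in> Ar M" "src M (lun M A) = unt M \<otimes> A" "tgt M (lun M A) = A"
  using lun_hom[OF assms] by auto

lemma run_arr [simp]:
  assumes "A \<in> Ob M"
  shows "run M A \<in> Ar M" "src M (run M A) = A \<otimes> unt M" "tgt M (run M A) = A"
  using run_hom[OF assms] by auto

lemma sym_arr [simp]:
  assumes "A \<in> Ob M" "B \<in> Ob M"
  shows "sym M A B \<in> Ar M" "src M (sym M A B) = A \<otimes> B" "tgt M (sym M A B) = B \<otimes> A"
  using sym_hom[OF assms] by auto

lemma ev_arr [simp]:
  assumes "A \<in> Ob M" "B \<in> Ob M"
  shows "ev M A B \<in> Ar M" "src M (ev M A B) = ihom M A B \<otimes> A" "tgt M (ev M A B) = B"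
  using ev_hom[OF assms] by auto

lemma sym_iso [simp]: "\<lbrakk>A \<in> Ob M; B \<in> Ob M\<rbrakk> \<Longrightarrow> is_iso M (sym M A B)"
  by (rule is_isoI[of _ "sym M B A"]) simp_all

lemma sym_sym_cmp [simp]:
  "\<lbrakk>A \<in> Ob M; B \<in> Ob M; k \<in> Ar M; tgt M k = A \<otimes> B\<rbrakk> \<Longrightarrow> sym M B A \<cdot> (sym M A B \<cdot> k) = k"
  by (subst cmp_cmp_eq[OF sym_sym]) simp_all

text \<open>The interchange law, oriented so as to fuse tensor products. It stays outside the simp
  set and is called as \<open>merge\<close> where a calculation is to be collected.\<close>

lemma tena_merge:
  assumes "f \<in> Ar M" "g \<in> Ar M" "src M g = tgt M f" "f' \<in> Ar M" "g' \<in> Ar M" "src M g' = tgt M f'"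
  shows "(g \<boxtimes> g') \<cdot> (f \<boxtimes> f') = (g \<cdot> f) \<boxtimes> (g' \<cdot> f')"
  using tena_cmp[of f "src M f" "tgt M f" g "tgt M g" f' "src M f'" "tgt M f'" g' "tgt M g'"] assms
  by auto

lemma tena_merge_cmp:
  assumes "f \<in> Ar M" "g \<in> Ar M" "src M g = tgt M f" "f' \<in> Ar M" "g' \<in> Ar M" "src M g' = tgt M f'"
    "k \<in> Ar M" "tgt M k = src M f \<otimes> src M f'"
  shows "(g \<boxtimes> g') \<cdot> ((f \<boxtimes> f') \<cdot> k) = ((g \<cdot> f) \<boxtimes> (g' \<cdot> f')) \<cdot> k"
  by (subst cmp_cmp_eq[OF tena_merge]) (use assms in simp_all)

lemmas merge = tena_merge tena_merge_cmp

lemma cmp_iso [simp]: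
  assumes "is_iso M f" "is_iso M g" "src M g = tgt M f"
  shows "is_iso M (g \<cdot> f)"
  by (rule is_isoI[of _ "inv_arr M f \<cdot> inv_arr M g"]) (use assms in \<open>simp_all add: is_iso_arr\<close>)

lemma tena_iso [simp]:
  assumes "is_iso M f" "is_iso M g"
  shows "is_iso M (f \<boxtimes> g)"
  by (rule is_isoI[of _ "inv_arr M f \<boxtimes> inv_arr M g"]) (use assms in \<open>simp_all add: is_iso_arr merge\<close>)

lemma idt_iso [simp]: "A \<in> Ob M \<Longrightarrow> is_iso M (idt M A)"
  by (rule is_isoI[of _ "idt M A"]) simp_all

lemma asc_nat_arr:
  assumes "f \<in> Ar M" "g \<in> Ar M" "h \<in> Ar M" "tgt M f = A" "tgt M g = B" "tgt M h = D"
  shows "asc M A B D \<cdot> (f \<boxtimes> g \<boxtimes> h) = (f \<boxtimes> (g \<boxtimes> h)) \<cdot> asc M (src M f) (src M g) (src M h)"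
  by (rule asc_nat) (use assms in auto)

text \<open>Simplification turns \<open>idt M A \<boxtimes> idt M B\<close> into a single identity,
  after which the left-hand side of \<open>asc_nat_arr\<close> no longer matches; this variant
  covers that case.\<close>

lemma asc_nat_idt:
  assumes "A \<in> Ob M" "B \<in> Ob M" "h \<in> Ar M" "tgt M h = D"
  shows "asc M A B D \<cdot> (idt M (A \<otimes> B) \<boxtimes> h) = (idt M A \<boxtimes> (idt M B \<boxtimes> h)) \<cdot> asc M A B (src M h)"
  using asc_nat_arr[of "idt M A" "idt M B" h A B D] assms by simp

lemma asc_nat_cmp:
  assumes "f \<in> Ar M" "g \<in> Ar M" "h \<in> Ar M" "tgt M f = A" "tgt M g = B" "tgt M h = D"
    "k \<in> Ar M" "tgt M k = src M f \<otimes> src M g \<otimes> src M h"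
  shows "asc M A B D \<cdot> ((f \<boxtimes> g \<boxtimes> h) \<cdot> k) =
    (f \<boxtimes> (g \<boxtimes> h)) \<cdot> (asc M (src M f) (src M g) (src M h) \<cdot> k)"
  by (subst cmp_cmp_eq[OF asc_nat_arr]) (use assms in auto)

lemma asc_nat_idt_cmp:
  assumes "A \<in> Ob M" "B \<in> Ob M" "h \<in> Ar M" "tgt M h = D" "k \<in> Ar M" "tgt M k = A \<otimes> B \<otimes> src M h"
  shows "asc M A B D \<cdot> ((idt M (A \<otimes> B) \<boxtimes> h) \<cdot> k) =
    (idt M A \<boxtimes> (idt M B \<boxtimes> h)) \<cdot> (asc M A B (src M h) \<cdot> k)"
  by (subst cmp_cmp_eq[OF asc_nat_idt]) (use assms in auto)

lemmas asc_nats = asc_nat_arr asc_nat_idt asc_nat_cmp asc_nat_idt_cmp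

lemma inv_asc_nat_arr:
  assumes "f \<in> Ar M" "g \<in> Ar M" "h \<in> Ar M" "tgt M f = A" "tgt M g = B" "tgt M h = D"
  shows "inv_arr M (asc M A B D) \<cdot> (f \<boxtimes> (g \<boxtimes> h)) =
    (f \<boxtimes> g \<boxtimes> h) \<cdot> inv_arr M (asc M (src M f) (src M g) (src M h))"
  by (rule inv_arr_commute) (use assms in \<open>auto simp: asc_nat_arr\<close>)

lemma inv_asc_nat_idt:
  assumes "f \<in> Ar M" "B \<in> Ob M" "D \<in> Ob M" "tgt M f = A"
  shows "inv_arr M (asc M A B D) \<cdot> (f \<boxtimes> idt M (B \<otimes> D)) =
    (f \<boxtimes> idt M B \<boxtimes> idt M D) \<cdot> inv_arr M (asc M (src M f) B D)"
  using inv_asc_nat_arr[of f "idt M B" "idt M D" A B D] assms by simp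

lemma inv_asc_nat_cmp:
  assumes "f \<in> Ar M" "g \<in> Ar M" "h \<in> Ar M" "tgt M f = A" "tgt M g = B" "tgt M h = D"
    "k \<in> Ar M" "tgt M k = src M f \<otimes> (src M g \<otimes> src M h)"
  shows "inv_arr M (asc M A B D) \<cdot> ((f \<boxtimes> (g \<boxtimes> h)) \<cdot> k) =
    (f \<boxtimes> g \<boxtimes> h) \<cdot> (inv_arr M (asc M (src M f) (src M g) (src M h)) \<cdot> k)"
  by (subst cmp_cmp_eq[OF inv_asc_nat_arr]) (use assms in auto)

lemma inv_asc_nat_idt_cmp:
  assumes "f \<in> Ar M" "B \<in> Ob M" "D \<in> Ob M" "tgt M f = A" "k \<in> Ar M" "tgt M k = src M f \<otimes> (B \<otimes> D)"
  shows "inv_arr M (asc M A B D) \<cdot> ((f \<boxtimes> idt M (B \<otimes> D)) \<cdot> k) =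
    (f \<boxtimes> idt M B \<boxtimes> idt M D) \<cdot> (inv_arr M (asc M (src M f) B D) \<cdot> k)"
  by (subst cmp_cmp_eq[OF inv_asc_nat_idt]) (use assms in auto)

lemmas inv_asc_nats = inv_asc_nat_arr inv_asc_nat_idt inv_asc_nat_cmp inv_asc_nat_idt_cmp

lemma lun_nat_arr: "\<lbrakk>f \<in> Ar M; tgt M f = B\<rbrakk> \<Longrightarrow> lun M B \<cdot> (idt M (unt M) \<boxtimes> f) = f \<cdot> lun M (src M f)"
  using lun_nat[of f "src M f" B] by auto

lemma run_nat_arr: "\<lbrakk>f \<in> Ar M; tgt M f = B\<rbrakk> \<Longrightarrow> run M B \<cdot> (f \<boxtimes> idt M (unt M)) = f \<cdot> run M (src M f)"
  using run_nat[of f "src M f" B] by auto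

lemma sym_nat_arr:
  "\<lbrakk>f \<in> Ar M; g \<in> Ar M; tgt M f = A; tgt M g = B\<rbrakk>
    \<Longrightarrow> sym M A B \<cdot> (f \<boxtimes> g) = (g \<boxtimes> f) \<cdot> sym M (src M f) (src M g)"
  using sym_nat[of f "src M f" A g "src M g" B] by auto

lemma sym_nat_cmp:
  "\<lbrakk>f \<in> Ar M; g \<in> Ar M; tgt M f = A; tgt M g = B; k \<in> Ar M; tgt M k = src M f \<otimes> src M g\<rbrakk>
    \<Longrightarrow> sym M A B \<cdot> ((f \<boxtimes> g) \<cdot> k) = (g \<boxtimes> f) \<cdot> (sym M (src M f) (src M g) \<cdot> k)"
  by (subst cmp_cmp_eq[OF sym_nat_arr]) auto

lemmas sym_nats = sym_nat_arr sym_nat_cmp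

section \<open>Coherence of units and symmetry, derived from the axioms\<close>

lemma unt_tena_cancel:
  assumes "f \<in> Ar M" "g \<in> Ar M" "src M f = src M g" "tgt M f = tgt M g"
    "idt M (unt M) \<boxtimes> f = idt M (unt M) \<boxtimes> g"
  shows "f = g"
proof (rule iso_cancel_right[of "lun M (src M f)"])
  show "f \<cdot> lun M (src M f) = g \<cdot> lun M (src M f)"
    using lun_nat_arr[of f "tgt M f"] lun_nat_arr[of g "tgt M f"] assms by metis
qed (use assms in auto)

lemma tena_unt_cancel:
  assumes "f \<in> Ar M" "g \<in> Ar M" "src M f = src M g" "tgt M f = tgt M g"
    "f \<boxtimes> idt M (unt M) = g \<boxtimes> idt M (unt M)"
  shows "f = g"
proof (rule iso_cancel_right[of "run M (src M f)"])
  show "f \<cdot> run M (src M f) = g \<cdot> run M (src M f)"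
    using run_nat_arr[of f "tgt M f"] run_nat_arr[of g "tgt M f"] assms by metis
qed (use assms in auto)

text \<open>Kelly's argument: \<open>lun\<close> is a natural isomorphism, so tensoring with the
  unit \<open>S\<close> is faithful and the law may be checked under \<open>S \<otimes> -\<close>.
  After composing with invertible associators it follows from the pentagon for
  \<open>S, S, A, B\<close> and two triangles.\<close>

lemma lun_asc:
  assumes [simp]: "A \<in> Ob M" "B \<in> Ob M"
  shows "lun M (A \<otimes> B) \<cdot> asc M (unt M) A B = lun M A \<boxtimes> idt M B"
proof (rule unt_tena_cancel)
  let ?S = "unt M"
  let ?c = "asc M ?S (?S \<otimes> A) B \<cdot> (asc M ?S ?S A \<boxtimes> idt M B)"
  show "idt M ?S \<boxtimes> (lun M (A \<otimes> B) \<cdot> asc M ?S A B) = idt M ?S \<boxtimes> (lun M A \<boxtimes> idt M B)"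
  proof (rule iso_cancel_right)
    show "is_iso M (asc M ?S (?S \<otimes> A) B)" by simp
    show "(idt M ?S \<boxtimes> (lun M (A \<otimes> B) \<cdot> asc M ?S A B)) \<cdot> asc M ?S (?S \<otimes> A) B =
        (idt M ?S \<boxtimes> (lun M A \<boxtimes> idt M B)) \<cdot> asc M ?S (?S \<otimes> A) B"
    proof (rule iso_cancel_right)
      show "is_iso M (asc M ?S ?S A \<boxtimes> idt M B)" by simp
      have "(idt M ?S \<boxtimes> (lun M (A \<otimes> B) \<cdot> asc M ?S A B)) \<cdot> asc M ?S (?S \<otimes> A) B \<cdot>
            (asc M ?S ?S A \<boxtimes> idt M B) =
          (idt M ?S \<boxtimes> lun M (A \<otimes> B)) \<cdot>
            ((idt M ?S \<boxtimes> asc M ?S A B) \<cdot> asc M ?S (?S \<otimes> A) B \<cdot> (asc M ?S ?S A \<boxtimes> idt M B))"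
        by (simp add: merge)
      also have "\<dots> = (idt M ?S \<boxtimes> lun M (A \<otimes> B)) \<cdot>
          (asc M ?S ?S (A \<otimes> B) \<cdot> asc M (?S \<otimes> ?S) A B)"
        by (simp add: pentagon)
      also have "\<dots> = (run M ?S \<boxtimes> (idt M A \<boxtimes> idt M B)) \<cdot> asc M (?S \<otimes> ?S) A B"
        by (simp flip: cmp_assoc_arr add: triangle del: cmp_assoc_arr)
      also have "\<dots> = asc M ?S A B \<cdot> (run M ?S \<boxtimes> idt M A \<boxtimes> idt M B)"
        by (simp add: asc_nat_arr del: tena_idt)
      also have "\<dots> = asc M ?S A B \<cdot> (((idt M ?S \<boxtimes> lun M A) \<cdot> asc M ?S ?S A) \<boxtimes> idt M B)"
        by (simp add: triangle)
      also have "\<dots> = asc M ?S A B \<cdot> ((idt M ?S \<boxtimes> lun M A \<boxtimes> idt M B) \<cdot> (asc M ?S ?S A \<boxtimes> idt M B))"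
        by (simp add: merge)
      also have "\<dots> = (idt M ?S \<boxtimes> (lun M A \<boxtimes> idt M B)) \<cdot> asc M ?S (?S \<otimes> A) B \<cdot>
          (asc M ?S ?S A \<boxtimes> idt M B)"
        by (simp add: asc_nats)
      finally show "(idt M ?S \<boxtimes> (lun M (A \<otimes> B) \<cdot> asc M ?S A B)) \<cdot> asc M ?S (?S \<otimes> A) B \<cdot>
            (asc M ?S ?S A \<boxtimes> idt M B) =
          (idt M ?S \<boxtimes> (lun M A \<boxtimes> idt M B)) \<cdot> asc M ?S (?S \<otimes> A) B \<cdot> (asc M ?S ?S A \<boxtimes> idt M B)" .
    qed simp_all
  qed simp_all
qed simp_all

text \<open>The mirror image, from the pentagon for \<open>A, B, S, S\<close> and faithfulness of
  \<open>- \<otimes> S\<close>.\<close>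

lemma run_asc:
  assumes [simp]: "A \<in> Ob M" "B \<in> Ob M"
  shows "(idt M A \<boxtimes> run M B) \<cdot> asc M A B (unt M) = run M (A \<otimes> B)"
proof (rule tena_unt_cancel)
  let ?S = "unt M"
  show "((idt M A \<boxtimes> run M B) \<cdot> asc M A B ?S) \<boxtimes> idt M ?S = run M (A \<otimes> B) \<boxtimes> idt M ?S"
  proof (rule iso_cancel_left)
    show "is_iso M (asc M A B ?S)" by simp
    have "asc M A B ?S \<cdot> (((idt M A \<boxtimes> run M B) \<cdot> asc M A B ?S) \<boxtimes> idt M ?S) =
        asc M A B ?S \<cdot> ((idt M A \<boxtimes> run M B \<boxtimes> idt M ?S) \<cdot> (asc M A B ?S \<boxtimes> idt M ?S))"
      by (simp add: merge)
    also have "\<dots> = (idt M A \<boxtimes> (run M B \<boxtimes> idt M ?S)) \<cdot> (asc M A (B \<otimes> ?S) ?S \<cdot> (asc M A B ?S \<boxtimes> idt M ?S))"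
      by (simp add: asc_nats)
    also have "\<dots> = (idt M A \<boxtimes> (idt M B \<boxtimes> lun M ?S)) \<cdot>
        ((idt M A \<boxtimes> asc M B ?S ?S) \<cdot> asc M A (B \<otimes> ?S) ?S \<cdot> (asc M A B ?S \<boxtimes> idt M ?S))"
      by (simp add: triangle[symmetric] merge)
    also have "\<dots> = (idt M A \<boxtimes> (idt M B \<boxtimes> lun M ?S)) \<cdot> (asc M A B (?S \<otimes> ?S) \<cdot> asc M (A \<otimes> B) ?S ?S)"
      by (simp add: pentagon)
    also have "\<dots> = asc M A B ?S \<cdot> ((idt M (A \<otimes> B) \<boxtimes> lun M ?S) \<cdot> asc M (A \<otimes> B) ?S ?S)"
      by (simp add: asc_nats)
    also have "\<dots> = asc M A B ?S \<cdot> (run M (A \<otimes> B) \<boxtimes> idt M ?S)"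
      by (simp add: triangle)
    finally show "asc M A B ?S \<cdot> (((idt M A \<boxtimes> run M B) \<cdot> asc M A B ?S) \<boxtimes> idt M ?S) =
        asc M A B ?S \<cdot> (run M (A \<otimes> B) \<boxtimes> idt M ?S)" .
  qed simp_all
qed simp_all

text \<open>The hexagon for \<open>A, S, S\<close>, together with \<open>lun_asc\<close> and the
  triangle, gives the law up to tensoring with \<open>S\<close> and composing with an invertible
  symmetry; both can be cancelled.\<close>

lemma lun_sym:
  assumes [simp]: "A \<in> Ob M"
  shows "lun M A \<cdot> sym M A (unt M) = run M A"
proof (rule tena_unt_cancel)
  let ?S = "unt M"
  show "(lun M A \<cdot> sym M A ?S) \<boxtimes> idt M ?S = run M A \<boxtimes> idt M ?S"
  proof (rule iso_cancel_left)
    show "is_iso M (sym M A ?S)" by simp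
    have "sym M A ?S \<cdot> ((lun M A \<cdot> sym M A ?S) \<boxtimes> idt M ?S) =
        sym M A ?S \<cdot> ((lun M A \<boxtimes> idt M ?S) \<cdot> (sym M A ?S \<boxtimes> idt M ?S))"
      by (simp add: merge)
    also have "\<dots> = sym M A ?S \<cdot> (lun M (A \<otimes> ?S) \<cdot> (asc M ?S A ?S \<cdot> (sym M A ?S \<boxtimes> idt M ?S)))"
      by (simp add: lun_asc[symmetric])
    also have "\<dots> = lun M (?S \<otimes> A) \<cdot> ((idt M ?S \<boxtimes> sym M A ?S) \<cdot> asc M ?S A ?S \<cdot> (sym M A ?S \<boxtimes> idt M ?S))"
      by (simp add: cmp_cmp_eq[OF lun_nat_arr])
    also have "\<dots> = lun M (?S \<otimes> A) \<cdot> (asc M ?S ?S A \<cdot> (sym M A (?S \<otimes> ?S) \<cdot> asc M A ?S ?S))"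
      by (subst hexagon[symmetric]) simp_all
    also have "\<dots> = (lun M ?S \<boxtimes> idt M A) \<cdot> (sym M A (?S \<otimes> ?S) \<cdot> asc M A ?S ?S)"
      by (simp add: cmp_cmp_eq[OF lun_asc])
    also have "\<dots> = sym M A ?S \<cdot> ((idt M A \<boxtimes> lun M ?S) \<cdot> asc M A ?S ?S)"
      by (simp add: sym_nats)
    also have "\<dots> = sym M A ?S \<cdot> (run M A \<boxtimes> idt M ?S)"
      by (simp add: triangle)
    finally show "sym M A ?S \<cdot> ((lun M A \<cdot> sym M A ?S) \<boxtimes> idt M ?S) = sym M A ?S \<cdot> (run M A \<boxtimes> idt M ?S)" .
  qed simp_all
qed simp_all

lemma run_sym: "A \<in> Ob M \<Longrightarrow> run M A \<cdot> sym M (unt M) A = lun M A"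
  by (simp flip: lun_sym)

text \<open>Both sides reverse the order of three factors. In the contravariant calculation the
  right side arises from the action of \<open>E\<close> on \<open>FE\<close>, and the left side
  contains the exchange of index objects caused by reversed composition.\<close>

lemma sym_ten:
  assumes [simp]: "A \<in> Ob M" "B \<in> Ob M" "D \<in> Ob M"
  shows "asc M D B A \<cdot> (sym M B D \<boxtimes> idt M A) \<cdot> sym M A (B \<otimes> D) \<cdot> asc M A B D =
    (idt M D \<boxtimes> sym M A B) \<cdot> sym M (A \<otimes> B) D"
proof -
  \<comment> \<open>The second hexagon, solved for \<open>sym M (B \<otimes> A) D\<close>: it is the
    axiom at \<open>D, B, A\<close> inverted, since the symmetry is its own inverse.\<close>
  have H: "asc M D B A \<cdot> (sym M B D \<boxtimes> idt M A) \<cdot> inv_arr M (asc M B D A) \<cdot> (idt M B \<boxtimes> sym M A D) \<cdot>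
      asc M B A D = sym M (B \<otimes> A) D" (is "?X = _")
  proof (rule iso_cancel_right)
    show "is_iso M (sym M D (B \<otimes> A) \<cdot> asc M D B A)" by simp
    have "?X \<cdot> (sym M D (B \<otimes> A) \<cdot> asc M D B A) =
        asc M D B A \<cdot> (sym M B D \<boxtimes> idt M A) \<cdot> inv_arr M (asc M B D A) \<cdot> (idt M B \<boxtimes> sym M A D) \<cdot>
          (asc M B A D \<cdot> sym M D (B \<otimes> A) \<cdot> asc M D B A)"
      by simp
    also have "\<dots> = asc M D B A"
      unfolding hexagon[OF assms(3,2,1)] by (simp add: merge)
    finally show "?X \<cdot> (sym M D (B \<otimes> A) \<cdot> asc M D B A) =
        sym M (B \<otimes> A) D \<cdot> (sym M D (B \<otimes> A) \<cdot> asc M D B A)"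
      by simp
  qed simp_all
  have "asc M D B A \<cdot> (sym M B D \<boxtimes> idt M A) \<cdot> sym M A (B \<otimes> D) \<cdot> asc M A B D =
      asc M D B A \<cdot> (sym M B D \<boxtimes> idt M A) \<cdot> inv_arr M (asc M B D A) \<cdot>
        (asc M B D A \<cdot> sym M A (B \<otimes> D) \<cdot> asc M A B D)"
    by simp
  also have "\<dots> = ?X \<cdot> (sym M A B \<boxtimes> idt M D)"
    unfolding hexagon[OF assms] by simp
  also have "\<dots> = (idt M D \<boxtimes> sym M A B) \<cdot> sym M (A \<otimes> B) D"
    unfolding H by (simp add: sym_nats)
  finally show ?thesis .
qed

end

section \<open>Closed structure and modules\<close>

text \<open>Fixes the record type without extension fields, the type for which \<open>cur\<close>,
  \<open>homE\<close> and the module constructions are defined.\<close>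

locale csmc = closed_symmetric_monoidal_category M for M :: "('o, 'a) csmc" (structure)
begin

lemma cur_props:
  assumes "D \<in> Ob M" "A \<in> Ob M" "B \<in> Ob M" "f \<in> Ar M" "src M f = D \<otimes> A" "tgt M f = B"
  shows "cur M D A B f \<in> hom M D (ihom M A B) \<and> ev M A B \<cdot> (cur M D A B f \<boxtimes> idt M A) = f"
  unfolding cur_def by (rule theI', rule ev_universal) (use assms in auto)

lemma cur_arr [simp]:
  assumes "D \<in> Ob M" "A \<in> Ob M" "B \<in> Ob M" "f \<in> Ar M" "src M f = D \<otimes> A" "tgt M f = B"
  shows "cur M D A B f \<in> Ar M" "src M (cur M D A B f) = D" "tgt M (cur M D A B f) = ihom M A B"
  using cur_props[OF assms] by auto

lemma ev_cur:
  assumes "D \<in> Ob M" "A \<in> Ob M" "B \<in> Ob M" "f \<in> Ar M" "src M f = D \<otimes> A" "tgt M f = B"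
  shows "ev M A B \<cdot> (cur M D A B f \<boxtimes> idt M A) = f"
  using cur_props[OF assms] by auto

lemma ev_cur_tena:
  assumes "D \<in> Ob M" "A \<in> Ob M" "B \<in> Ob M" "f \<in> Ar M" "src M f = D \<otimes> A" "tgt M f = B"
    "k \<in> Ar M" "tgt M k = A"
  shows "ev M A B \<cdot> (cur M D A B f \<boxtimes> k) = f \<cdot> (idt M D \<boxtimes> k)"
  by (subst ev_cur[OF assms(1-6), symmetric]) (use assms in \<open>simp add: merge\<close>)

lemma ev_cur_cmp:
  assumes "D \<in> Ob M" "A \<in> Ob M" "B \<in> Ob M" "f \<in> Ar M" "src M f = D \<otimes> A" "tgt M f = B"
    "k \<in> Ar M" "tgt M k = D"
  shows "ev M A B \<cdot> ((cur M D A B f \<cdot> k) \<boxtimes> idt M A) = f \<cdot> (k \<boxtimes> idt M A)"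
  by (subst ev_cur[OF assms(1-6), symmetric]) (use assms in \<open>simp add: merge\<close>)

lemma cur_unique:
  assumes "A \<in> Ob M" "B \<in> Ob M" "g \<in> Ar M" "tgt M g = ihom M A B"
    "ev M A B \<cdot> (g \<boxtimes> idt M A) = f"
  shows "cur M (src M g) A B f = g"
proof -
  have D: "src M g \<in> Ob M" and f: "f \<in> Ar M" "src M f = src M g \<otimes> A" "tgt M f = B"
    using assms by auto
  have "\<exists>!h. h \<in> hom M (src M g) (ihom M A B) \<and> ev M A B \<cdot> (h \<boxtimes> idt M A) = f"
    by (rule ev_universal) (use assms D f in auto)
  then show ?thesis using cur_props[OF D assms(1,2) f] assms by auto
qed

lemma ihom_ext:
  assumes "A \<in> Ob M" "B \<in> Ob M" "g \<in> Ar M" "h \<in> Ar M" "src M h = src M g"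
    "tgt M g = ihom M A B" "tgt M h = ihom M A B"
    "ev M A B \<cdot> (g \<boxtimes> idt M A) = ev M A B \<cdot> (h \<boxtimes> idt M A)"
  shows "g = h"
  using cur_unique[of A B g] cur_unique[of A B h] assms by metis

lemma cur_cmp:
  assumes "D \<in> Ob M" "A \<in> Ob M" "B \<in> Ob M" "f \<in> Ar M" "src M f = D \<otimes> A" "tgt M f = B"
    "k \<in> Ar M" "tgt M k = D"
  shows "cur M D A B f \<cdot> k = cur M (src M k) A B (f \<cdot> (k \<boxtimes> idt M A))"
  by (rule ihom_ext[of A B]) (use assms in \<open>simp_all add: ev_cur_cmp ev_cur\<close>)

lemma cur_inj:
  assumes "D \<in> Ob M" "A \<in> Ob M" "B \<in> Ob M" "f \<in> Ar M" "src M f = D \<otimes> A" "tgt M f = B"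
    "g \<in> Ar M" "src M g = D \<otimes> A" "tgt M g = B"
    "cur M D A B f = cur M D A B g"
  shows "f = g"
  using ev_cur[OF assms(1-6)] ev_cur[OF assms(1-3,7-9)] assms(10) by metis

text \<open>The functor \<open>- \<otimes> D\<close> is a left adjoint: a map out of the tensored
  pair is curried, factored through \<open>q\<close>, and uncurried again.\<close>

lemma coequalizer_tena:
  assumes q: "is_coequalizer M f g q" and D: "D \<in> Ob M"
  shows "is_coequalizer M (f \<boxtimes> idt M D) (g \<boxtimes> idt M D) (q \<boxtimes> idt M D)"
proof (rule is_coequalizerI)
  note c [simp] = coequalizer_arr[OF q] and [simp] = D
  show "(q \<boxtimes> idt M D) \<cdot> (f \<boxtimes> idt M D) = (q \<boxtimes> idt M D) \<cdot> (g \<boxtimes> idt M D)"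
    by (simp add: merge)
  {
    fix h assume h [simp]: "h \<in> Ar M" "src M h = tgt M (f \<boxtimes> idt M D)"
      and eq: "h \<cdot> (f \<boxtimes> idt M D) = h \<cdot> (g \<boxtimes> idt M D)"
    let ?B = "tgt M f" and ?Z = "tgt M h"
    have "cur M ?B D ?Z h \<cdot> f = cur M ?B D ?Z h \<cdot> g"
      using eq by (simp add: cur_cmp)
    then obtain k where k [simp]: "k \<in> Ar M" "src M k = tgt M q" "tgt M k = tgt M (cur M ?B D ?Z h)"
        and kq: "k \<cdot> q = cur M ?B D ?Z h"
      using coequalizer_factor[OF q, of "cur M ?B D ?Z h"] by auto
    have "ev M D ?Z \<cdot> (k \<boxtimes> idt M D) \<cdot> (q \<boxtimes> idt M D) = h"
      by (simp add: merge kq ev_cur)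
    then show "\<exists>k. k \<in> Ar M \<and> src M k = tgt M (q \<boxtimes> idt M D) \<and> tgt M k = ?Z \<and> k \<cdot> (q \<boxtimes> idt M D) = h"
      by (intro exI[of _ "ev M D ?Z \<cdot> (k \<boxtimes> idt M D)"]) simp
  next
    fix h k assume h [simp]: "h \<in> Ar M" "k \<in> Ar M" "src M h = tgt M (q \<boxtimes> idt M D)"
        "src M k = tgt M (q \<boxtimes> idt M D)"
      and eq: "h \<cdot> (q \<boxtimes> idt M D) = k \<cdot> (q \<boxtimes> idt M D)"
    let ?T = "tgt M q" and ?Z = "tgt M h"
    have [simp]: "tgt M k = ?Z" using arg_cong[OF eq, of "tgt M"] by simp
    have "cur M ?T D ?Z h \<cdot> q = cur M ?T D ?Z k \<cdot> q"
      using eq by (simp add: cur_cmp)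
    then have "cur M ?T D ?Z h = cur M ?T D ?Z k"
      by (rule coequalizer_epi[OF q, rotated -1]) simp_all
    then show "h = k" by (rule cur_inj[rotated -1]) simp_all
  }
qed (use coequalizer_arr[OF q] D in simp_all)

lemma swap_arr [simp]:
  assumes "A \<in> Ob M" "B \<in> Ob M" "D \<in> Ob M"
  shows "swap M A B D \<in> Ar M" "src M (swap M A B D) = A \<otimes> B \<otimes> D" "tgt M (swap M A B D) = A \<otimes> D \<otimes> B"
  using assms by (simp_all add: swap_def)

lemma swap_nat:
  assumes "f \<in> Ar M" "tgt M f = A" "B \<in> Ob M" "D \<in> Ob M"
  shows "swap M A B D \<cdot> (f \<boxtimes> idt M B \<boxtimes> idt M D) = (f \<boxtimes> idt M D \<boxtimes> idt M B) \<cdot> swap M (src M f) B D"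
proof -
  have [simp]: "A \<in> Ob M" using assms by auto
  have "swap M A B D \<cdot> (f \<boxtimes> idt M B \<boxtimes> idt M D) =
      inv_arr M (asc M A D B) \<cdot> ((f \<boxtimes> idt M (D \<otimes> B)) \<cdot> ((idt M (src M f) \<boxtimes> sym M B D) \<cdot> asc M (src M f) B D))"
    using assms by (simp add: swap_def asc_nats merge)
  then show ?thesis using assms by (simp add: swap_def inv_asc_nats)
qed

lemma Mod_cat_simps [simp]:
  "Ob (Mod_cat M E) = {X. is_rmod M E X}" "src (Mod_cat M E) = msrc" "tgt (Mod_cat M E) = mtgt"
  "idt (Mod_cat M E) X = MHom X (idt M (car X)) X"
  "g \<cdot>\<^bsub>Mod_cat M E\<^esub> f = MHom (msrc f) (marr g \<cdot> marr f) (mtgt g)"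
  by (simp_all add: Mod_cat_def)

lemma Ar_Mod_cat:
  "f \<in> Ar (Mod_cat M E) \<longleftrightarrow> is_rmod M E (msrc f) \<and> is_rmod M E (mtgt f) \<and>
     marr f \<in> Ar M \<and> src M (marr f) = car (msrc f) \<and> tgt M (marr f) = car (mtgt f) \<and>
     act (mtgt f) \<cdot> (marr f \<boxtimes> idt M (mon_car E)) = marr f \<cdot> act (msrc f)"
  by (cases f) (auto simp: Mod_cat_def)

lemma rmod_arr:
  assumes "is_rmod M E X"
  shows "car X \<in> Ob M" "act X \<in> Ar M" "src M (act X) = car X \<otimes> mon_car E" "tgt M (act X) = car X"
  using assms by (auto simp: is_rmod_def)

lemma rmod_assoc:
  "is_rmod M E X \<Longrightarrow> act X \<cdot> (act X \<boxtimes> idt M (mon_car E)) =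
    act X \<cdot> (idt M (car X) \<boxtimes> mon_mul E) \<cdot> asc M (car X) (mon_car E) (mon_car E)"
  by (auto simp: is_rmod_def)

lemma rmod_unit:
  "is_rmod M E X \<Longrightarrow> act X \<cdot> (idt M (car X) \<boxtimes> mon_unit E) = run M (car X)"
  by (auto simp: is_rmod_def)

lemma mhom_eqI: "\<lbrakk>msrc f = msrc g; marr f = marr g; mtgt f = mtgt g\<rbrakk> \<Longrightarrow> f = g"
  by (cases f; cases g) simp

end

locale csmc_monoid = csmc M for M :: "('o, 'a) csmc" (structure) +
  fixes E :: "('o, 'a) mon"
  assumes E: "is_monoid M E"
begin

abbreviation "e \<equiv> mon_car E"
abbreviation "m \<equiv> mon_mul E"
abbreviation "u \<equiv> mon_unit E"

lemma mon_arr [simp]: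
  "e \<in> Ob M" "m \<in> Ar M" "src M m = e \<otimes> e" "tgt M m = e" "u \<in> Ar M" "src M u = unt M" "tgt M u = e"
  using E by (auto simp: is_monoid_def)

lemma mon_assoc: "m \<cdot> (m \<boxtimes> idt M e) = m \<cdot> (idt M e \<boxtimes> m) \<cdot> asc M e e e"
  and mon_lunit: "m \<cdot> (u \<boxtimes> idt M e) = lun M e"
  and mon_runit: "m \<cdot> (idt M e \<boxtimes> u) = run M e"
  using E by (auto simp: is_monoid_def)

lemma is_rmodI:
  assumes "T \<in> Ob M" "a \<in> Ar M" "src M a = T \<otimes> e" "tgt M a = T"
    "a \<cdot> (a \<boxtimes> idt M e) = a \<cdot> (idt M T \<boxtimes> m) \<cdot> asc M T e e"
    "a \<cdot> (idt M T \<boxtimes> u) = run M T"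
  shows "is_rmod M E (RMod T a)"
  using assms by (simp add: is_rmod_def)

lemma rmod_reg [simp]: "is_rmod M E (reg_mod E)"
  unfolding reg_mod_def by (rule is_rmodI) (simp_all add: mon_assoc mon_runit)

lemma car_reg [simp]: "car (reg_mod E) = e" "act (reg_mod E) = m"
  by (simp_all add: reg_mod_def)

lemma category_Mod: "category (Mod_cat M E)"
proof unfold_locales
  fix f g A B D assume fg: "f \<in> hom (Mod_cat M E) A B" "g \<in> hom (Mod_cat M E) B D"
  then have f: "f \<in> Ar (Mod_cat M E)" "g \<in> Ar (Mod_cat M E)" "msrc g = mtgt f" "msrc f = A" "mtgt g = D"
    by auto
  have [simp]: "is_rmod M E (msrc f)" "is_rmod M E (mtgt f)" "is_rmod M E (mtgt g)"
      "marr f \<in> Ar M" "src M (marr f) = car (msrc f)" "tgt M (marr f) = car (mtgt f)"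
      "marr g \<in> Ar M" "src M (marr g) = car (mtgt f)" "tgt M (marr g) = car (mtgt g)"
    and fa: "act (mtgt f) \<cdot> (marr f \<boxtimes> idt M e) = marr f \<cdot> act (msrc f)"
    and ga: "act (mtgt g) \<cdot> (marr g \<boxtimes> idt M e) = marr g \<cdot> act (mtgt f)"
    using f(1,2) unfolding Ar_Mod_cat f(3) by auto
  note [simp] = rmod_arr[of E "msrc f"] rmod_arr[of E "mtgt f"] rmod_arr[of E "mtgt g"]
  have "act (mtgt g) \<cdot> ((marr g \<cdot> marr f) \<boxtimes> idt M e) =
      act (mtgt g) \<cdot> ((marr g \<boxtimes> idt M e) \<cdot> (marr f \<boxtimes> idt M e))"
    by (simp add: merge)
  also have "\<dots> = marr g \<cdot> marr f \<cdot> act (msrc f)" by (simp add: cmp_cmp_eq[OF ga] fa)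
  finally have "g \<cdot>\<^bsub>Mod_cat M E\<^esub> f \<in> Ar (Mod_cat M E)"
    by (simp add: Ar_Mod_cat)
  then show "g \<cdot>\<^bsub>Mod_cat M E\<^esub> f \<in> hom (Mod_cat M E) A D" using f by simp
next
  fix f g h A B D E'
  assume "f \<in> hom (Mod_cat M E) A B" "g \<in> hom (Mod_cat M E) B D" "h \<in> hom (Mod_cat M E) D E'"
  then show "h \<cdot>\<^bsub>Mod_cat M E\<^esub> g \<cdot>\<^bsub>Mod_cat M E\<^esub> f = h \<cdot>\<^bsub>Mod_cat M E\<^esub> (g \<cdot>\<^bsub>Mod_cat M E\<^esub> f)"
    by (simp add: Ar_Mod_cat)
next
  fix X assume "X \<in> Ob (Mod_cat M E)"
  then show "idt (Mod_cat M E) X \<in> hom (Mod_cat M E) X X"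
    using rmod_arr[of E X] by (auto simp: Ar_Mod_cat)
qed (auto simp: Ar_Mod_cat intro: mhom_eqI)

end

sublocale csmc_monoid \<subseteq> Mod: category "Mod_cat M E"
  by (rule category_Mod)

section \<open>Coequalizers and equalizers of modules\<close>

context csmc_monoid
begin

text \<open>The forgetful functor creates coequalizers, since tensoring with \<open>E\<close> preserves them.\<close>

lemma coequalizer_Mod:
  assumes f: "f \<in> Ar (Mod_cat M E)" and g: "g \<in> Ar (Mod_cat M E)"
    and fg: "msrc g = msrc f" "mtgt g = mtgt f"
    and q: "is_coequalizer M (marr f) (marr g) q"
  defines "B \<equiv> mtgt f" and "T \<equiv> tgt M q"
  defines "a \<equiv> THE a. a \<in> hom M (T \<otimes> e) T \<and> a \<cdot> (q \<boxtimes> idt M e) = q \<cdot> act B"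
  shows "is_coequalizer (Mod_cat M E) f g (MHom B q (RMod T a))"
proof -
  note f1 = f[unfolded Ar_Mod_cat] and g1 = g[unfolded Ar_Mod_cat fg]
  note q1 = coequalizer_arr[OF q]
  note ar = rmod_arr[OF conjunct1[OF f1]]
    rmod_arr[OF conjunct1[OF conjunct2[OF f1]], folded B_def]
  have [simp]: "marr f \<in> Ar M" "marr g \<in> Ar M" "src M (marr f) = car (msrc f)"
      "src M (marr g) = car (msrc f)" "tgt M (marr f) = car B" "tgt M (marr g) = car B"
      "q \<in> Ar M" "src M q = car B" "tgt M q = T" "T \<in> Ob M"
    using f1 g1 q1 by (auto simp: B_def T_def)
  note [simp] = ar
  note qe = coequalizer_tena[OF q, of e, simplified]
  have "q \<cdot> act B \<cdot> (marr f \<boxtimes> idt M e) = q \<cdot> act B \<cdot> (marr g \<boxtimes> idt M e)"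
    using f1 g1 q1 by (simp add: B_def[symmetric] cmp_cmp_eq[OF q1(7)])
  then obtain b where b: "b \<in> hom M (T \<otimes> e) T" "b \<cdot> (q \<boxtimes> idt M e) = q \<cdot> act B"
    using coequalizer_factor[OF qe, of "q \<cdot> act B"] by auto
  \<comment> \<open>The action is given by \<open>THE\<close> so that the resulting module agrees
    literally with \<open>tenE_mod\<close>; this step shows that the description is met by exactly
    one map.\<close>
  have "a = b" unfolding a_def
  proof (rule the_equality)
    fix a assume a: "a \<in> hom M (T \<otimes> e) T \<and> a \<cdot> (q \<boxtimes> idt M e) = q \<cdot> act B"
    show "a = b" by (rule coequalizer_epi[OF qe]) (use a b in auto)
  qed (use b in auto)
  with b have a [simp]: "a \<in> Ar M" "src M a = T \<otimes> e" "tgt M a = T"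
    and aq: "a \<cdot> (q \<boxtimes> idt M e) = q \<cdot> act B" by auto
  have B: "is_rmod M E B" using f1 by (simp add: B_def)
  have T: "is_rmod M E (RMod T a)"
  proof (rule is_rmodI)
    show "a \<cdot> (a \<boxtimes> idt M e) = a \<cdot> (idt M T \<boxtimes> m) \<cdot> asc M T e e"
    \<comment> \<open>Tensoring twice keeps \<open>q\<close> epi, so associativity is tested after
      precomposition, where it becomes associativity of \<open>B\<close>.\<close>
    proof (rule coequalizer_epi[OF coequalizer_tena[OF qe]])
      have "a \<cdot> (a \<boxtimes> idt M e) \<cdot> (q \<boxtimes> idt M e \<boxtimes> idt M e) = a \<cdot> ((q \<boxtimes> idt M e) \<cdot> (act B \<boxtimes> idt M e))"
        by (simp add: merge aq)
      also have "\<dots> = q \<cdot> act B \<cdot> (act B \<boxtimes> idt M e)" by (simp add: cmp_cmp_eq[OF aq])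
      also have "\<dots> = q \<cdot> (act B \<cdot> (idt M (car B) \<boxtimes> m) \<cdot> asc M (car B) e e)"
        using rmod_assoc[OF B] by simp
      also have "\<dots> = q \<cdot> act B \<cdot> ((idt M (car B) \<boxtimes> m) \<cdot> asc M (car B) e e)"
        by simp
      also have "\<dots> = a \<cdot> ((q \<boxtimes> idt M e) \<cdot> (idt M (car B) \<boxtimes> m) \<cdot> asc M (car B) e e)"
        by (simp add: cmp_cmp_eq[OF aq])
      also have "\<dots> = a \<cdot> (idt M T \<boxtimes> m) \<cdot> asc M T e e \<cdot> (q \<boxtimes> idt M e \<boxtimes> idt M e)"
        by (simp add: asc_nat_arr merge)
      finally show "a \<cdot> (a \<boxtimes> idt M e) \<cdot> (q \<boxtimes> idt M e \<boxtimes> idt M e) =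
        a \<cdot> (idt M T \<boxtimes> m) \<cdot> asc M T e e \<cdot> (q \<boxtimes> idt M e \<boxtimes> idt M e)" .
    qed simp_all
    show "a \<cdot> (idt M T \<boxtimes> u) = run M T"
    proof (rule coequalizer_epi[OF coequalizer_tena[OF q, of "unt M"]])
      have "a \<cdot> (idt M T \<boxtimes> u) \<cdot> (q \<boxtimes> idt M (unt M)) = a \<cdot> ((q \<boxtimes> idt M e) \<cdot> (idt M (car B) \<boxtimes> u))"
        by (simp add: merge)
      also have "\<dots> = q \<cdot> (act B \<cdot> (idt M (car B) \<boxtimes> u))" by (simp add: cmp_cmp_eq[OF aq])
      also have "\<dots> = run M T \<cdot> (q \<boxtimes> idt M (unt M))"
        by (simp add: rmod_unit[OF B] run_nat_arr)
      finally show "a \<cdot> (idt M T \<boxtimes> u) \<cdot> (q \<boxtimes> idt M (unt M)) = run M T \<cdot> (q \<boxtimes> idt M (unt M))" .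
    qed simp_all
  qed simp_all
  show ?thesis
  proof (rule Mod.is_coequalizerI)
    show "f \<in> Ar (Mod_cat M E)" "g \<in> Ar (Mod_cat M E)" by (fact f g)+
    show "MHom B q (RMod T a) \<in> Ar (Mod_cat M E)"
      using B T by (simp add: Ar_Mod_cat aq)
    fix h assume h: "h \<in> Ar (Mod_cat M E)" "src (Mod_cat M E) h = tgt (Mod_cat M E) f"
      "h \<cdot>\<^bsub>Mod_cat M E\<^esub> f = h \<cdot>\<^bsub>Mod_cat M E\<^esub> g"
    have Z: "is_rmod M E (mtgt h)" and [simp]: "marr h \<in> Ar M" "src M (marr h) = car B"
        "tgt M (marr h) = car (mtgt h)" and
      hact: "act (mtgt h) \<cdot> (marr h \<boxtimes> idt M e) = marr h \<cdot> act B"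
      using h(1,2) by (auto simp: Ar_Mod_cat B_def)
    note [simp] = rmod_arr[OF Z]
    have "marr h \<cdot> marr f = marr h \<cdot> marr g" using h(3) by simp
    then obtain k where k [simp]: "k \<in> Ar M" "src M k = T" "tgt M k = car (mtgt h)"
        and kq: "k \<cdot> q = marr h"
      using coequalizer_factor[OF q, of "marr h"] by auto
    have "act (mtgt h) \<cdot> (k \<boxtimes> idt M e) = k \<cdot> a"
      by (rule coequalizer_epi[OF qe]) (simp_all add: merge kq hact aq cmp_cmp_eq[OF kq])
    then have "MHom (RMod T a) k (mtgt h) \<in> Ar (Mod_cat M E)"
      using Z T by (simp add: Ar_Mod_cat)
    then show "\<exists>k. k \<in> Ar (Mod_cat M E) \<and> src (Mod_cat M E) k = tgt (Mod_cat M E) (MHom B q (RMod T a)) \<and>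
        tgt (Mod_cat M E) k = tgt (Mod_cat M E) h \<and> k \<cdot>\<^bsub>Mod_cat M E\<^esub> MHom B q (RMod T a) = h"
      by (intro exI[of _ "MHom (RMod T a) k (mtgt h)"])
        (use h(2) in \<open>auto simp: kq B_def intro: mhom_eqI\<close>)
  next
    fix h k assume h: "h \<in> Ar (Mod_cat M E)" "k \<in> Ar (Mod_cat M E)"
      "src (Mod_cat M E) h = tgt (Mod_cat M E) (MHom B q (RMod T a))"
      "src (Mod_cat M E) k = tgt (Mod_cat M E) (MHom B q (RMod T a))"
      "h \<cdot>\<^bsub>Mod_cat M E\<^esub> MHom B q (RMod T a) = k \<cdot>\<^bsub>Mod_cat M E\<^esub> MHom B q (RMod T a)"
    have "marr h = marr k"
      by (rule coequalizer_epi[OF q]) (use h in \<open>auto simp: Ar_Mod_cat\<close>)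
    then show "h = k" using h by (auto intro: mhom_eqI)
  qed (use fg q1 in \<open>simp_all add: B_def\<close>)
qed

text \<open>Since \<open>i\<close> is mono, the action of \<open>A\<close> restricts along it and
  the axioms are checked after composing with \<open>i\<close>. The equation for \<open>a\<close> is
  part of the conclusion because it later identifies \<open>a\<close> with the action of
  \<open>homE_mod\<close>, which is given by a formula.\<close>

lemma equalizer_Mod:
  assumes f: "f \<in> Ar (Mod_cat M E)" and g: "g \<in> Ar (Mod_cat M E)"
    and fg: "msrc g = msrc f" "mtgt g = mtgt f"
    and i: "is_equalizer M (marr f) (marr g) i"
  defines "A \<equiv> msrc f" and "H \<equiv> src M i"
  obtains a where "a \<in> hom M (H \<otimes> e) H" "i \<cdot> a = act A \<cdot> (i \<boxtimes> idt M e)"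
    "is_equalizer (Mod_cat M E) f g (MHom (RMod H a) i A)"
proof -
  note f1 = f[unfolded Ar_Mod_cat] and g1 = g[unfolded Ar_Mod_cat fg]
  note i1 = equalizer_arr[OF i]
  note ar = rmod_arr[OF conjunct1[OF f1], folded A_def]
    rmod_arr[OF conjunct1[OF conjunct2[OF f1]]]
  have [simp]: "marr f \<in> Ar M" "marr g \<in> Ar M" "src M (marr f) = car A"
      "src M (marr g) = car A" "tgt M (marr f) = car (mtgt f)" "tgt M (marr g) = car (mtgt f)"
      "i \<in> Ar M" "tgt M i = car A" "src M i = H" "H \<in> Ob M"
    using f1 g1 i1 by (auto simp: A_def H_def)
  note [simp] = ar
  have fact: "act (mtgt f) \<cdot> (marr f \<boxtimes> idt M e) = marr f \<cdot> act A"
    "act (mtgt f) \<cdot> (marr g \<boxtimes> idt M e) = marr g \<cdot> act A"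
    using f1 g1 by (simp_all add: A_def)
  have A: "is_rmod M E A" using f1 by (simp add: A_def)
  have "marr f \<cdot> (act A \<cdot> (i \<boxtimes> idt M e)) = act (mtgt f) \<cdot> ((marr f \<cdot> i) \<boxtimes> idt M e)"
    by (subst cmp_cmp_eq[OF fact(1)[symmetric]]) (simp_all add: merge)
  also have "\<dots> = act (mtgt f) \<cdot> ((marr g \<cdot> i) \<boxtimes> idt M e)" using i1 by simp
  also have "\<dots> = marr g \<cdot> (act A \<cdot> (i \<boxtimes> idt M e))"
    by (subst cmp_cmp_eq[OF fact(2)[symmetric]]) (simp_all add: merge)
  finally obtain a where a [simp]: "a \<in> Ar M" "src M a = H \<otimes> e" "tgt M a = H"
      and ia: "i \<cdot> a = act A \<cdot> (i \<boxtimes> idt M e)"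
    using equalizer_factor[OF i, of "act A \<cdot> (i \<boxtimes> idt M e)"] by auto
  have H: "is_rmod M E (RMod H a)"
  proof (rule is_rmodI)
    show "a \<cdot> (a \<boxtimes> idt M e) = a \<cdot> (idt M H \<boxtimes> m) \<cdot> asc M H e e"
    proof (rule equalizer_mono[OF i])
      have "i \<cdot> (a \<cdot> (a \<boxtimes> idt M e)) = act A \<cdot> ((i \<cdot> a) \<boxtimes> idt M e)"
        by (simp add: cmp_cmp_eq[OF ia] merge)
      also have "\<dots> = act A \<cdot> (act A \<boxtimes> idt M e) \<cdot> (i \<boxtimes> idt M e \<boxtimes> idt M e)"
        by (simp add: ia merge)
      also have "\<dots> = act A \<cdot> ((idt M (car A) \<boxtimes> m) \<cdot> (asc M (car A) e e \<cdot> (i \<boxtimes> idt M e \<boxtimes> idt M e)))"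
        by (simp add: rmod_assoc[OF A] del: cmp_assoc_arr) simp
      also have "\<dots> = act A \<cdot> ((i \<boxtimes> idt M e) \<cdot> ((idt M H \<boxtimes> m) \<cdot> asc M H e e))"
        by (simp add: asc_nat_arr merge)
      also have "\<dots> = i \<cdot> (a \<cdot> (idt M H \<boxtimes> m) \<cdot> asc M H e e)"
        by (simp add: cmp_cmp_eq[OF ia])
      finally show "i \<cdot> (a \<cdot> (a \<boxtimes> idt M e)) = i \<cdot> (a \<cdot> (idt M H \<boxtimes> m) \<cdot> asc M H e e)" .
    qed simp_all
    show "a \<cdot> (idt M H \<boxtimes> u) = run M H"
    proof (rule equalizer_mono[OF i])
      have "i \<cdot> (a \<cdot> (idt M H \<boxtimes> u)) = act A \<cdot> (idt M (car A) \<boxtimes> u) \<cdot> (i \<boxtimes> idt M (unt M))"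
        by (simp add: cmp_cmp_eq[OF ia] merge)
      also have "\<dots> = i \<cdot> run M H"
        unfolding rmod_unit[OF A] by (simp add: run_nat_arr)
      finally show "i \<cdot> (a \<cdot> (idt M H \<boxtimes> u)) = i \<cdot> run M H" .
    qed simp_all
  qed simp_all
  have "is_equalizer (Mod_cat M E) f g (MHom (RMod H a) i A)"
  proof (rule Mod.is_equalizerI)
    show "f \<in> Ar (Mod_cat M E)" "g \<in> Ar (Mod_cat M E)" by (fact f g)+
    show "MHom (RMod H a) i A \<in> Ar (Mod_cat M E)"
      using A H by (simp add: Ar_Mod_cat ia)
    fix h assume h: "h \<in> Ar (Mod_cat M E)" "tgt (Mod_cat M E) h = src (Mod_cat M E) f"
      "f \<cdot>\<^bsub>Mod_cat M E\<^esub> h = g \<cdot>\<^bsub>Mod_cat M E\<^esub> h"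
    have Z: "is_rmod M E (msrc h)" and [simp]: "marr h \<in> Ar M" "tgt M (marr h) = car A"
        "src M (marr h) = car (msrc h)" and
      hact: "act A \<cdot> (marr h \<boxtimes> idt M e) = marr h \<cdot> act (msrc h)"
      using h(1,2) by (auto simp: Ar_Mod_cat A_def)
    note [simp] = rmod_arr[OF Z]
    have "marr f \<cdot> marr h = marr g \<cdot> marr h" using h(3) by simp
    then obtain k where k [simp]: "k \<in> Ar M" "tgt M k = H" "src M k = car (msrc h)"
        and ik: "i \<cdot> k = marr h"
      using equalizer_factor[OF i, of "marr h"] by auto
    have "a \<cdot> (k \<boxtimes> idt M e) = k \<cdot> act (msrc h)"
      by (rule equalizer_mono[OF i])
        (simp_all add: merge ik hact cmp_cmp_eq[OF ia] cmp_cmp_eq[OF ik])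
    then have "MHom (msrc h) k (RMod H a) \<in> Ar (Mod_cat M E)"
      using Z H by (simp add: Ar_Mod_cat)
    then show "\<exists>k. k \<in> Ar (Mod_cat M E) \<and> src (Mod_cat M E) k = src (Mod_cat M E) h \<and>
        tgt (Mod_cat M E) k = src (Mod_cat M E) (MHom (RMod H a) i A) \<and>
        MHom (RMod H a) i A \<cdot>\<^bsub>Mod_cat M E\<^esub> k = h"
      by (intro exI[of _ "MHom (msrc h) k (RMod H a)"])
        (use h(2) in \<open>auto simp: ik A_def intro: mhom_eqI\<close>)
  next
    fix h k assume h: "h \<in> Ar (Mod_cat M E)" "k \<in> Ar (Mod_cat M E)"
      "tgt (Mod_cat M E) h = src (Mod_cat M E) (MHom (RMod H a) i A)"
      "tgt (Mod_cat M E) k = src (Mod_cat M E) (MHom (RMod H a) i A)"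
      "MHom (RMod H a) i A \<cdot>\<^bsub>Mod_cat M E\<^esub> h = MHom (RMod H a) i A \<cdot>\<^bsub>Mod_cat M E\<^esub> k"
    have "marr h = marr k"
      by (rule equalizer_mono[OF i]) (use h in \<open>auto simp: Ar_Mod_cat\<close>)
    then show "h = k" using h by (auto intro: mhom_eqI)
  qed (use fg i1 in \<open>simp_all add: A_def\<close>)
  then show thesis using that[of a] ia by simp
qed

end

section \<open>Families of module maps and the bar resolution\<close>

context csmc_monoid
begin

text \<open>A module without its axioms: the construction of \<open>Hom\<^sub>E\<close> only uses the type of the actions.\<close>

definition pre_rmod :: "('o, 'a) rmod \<Rightarrow> bool" where
  "pre_rmod X \<longleftrightarrow> car X \<in> Ob M \<and> act X \<in> Ar M \<and> src M (act X) = car X \<otimes> e \<and> tgt M (act X) = car X"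

lemma pre_rmod_arr:
  assumes "pre_rmod X"
  shows "car X \<in> Ob M" "act X \<in> Ar M" "src M (act X) = car X \<otimes> e" "tgt M (act X) = car X"
  using assms by (auto simp: pre_rmod_def)

lemma rmod_pre [simp]: "is_rmod M E X \<Longrightarrow> pre_rmod X"
  by (auto simp: pre_rmod_def is_rmod_def)

declare pre_rmod_arr [simp]

text \<open>Linearity for the action on \<open>K \<otimes> X\<close>. Such \<open>f\<close> are the
  generalized elements of the hom object: they correspond to maps
  \<open>K \<rightarrow> Hom\<^sub>E(X, Y)\<close>.\<close>

definition mod_map :: "'o \<Rightarrow> ('o, 'a) rmod \<Rightarrow> ('o, 'a) rmod \<Rightarrow> 'a \<Rightarrow> bool" where
  "mod_map K X Y f \<longleftrightarrow> K \<in> Ob M \<and> pre_rmod X \<and> pre_rmod Y \<and>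
     f \<in> Ar M \<and> src M f = K \<otimes> car X \<and> tgt M f = car Y \<and>
     act Y \<cdot> (f \<boxtimes> idt M e) = f \<cdot> ((idt M K \<boxtimes> act X) \<cdot> asc M K (car X) e)"

lemma mod_map_arr:
  assumes "mod_map K X Y f"
  shows "K \<in> Ob M" "pre_rmod X" "pre_rmod Y" "f \<in> Ar M" "src M f = K \<otimes> car X" "tgt M f = car Y"
    "act Y \<cdot> (f \<boxtimes> idt M e) = f \<cdot> ((idt M K \<boxtimes> act X) \<cdot> asc M K (car X) e)"
  using assms by (auto simp: mod_map_def)

lemma mod_map_cmp:
  assumes f: "mod_map K X Y f" and k: "k \<in> Ar M" "tgt M k = K"
  shows "mod_map (src M k) X Y (f \<cdot> (k \<boxtimes> idt M (car X)))"
proof -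
  note f' = mod_map_arr[OF f]
  note [simp] = f'(1-6) k pre_rmod_arr[OF f'(2)] pre_rmod_arr[OF f'(3)]
  have "act Y \<cdot> ((f \<cdot> (k \<boxtimes> idt M (car X))) \<boxtimes> idt M e) =
      act Y \<cdot> ((f \<boxtimes> idt M e) \<cdot> (k \<boxtimes> idt M (car X) \<boxtimes> idt M e))"
    by (simp add: merge)
  also have "\<dots> = f \<cdot> ((idt M K \<boxtimes> act X) \<cdot> (asc M K (car X) e \<cdot> (k \<boxtimes> idt M (car X) \<boxtimes> idt M e)))"
    by (simp add: cmp_cmp_eq[OF f'(7)])
  also have "\<dots> = f \<cdot> (k \<boxtimes> idt M (car X)) \<cdot>
      ((idt M (src M k) \<boxtimes> act X) \<cdot> asc M (src M k) (car X) e)"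
    by (simp add: asc_nat_arr merge)
  finally show ?thesis by (simp add: mod_map_def)
qed

text \<open>Enriched composition in uncurried form. Moving the action through both families produces
  two bracketings of four factors, which the pentagon reconciles.\<close>

lemma mod_map_comp:
  assumes g: "mod_map L Y Z g" and f: "mod_map K X Y f"
  shows "mod_map (L \<otimes> K) X Z (g \<cdot> ((idt M L \<boxtimes> f) \<cdot> asc M L K (car X)))"
proof -
  note f' = mod_map_arr[OF f] and g' = mod_map_arr[OF g]
  note [simp] = f'(1-6) g'(1-6) pre_rmod_arr[OF f'(2)] pre_rmod_arr[OF f'(3)] pre_rmod_arr[OF g'(3)]
  have "act Z \<cdot> ((g \<cdot> ((idt M L \<boxtimes> f) \<cdot> asc M L K (car X))) \<boxtimes> idt M e) =
      act Z \<cdot> ((g \<boxtimes> idt M e) \<cdot> ((idt M L \<boxtimes> f \<boxtimes> idt M e) \<cdot> (asc M L K (car X) \<boxtimes> idt M e)))"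
    by (simp add: merge)
  also have "\<dots> = g \<cdot> ((idt M L \<boxtimes> act Y) \<cdot>
      (asc M L (car Y) e \<cdot> ((idt M L \<boxtimes> f \<boxtimes> idt M e) \<cdot> (asc M L K (car X) \<boxtimes> idt M e))))"
    by (simp add: cmp_cmp_eq[OF g'(7)])
  also have "\<dots> = g \<cdot> ((idt M L \<boxtimes> (act Y \<cdot> (f \<boxtimes> idt M e))) \<cdot>
      (asc M L (K \<otimes> car X) e \<cdot> (asc M L K (car X) \<boxtimes> idt M e)))"
    by (simp add: asc_nats) (simp add: merge)
  also have "\<dots> = g \<cdot> ((idt M L \<boxtimes> (f \<cdot> (idt M K \<boxtimes> act X))) \<cdot>
      ((idt M L \<boxtimes> asc M K (car X) e) \<cdot> asc M L (K \<otimes> car X) e \<cdot> (asc M L K (car X) \<boxtimes> idt M e)))"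
    by (simp add: f'(7) merge)
  also have "\<dots> = g \<cdot> ((idt M L \<boxtimes> (f \<cdot> (idt M K \<boxtimes> act X))) \<cdot>
      (asc M L K (car X \<otimes> e) \<cdot> asc M (L \<otimes> K) (car X) e))"
    by (subst pentagon) simp_all
  also have "\<dots> = g \<cdot> ((idt M L \<boxtimes> f) \<cdot> asc M L K (car X)) \<cdot>
      ((idt M (L \<otimes> K) \<boxtimes> act X) \<cdot> asc M (L \<otimes> K) (car X) e)"
    by (simp add: asc_nats merge)
  finally show ?thesis by (simp add: mod_map_def)
qed

lemma ten_mod_simps [simp]:
  "car (ten_mod M E K X) = K \<otimes> car X"
  "act (ten_mod M E K X) = (idt M K \<boxtimes> act X) \<cdot> asc M K (car X) e"
  by (simp_all add: ten_mod_def)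

text \<open>The pentagon reduces associativity to that of \<open>X\<close>, and
  \<open>run_asc\<close> reduces the unit law to that of \<open>X\<close>.\<close>

lemma rmod_ten [simp]:
  assumes X: "is_rmod M E X" and [simp]: "K \<in> Ob M"
  shows "is_rmod M E (ten_mod M E K X)"
  unfolding ten_mod_def
proof (rule is_rmodI)
  note [simp] = rmod_arr[OF X]
  let ?a = "(idt M K \<boxtimes> act X) \<cdot> asc M K (car X) e"
  have "?a \<cdot> (?a \<boxtimes> idt M e) = ?a \<cdot> ((idt M K \<boxtimes> act X \<boxtimes> idt M e) \<cdot> (asc M K (car X) e \<boxtimes> idt M e))"
    by (simp add: merge)
  also have "\<dots> = (idt M K \<boxtimes> (act X \<cdot> (act X \<boxtimes> idt M e))) \<cdot>
      (asc M K (car X \<otimes> e) e \<cdot> (asc M K (car X) e \<boxtimes> idt M e))"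
    by (simp add: asc_nats) (simp add: merge)
  also have "\<dots> = (idt M K \<boxtimes> (act X \<cdot> (idt M (car X) \<boxtimes> m))) \<cdot>
      ((idt M K \<boxtimes> asc M (car X) e e) \<cdot> asc M K (car X \<otimes> e) e \<cdot> (asc M K (car X) e \<boxtimes> idt M e))"
    by (simp add: rmod_assoc[OF X] merge)
  also have "\<dots> = (idt M K \<boxtimes> (act X \<cdot> (idt M (car X) \<boxtimes> m))) \<cdot>
      (asc M K (car X) (e \<otimes> e) \<cdot> asc M (K \<otimes> car X) e e)"
    by (subst pentagon) simp_all
  also have "\<dots> = ?a \<cdot> (idt M (K \<otimes> car X) \<boxtimes> m) \<cdot> asc M (K \<otimes> car X) e e"
    by (simp add: asc_nats merge)
  finally show "?a \<cdot> (?a \<boxtimes> idt M e) = ?a \<cdot> (idt M (K \<otimes> car X) \<boxtimes> m) \<cdot> asc M (K \<otimes> car X) e e" .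
  show "?a \<cdot> (idt M (K \<otimes> car X) \<boxtimes> u) = run M (K \<otimes> car X)"
    by (simp add: asc_nats merge rmod_unit[OF X] run_asc)
qed (use rmod_arr[OF X] in simp_all)

lemma mod_map_iff:
  assumes "K \<in> Ob M" "is_rmod M E X" "is_rmod M E Y"
  shows "mod_map K X Y f \<longleftrightarrow> MHom (ten_mod M E K X) f Y \<in> Ar (Mod_cat M E)"
  using assms by (auto simp: mod_map_def Ar_Mod_cat)

text \<open>The universal family indexed by \<open>K\<close>; its adjoint
  \<open>K \<rightarrow> Hom\<^sub>E(X, K \<otimes> X)\<close> is what both kinds of strength map
  are built from.\<close>

lemma mod_map_ten:
  assumes "K \<in> Ob M" "is_rmod M E X"
  shows "mod_map K X (ten_mod M E K X) (idt M (K \<otimes> car X))"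
  using assms rmod_arr[of E X] by (simp add: mod_map_def)

text \<open>Associativity says that acting on a point of \<open>X\<close> is linear in
  \<open>E\<close>: the action is a family of module maps \<open>E \<rightarrow> X\<close> indexed
  by \<open>X\<close> itself. Its adjoint is \<open>yonE\<close>.\<close>

lemma mod_map_act:
  assumes "is_rmod M E X"
  shows "mod_map (car X) (reg_mod E) X (act X)"
  using assms rmod_arr[OF assms] rmod_assoc[OF assms] by (simp add: mod_map_def)

text \<open>A single module map becomes a family indexed by the unit, the one that
  \<open>nameE\<close> curries; linearity of the unitor is \<open>lun_asc\<close>.\<close>

lemma mod_map_lun:
  assumes f: "f \<in> Ar (Mod_cat M E)"
  shows "mod_map (unt M) (msrc f) (mtgt f) (marr f \<cdot> lun M (car (msrc f)))"
proof -
  have [simp]: "is_rmod M E (msrc f)" "is_rmod M E (mtgt f)"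
      "marr f \<in> Ar M" "src M (marr f) = car (msrc f)" "tgt M (marr f) = car (mtgt f)"
    and fa: "act (mtgt f) \<cdot> (marr f \<boxtimes> idt M e) = marr f \<cdot> act (msrc f)"
    using f unfolding Ar_Mod_cat by auto
  note [simp] = rmod_arr[of E "msrc f"] rmod_arr[of E "mtgt f"]
  have "act (mtgt f) \<cdot> ((marr f \<cdot> lun M (car (msrc f))) \<boxtimes> idt M e) =
      act (mtgt f) \<cdot> ((marr f \<boxtimes> idt M e) \<cdot> (lun M (car (msrc f)) \<boxtimes> idt M e))"
    by (simp add: merge)
  also have "\<dots> = marr f \<cdot> (act (msrc f) \<cdot> (lun M (car (msrc f) \<otimes> e) \<cdot> asc M (unt M) (car (msrc f)) e))"
    by (simp add: cmp_cmp_eq[OF fa] lun_asc)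
  also have "\<dots> = marr f \<cdot> (lun M (car (msrc f)) \<cdot>
      ((idt M (unt M) \<boxtimes> act (msrc f)) \<cdot> asc M (unt M) (car (msrc f)) e))"
    by (simp add: cmp_cmp_eq[OF lun_nat_arr])
  finally show ?thesis by (simp add: mod_map_def)
qed

declare mod_map_act [simp]

lemma mod_map_mul [simp]: "mod_map e (reg_mod E) (reg_mod E) m"
  using mod_map_act[of "reg_mod E"] by simp

lemma mod_map_ten_reg [simp]:
  "K \<in> Ob M \<Longrightarrow> mod_map K (reg_mod E) (ten_mod M E K (reg_mod E)) (idt M (K \<otimes> e))"
  using mod_map_ten[of K "reg_mod E"] by simp

lemma mod_map_post:
  assumes f: "mod_map K X Y f" and d: "d \<in> Ar (Mod_cat M E)" "msrc d = Y"
  shows "mod_map K X (mtgt d) (marr d \<cdot> f)"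
proof -
  note f' = mod_map_arr[OF f]
  have [simp]: "is_rmod M E (mtgt d)" "marr d \<in> Ar M" "src M (marr d) = car Y" "tgt M (marr d) = car (mtgt d)"
    and da: "act (mtgt d) \<cdot> (marr d \<boxtimes> idt M e) = marr d \<cdot> act Y"
    using d unfolding Ar_Mod_cat by auto
  note [simp] = f'(1-6)
  have "act (mtgt d) \<cdot> ((marr d \<cdot> f) \<boxtimes> idt M e) = act (mtgt d) \<cdot> ((marr d \<boxtimes> idt M e) \<cdot> (f \<boxtimes> idt M e))"
    by (simp add: merge)
  also have "\<dots> = marr d \<cdot> (act Y \<cdot> (f \<boxtimes> idt M e))"
    by (simp add: cmp_cmp_eq[OF da])
  finally show ?thesis by (simp add: mod_map_def f'(7))
qed

text \<open>The map \<open>x\<close> is \<open>h\<close> after the inverse of \<open>i\<close>,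
  hence linear. This gives linearity of maps out of \<open>Hom(K, FE)\<close> without computing with
  the action there.\<close>

lemma Mod_lift_right:
  assumes i: "is_iso (Mod_cat M E) i" and h: "h \<in> Ar (Mod_cat M E)" "msrc h = msrc i"
    and x: "x \<in> Ar M" "src M x = car (mtgt i)" "x \<cdot> marr i = marr h"
  shows "MHom (mtgt i) x (mtgt h) \<in> Ar (Mod_cat M E)"
proof -
  let ?j = "inv_arr (Mod_cat M E) i"
  have j: "?j \<in> Ar (Mod_cat M E)" "msrc ?j = mtgt i" "mtgt ?j = msrc i"
    using Mod.inv_arr[OF i] by auto
  have "marr i \<cdot> marr ?j = idt M (car (mtgt i))"
    using Mod.cmp_inv_arr[OF i] by simp
  moreover have "marr i \<in> Ar M" "marr ?j \<in> Ar M" "src M (marr i) = car (msrc i)" "tgt M (marr i) = car (mtgt i)"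
      "src M (marr ?j) = car (mtgt i)" "tgt M (marr ?j) = car (msrc i)"
    using Mod.is_iso_arr[OF i] j by (auto simp: Ar_Mod_cat)
  ultimately have "marr h \<cdot> marr ?j = x"
    using x(1,2) unfolding x(3)[symmetric] by simp
  then have "h \<cdot>\<^bsub>Mod_cat M E\<^esub> ?j = MHom (mtgt i) x (mtgt h)"
    using j by simp
  then show ?thesis using Mod.cmp_arr(1)[OF j(1) h(1)] j h by simp
qed

text \<open>The bar resolution \<open>(X \<otimes> E) \<otimes> E \<rightrightarrows> X \<otimes> E \<rightarrow> X\<close>, split in the underlying category by the unit of \<open>E\<close>.\<close>

definition bar0 :: "('o, 'a) rmod \<Rightarrow> ('o, 'a) mhom" where
  "bar0 X = MHom (ten_mod M E (car X \<otimes> e) (reg_mod E)) (act X \<boxtimes> idt M e) (ten_mod M E (car X) (reg_mod E))"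

definition bar1 :: "('o, 'a) rmod \<Rightarrow> ('o, 'a) mhom" where
  "bar1 X = MHom (ten_mod M E (car X \<otimes> e) (reg_mod E))
     ((idt M (car X) \<boxtimes> m) \<cdot> asc M (car X) e e) (ten_mod M E (car X) (reg_mod E))"

definition bar_proj :: "('o, 'a) rmod \<Rightarrow> ('o, 'a) mhom" where
  "bar_proj X = MHom (ten_mod M E (car X) (reg_mod E)) (act X) X"

lemma bar_arr:
  assumes X: "is_rmod M E X"
  shows "bar0 X \<in> Ar (Mod_cat M E)" "bar1 X \<in> Ar (Mod_cat M E)" "bar_proj X \<in> Ar (Mod_cat M E)"
proof -
  note [simp] = X rmod_arr[OF X]
  show "bar0 X \<in> Ar (Mod_cat M E)"
    by (simp add: bar0_def Ar_Mod_cat asc_nats merge)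
  have "mod_map (car X \<otimes> e) (reg_mod E) (ten_mod M E (car X) (reg_mod E))
     (idt M (car X \<otimes> e) \<cdot> ((idt M (car X) \<boxtimes> m) \<cdot> asc M (car X) e e))"
    using mod_map_comp[OF mod_map_ten[of "car X" "reg_mod E"] mod_map_act[of "reg_mod E"]] by simp
  then show "bar1 X \<in> Ar (Mod_cat M E)"
    by (simp add: mod_map_iff bar1_def)
  show "bar_proj X \<in> Ar (Mod_cat M E)"
    using mod_map_act[OF X] by (simp add: mod_map_iff bar_proj_def)
qed

text \<open>The splitting lives in \<open>M\<close> and is not linear, so it gives the factorization
  and its uniqueness at once, but linearity of the factorization needs its own argument.\<close>

lemma bar_coequalizer:
  assumes X: "is_rmod M E X"
  shows "is_coequalizer (Mod_cat M E) (bar0 X) (bar1 X) (bar_proj X)"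
proof (rule Mod.is_coequalizerI)
  note [simp] = X rmod_arr[OF X]
  let ?X = "car X"
  \<comment> \<open>On elements these insert the unit: \<open>?s\<close> sends \<open>x\<close> to
    \<open>x \<otimes> 1\<close>, and \<open>?t\<close> sends \<open>x \<otimes> y\<close> to
    \<open>x \<otimes> y \<otimes> 1\<close>. They satisfy the equations of a split
    coequalizer.\<close>
  let ?s = "(idt M ?X \<boxtimes> u) \<cdot> inv_arr M (run M ?X)"
  let ?t = "(idt M (?X \<otimes> e) \<boxtimes> u) \<cdot> inv_arr M (run M (?X \<otimes> e))"
  have qs: "act X \<cdot> ?s = idt M ?X"
    by (simp add: cmp_cmp_eq[OF rmod_unit[OF X]])
  have d1t: "(idt M ?X \<boxtimes> m) \<cdot> asc M ?X e e \<cdot> ?t = idt M (?X \<otimes> e)"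
    by (simp add: asc_nats merge mon_runit cmp_cmp_eq[OF run_asc])
  have d0t: "(act X \<boxtimes> idt M e) \<cdot> ?t = ?s \<cdot> act X"
  proof -
    have "inv_arr M (run M ?X) \<cdot> act X = (act X \<boxtimes> idt M (unt M)) \<cdot> inv_arr M (run M (?X \<otimes> e))"
      by (rule inv_arr_commute) (simp_all add: run_nat_arr)
    then show ?thesis by (simp add: merge)
  qed
  show "bar0 X \<in> Ar (Mod_cat M E)" "bar1 X \<in> Ar (Mod_cat M E)" "bar_proj X \<in> Ar (Mod_cat M E)"
    by (fact bar_arr[OF X])+
  show "bar_proj X \<cdot>\<^bsub>Mod_cat M E\<^esub> bar0 X = bar_proj X \<cdot>\<^bsub>Mod_cat M E\<^esub> bar1 X"
    using rmod_assoc[OF X] by (simp add: bar_proj_def bar0_def bar1_def)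
  fix h assume h: "h \<in> Ar (Mod_cat M E)" "src (Mod_cat M E) h = tgt (Mod_cat M E) (bar0 X)"
    "h \<cdot>\<^bsub>Mod_cat M E\<^esub> bar0 X = h \<cdot>\<^bsub>Mod_cat M E\<^esub> bar1 X"
  have Z: "is_rmod M E (mtgt h)" and [simp]: "marr h \<in> Ar M" "src M (marr h) = ?X \<otimes> e"
      "tgt M (marr h) = car (mtgt h)" and
    hact: "act (mtgt h) \<cdot> (marr h \<boxtimes> idt M e) = marr h \<cdot> ((idt M ?X \<boxtimes> m) \<cdot> asc M ?X e e)"
    using h(1,2) by (auto simp: Ar_Mod_cat bar0_def)
  note [simp] = rmod_arr[OF Z]
  have hd: "marr h \<cdot> (act X \<boxtimes> idt M e) = marr h \<cdot> ((idt M ?X \<boxtimes> m) \<cdot> asc M ?X e e)"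
    using h(3) by (simp add: bar0_def bar1_def)
  let ?k = "marr h \<cdot> ?s"
  have kq: "?k \<cdot> act X = marr h"
  proof -
    have "?k \<cdot> act X = marr h \<cdot> (?s \<cdot> act X)" by simp
    also have "\<dots> = marr h \<cdot> ((act X \<boxtimes> idt M e) \<cdot> ?t)" unfolding d0t ..
    also have "\<dots> = marr h \<cdot> ((idt M ?X \<boxtimes> m) \<cdot> asc M ?X e e \<cdot> ?t)"
      by (simp add: cmp_cmp_eq[OF hd])
    also have "\<dots> = marr h" unfolding d1t by simp
    finally show ?thesis .
  qed
  \<comment> \<open>The map of \<open>bar1\<close> is also the action on
    \<open>X \<otimes> E\<close>. Linearity of \<open>h\<close> therefore produces it, the
    coequalizing condition \<open>hd\<close> trades it for \<open>act X \<boxtimes> idt M e\<close>,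
    and there \<open>?s\<close> cancels by \<open>qs\<close>.\<close>
  have "act (mtgt h) \<cdot> (?k \<boxtimes> idt M e) = act (mtgt h) \<cdot> ((marr h \<boxtimes> idt M e) \<cdot> (?s \<boxtimes> idt M e))"
    by (simp add: merge)
  also have "\<dots> = marr h \<cdot> ((idt M ?X \<boxtimes> m) \<cdot> asc M ?X e e) \<cdot> (?s \<boxtimes> idt M e)"
    by (subst cmp_cmp_eq[OF hact]) simp_all
  also have "\<dots> = marr h \<cdot> ((act X \<boxtimes> idt M e) \<cdot> (?s \<boxtimes> idt M e))"
    unfolding hd[symmetric] by simp
  also have "\<dots> = marr h" using qs by (simp add: merge)
  finally have k: "act (mtgt h) \<cdot> (?k \<boxtimes> idt M e) = ?k \<cdot> act X" using kq by simp
  have "MHom X ?k (mtgt h) \<in> Ar (Mod_cat M E)"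
    using Z k by (simp add: Ar_Mod_cat)
  then show "\<exists>k. k \<in> Ar (Mod_cat M E) \<and> src (Mod_cat M E) k = tgt (Mod_cat M E) (bar_proj X) \<and>
      tgt (Mod_cat M E) k = tgt (Mod_cat M E) h \<and> k \<cdot>\<^bsub>Mod_cat M E\<^esub> bar_proj X = h"
    using kq h(2) by (intro exI[of _ "MHom X ?k (mtgt h)"])
      (auto simp: bar_proj_def bar0_def intro: mhom_eqI)
next
  note [simp] = X rmod_arr[OF X]
  fix h k assume h: "h \<in> Ar (Mod_cat M E)" "k \<in> Ar (Mod_cat M E)"
    "src (Mod_cat M E) h = tgt (Mod_cat M E) (bar_proj X)"
    "src (Mod_cat M E) k = tgt (Mod_cat M E) (bar_proj X)"
    "h \<cdot>\<^bsub>Mod_cat M E\<^esub> bar_proj X = k \<cdot>\<^bsub>Mod_cat M E\<^esub> bar_proj X"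
  have eq: "marr h \<cdot> act X = marr k \<cdot> act X" "mtgt h = mtgt k" "msrc h = X" "msrc k = X"
    using h(3-5) by (auto simp: bar_proj_def)
  have [simp]: "marr h \<in> Ar M" "marr k \<in> Ar M" "src M (marr h) = car X" "src M (marr k) = car X"
    using h(1,2) eq by (auto simp: Ar_Mod_cat)
  have "marr h \<cdot> (act X \<cdot> (idt M (car X) \<boxtimes> u)) = marr k \<cdot> (act X \<cdot> (idt M (car X) \<boxtimes> u))"
    by (simp add: cmp_cmp_eq[OF eq(1)])
  then have "marr h = marr k"
    unfolding rmod_unit[OF X] by (rule iso_cancel_right[rotated -1]) simp_all
  then show "h = k" using eq by (auto intro: mhom_eqI)
qed (simp_all add: bar0_def bar1_def bar_proj_def)

end

section \<open>The hom object \<open>Hom\<^sub>E(X, Y)\<close> as representing object of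
  families\<close>

locale csmc_monoid_complete = csmc_monoid M E for M :: "('o, 'a) csmc" (structure) and E +
  assumes limits: "has_finite_limits M"
begin

text \<open>The parallel maps inside \<open>homE_incl\<close> receive names because they return as
  maps between the \<open>E'\<close>-modules \<open>Hom(X, FE)\<close> and
  \<open>Hom(X \<otimes> E, FE)\<close>.\<close>

definition homE0 :: "('o, 'a) rmod \<Rightarrow> ('o, 'a) rmod \<Rightarrow> 'a" where
  "homE0 X Y = cur M (ihom M (car X) (car Y)) (car X \<otimes> e) (car Y)
     (ev M (car X) (car Y) \<cdot> (idt M (ihom M (car X) (car Y)) \<boxtimes> act X))"

definition homE1 :: "('o, 'a) rmod \<Rightarrow> ('o, 'a) rmod \<Rightarrow> 'a" where
  "homE1 X Y = cur M (ihom M (car X) (car Y)) (car X \<otimes> e) (car Y)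
     (act Y \<cdot> (ev M (car X) (car Y) \<boxtimes> idt M e) \<cdot> inv_arr M (asc M (ihom M (car X) (car Y)) (car X) e))"

context
  fixes X Y :: "('o, 'a) rmod"
  assumes X [simp]: "pre_rmod X" and Y [simp]: "pre_rmod Y"
begin

lemma homE01_arr [simp]:
  "homE0 X Y \<in> Ar M" "src M (homE0 X Y) = ihom M (car X) (car Y)"
  "tgt M (homE0 X Y) = ihom M (car X \<otimes> e) (car Y)"
  "homE1 X Y \<in> Ar M" "src M (homE1 X Y) = ihom M (car X) (car Y)"
  "tgt M (homE1 X Y) = ihom M (car X \<otimes> e) (car Y)"
  by (simp_all add: homE0_def homE1_def)

lemma homE_equalizer: "is_equalizer M (homE0 X Y) (homE1 X Y) (homE_incl M E X Y)"
proof -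
  have "homE_incl M E X Y = equ M (homE0 X Y) (homE1 X Y)"
    by (simp add: homE_incl_def homE0_def homE1_def)
  then show ?thesis using has_equalizers[OF limits] by simp
qed

lemma homE_incl_arr [simp]:
  "homE_incl M E X Y \<in> Ar M" "src M (homE_incl M E X Y) = homE M E X Y"
  "tgt M (homE_incl M E X Y) = ihom M (car X) (car Y)" "homE M E X Y \<in> Ob M"
  using equalizer_arr[OF homE_equalizer] by (auto simp: homE_def)

text \<open>Transposing both composites turns the equalizing condition into the linearity square, up
  to an invertible associator. Hence \<open>Hom\<^sub>E(X, Y)\<close> represents
  \<open>mod_map\<close>.\<close>

lemma homE01_eq_iff:
  assumes [simp]: "k \<in> Ar M" "tgt M k = ihom M (car X) (car Y)"
  shows "homE0 X Y \<cdot> k = homE1 X Y \<cdot> k \<longleftrightarrow>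
    mod_map (src M k) X Y (ev M (car X) (car Y) \<cdot> (k \<boxtimes> idt M (car X)))"
proof -
  let ?K = "src M k" and ?ev = "ev M (car X) (car Y)"
  let ?f = "?ev \<cdot> (k \<boxtimes> idt M (car X))"
  have 0: "homE0 X Y \<cdot> k = cur M ?K (car X \<otimes> e) (car Y) (?f \<cdot> (idt M ?K \<boxtimes> act X))"
    by (simp add: homE0_def cur_cmp merge)
  have 1: "homE1 X Y \<cdot> k = cur M ?K (car X \<otimes> e) (car Y)
      (act Y \<cdot> (?f \<boxtimes> idt M e) \<cdot> inv_arr M (asc M ?K (car X) e))"
    by (simp add: homE1_def cur_cmp inv_asc_nats merge)
  have "homE0 X Y \<cdot> k = homE1 X Y \<cdot> k \<longleftrightarrow>
      ?f \<cdot> (idt M ?K \<boxtimes> act X) = act Y \<cdot> (?f \<boxtimes> idt M e) \<cdot> inv_arr M (asc M ?K (car X) e)"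
    unfolding 0 1 by (rule iffI, rule cur_inj[rotated -1]) simp_all
  also have "\<dots> \<longleftrightarrow> act Y \<cdot> (?f \<boxtimes> idt M e) = ?f \<cdot> ((idt M ?K \<boxtimes> act X) \<cdot> asc M ?K (car X) e)"
  proof
    assume "?f \<cdot> (idt M ?K \<boxtimes> act X) = act Y \<cdot> (?f \<boxtimes> idt M e) \<cdot> inv_arr M (asc M ?K (car X) e)"
    then have "?f \<cdot> (idt M ?K \<boxtimes> act X) \<cdot> asc M ?K (car X) e =
      act Y \<cdot> (?f \<boxtimes> idt M e) \<cdot> inv_arr M (asc M ?K (car X) e) \<cdot> asc M ?K (car X) e" by (rule arg_cong)
    then show "act Y \<cdot> (?f \<boxtimes> idt M e) = ?f \<cdot> ((idt M ?K \<boxtimes> act X) \<cdot> asc M ?K (car X) e)"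
      by simp
  next
    assume "act Y \<cdot> (?f \<boxtimes> idt M e) = ?f \<cdot> ((idt M ?K \<boxtimes> act X) \<cdot> asc M ?K (car X) e)"
    then show "?f \<cdot> (idt M ?K \<boxtimes> act X) = act Y \<cdot> (?f \<boxtimes> idt M e) \<cdot> inv_arr M (asc M ?K (car X) e)"
      by simp
  qed
  finally show ?thesis by (simp add: mod_map_def)
qed

lemma mod_map_evE: "mod_map (homE M E X Y) X Y (evE M E X Y)"
  using homE01_eq_iff[of "homE_incl M E X Y"] equalizer_arr(7)[OF homE_equalizer]
  by (simp add: evE_def)

lemmas evE_arr [simp] = mod_map_arr(4-6)[OF mod_map_evE]

lemma mod_map_uncurE:
  assumes "h \<in> Ar M" "tgt M h = homE M E X Y"
  shows "mod_map (src M h) X Y (uncurE M E X Y h)"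
  using mod_map_cmp[OF mod_map_evE assms] by (simp add: uncurE_def)

lemma uncurE_arr [simp]:
  assumes "h \<in> Ar M" "tgt M h = homE M E X Y"
  shows "uncurE M E X Y h \<in> Ar M" "src M (uncurE M E X Y h) = src M h \<otimes> car X"
    "tgt M (uncurE M E X Y h) = car Y"
  using mod_map_arr(4-6)[OF mod_map_uncurE[OF assms]] by auto

lemma uncurE_cmp:
  assumes "h \<in> Ar M" "tgt M h = homE M E X Y" "k \<in> Ar M" "tgt M k = src M h"
  shows "uncurE M E X Y (h \<cdot> k) = uncurE M E X Y h \<cdot> (k \<boxtimes> idt M (car X))"
  using assms by (simp add: uncurE_def merge)

lemma homE_ext:
  assumes "g \<in> Ar M" "tgt M g = homE M E X Y" "h \<in> Ar M" "tgt M h = homE M E X Y" "src M h = src M g"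
    "uncurE M E X Y g = uncurE M E X Y h"
  shows "g = h"
proof (rule equalizer_mono[OF homE_equalizer])
  show "homE_incl M E X Y \<cdot> g = homE_incl M E X Y \<cdot> h"
    by (rule ihom_ext[of "car X" "car Y"])
      (use assms in \<open>simp_all add: uncurE_def evE_def merge\<close>)
qed (use assms in simp_all)

lemma curE_props:
  assumes f: "mod_map K X Y f"
  shows "curE M E K X Y f \<in> hom M K (homE M E X Y) \<and>
    homE_incl M E X Y \<cdot> curE M E K X Y f = cur M K (car X) (car Y) f"
  unfolding curE_def
proof (rule theI')
  note [simp] = mod_map_arr(1,4-6)[OF f]
  have "homE0 X Y \<cdot> cur M K (car X) (car Y) f = homE1 X Y \<cdot> cur M K (car X) (car Y) f"
    using f by (subst homE01_eq_iff) (simp_all add: ev_cur)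
  then have "\<exists>h. h \<in> hom M K (homE M E X Y) \<and> homE_incl M E X Y \<cdot> h = cur M K (car X) (car Y) f"
    using equalizer_factor[OF homE_equalizer, of "cur M K (car X) (car Y) f"] by auto
  moreover have "g = h" if "g \<in> hom M K (homE M E X Y) \<and> homE_incl M E X Y \<cdot> g = cur M K (car X) (car Y) f"
    "h \<in> hom M K (homE M E X Y) \<and> homE_incl M E X Y \<cdot> h = cur M K (car X) (car Y) f" for g h
    using equalizer_mono[OF homE_equalizer, of g h] that by auto
  ultimately show "\<exists>!h. h \<in> hom M K (homE M E X Y) \<and>
      homE_incl M E X Y \<cdot> h = cur M K (car X) (car Y) f" by blast
qed

lemma curE_arr [simp]:
  assumes "mod_map K X Y f"
  shows "curE M E K X Y f \<in> Ar M" "src M (curE M E K X Y f) = K" "tgt M (curE M E K X Y f) = homE M E X Y"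
  using curE_props[OF assms] by auto

lemma uncurE_curE:
  assumes "mod_map K X Y f"
  shows "uncurE M E X Y (curE M E K X Y f) = f"
proof -
  note [simp] = mod_map_arr(1,4-6)[OF assms] assms
  have "uncurE M E X Y (curE M E K X Y f) =
      ev M (car X) (car Y) \<cdot> ((homE_incl M E X Y \<cdot> curE M E K X Y f) \<boxtimes> idt M (car X))"
    by (simp add: uncurE_def evE_def merge)
  also have "\<dots> = f" using curE_props[OF assms] by (simp add: ev_cur)
  finally show ?thesis .
qed

lemma curE_cmp:
  assumes f: "mod_map K X Y f" and k: "k \<in> Ar M" "tgt M k = K"
  shows "curE M E K X Y f \<cdot> k = curE M E (src M k) X Y (f \<cdot> (k \<boxtimes> idt M (car X)))"
  by (rule homE_ext) (use mod_map_cmp[OF f k] f k in \<open>simp_all add: uncurE_cmp uncurE_curE\<close>)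

end

text \<open>The map \<open>h\<close> itself witnesses that the adjoint of \<open>f\<close> factors,
  so linearity of \<open>f\<close> is not a premise. This is how formulas written with
  \<open>curE\<close> are matched with maps that an equalizer provides.\<close>

lemma curE_eqI:
  assumes "pre_rmod X" "pre_rmod Y" "h \<in> Ar M" "src M h = K" "tgt M h = homE M E X Y"
    "homE_incl M E X Y \<cdot> h = cur M K (car X) (car Y) f"
  shows "curE M E K X Y f = h"
  unfolding curE_def
proof (rule the_equality)
  fix g assume "g \<in> hom M K (homE M E X Y) \<and> homE_incl M E X Y \<cdot> g = cur M K (car X) (car Y) f"
  then show "g = h" using assms equalizer_mono[OF homE_equalizer[OF assms(1,2)], of g h] by auto
qed (use assms in auto)

lemma mod_map_compE:
  assumes "pre_rmod X" "pre_rmod Y" "pre_rmod Z"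
  shows "mod_map (homE M E Y Z \<otimes> homE M E X Y) X Z
    (evE M E Y Z \<cdot> (idt M (homE M E Y Z) \<boxtimes> evE M E X Y) \<cdot> asc M (homE M E Y Z) (homE M E X Y) (car X))"
  using mod_map_comp[OF mod_map_evE[OF assms(2,3)] mod_map_evE[OF assms(1,2)]] assms
  by (simp add: pre_rmod_arr)

lemma compE_arr [simp]:
  assumes "pre_rmod X" "pre_rmod Y" "pre_rmod Z"
  shows "compE M E X Y Z \<in> Ar M" "src M (compE M E X Y Z) = homE M E Y Z \<otimes> homE M E X Y"
    "tgt M (compE M E X Y Z) = homE M E X Z"
  using curE_arr[OF _ _ mod_map_compE[OF assms]] assms by (simp_all add: compE_def)

lemma uncurE_compE:
  assumes [simp]: "pre_rmod X" "pre_rmod Y" "pre_rmod Z"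
    "g \<in> Ar M" "tgt M g = homE M E Y Z" "f \<in> Ar M" "tgt M f = homE M E X Y"
  shows "uncurE M E X Z (compE M E X Y Z \<cdot> (g \<boxtimes> f)) =
    uncurE M E Y Z g \<cdot> ((idt M (src M g) \<boxtimes> uncurE M E X Y f) \<cdot> asc M (src M g) (src M f) (car X))"
proof -
  note [simp] = pre_rmod_arr[of X] pre_rmod_arr[of Y] pre_rmod_arr[of Z]
  have "uncurE M E X Z (compE M E X Y Z \<cdot> (g \<boxtimes> f)) =
      uncurE M E X Z (compE M E X Y Z) \<cdot> (g \<boxtimes> f \<boxtimes> idt M (car X))"
    by (simp add: uncurE_cmp)
  also have "uncurE M E X Z (compE M E X Y Z) =
      evE M E Y Z \<cdot> ((idt M (homE M E Y Z) \<boxtimes> evE M E X Y) \<cdot> asc M (homE M E Y Z) (homE M E X Y) (car X))"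
    unfolding compE_def by (subst uncurE_curE[OF _ _ mod_map_compE]) simp_all
  finally show ?thesis
    by (simp add: asc_nats merge uncurE_def)
qed

text \<open>On generalized elements \<open>compE\<close> is composition of families; both sides have
  the same adjoint.\<close>

lemma curE_comp:
  assumes g: "mod_map L Y Z g" and f: "mod_map K X Y f"
  shows "curE M E (L \<otimes> K) X Z (g \<cdot> ((idt M L \<boxtimes> f) \<cdot> asc M L K (car X))) =
    compE M E X Y Z \<cdot> (curE M E L Y Z g \<boxtimes> curE M E K X Y f)"
proof -
  note [simp] = mod_map_arr(1-6)[OF f] mod_map_arr(1-6)[OF g] f g mod_map_comp[OF g f]
  show ?thesis
    by (rule homE_ext[of X Z]) (simp_all add: uncurE_compE uncurE_curE)
qed

end

section \<open>Covariant functors\<close>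

locale two_monoids =
  E: csmc_monoid_complete M E + E': csmc_monoid_complete M E'
  for M :: "('o, 'a) csmc" (structure) and E E'

locale enriched_functor = two_monoids M E E' for M :: "('o, 'a) csmc" (structure) and E E' +
  fixes F :: "('o, 'a) mfun"
  assumes enriched: "M_functor M E E' F"
begin

lemma fob_rmod [simp]: "is_rmod M E X \<Longrightarrow> is_rmod M E' (fob F X)"
  using enriched by (auto simp: M_functor_def)

lemma fhom_arr [simp]:
  assumes "is_rmod M E X" "is_rmod M E Y"
  shows "fhom F X Y \<in> Ar M" "src M (fhom F X Y) = homE M E X Y"
    "tgt M (fhom F X Y) = homE M E' (fob F X) (fob F Y)"
  using enriched assms by (auto simp: M_functor_def)

lemma fhom_compE:
  assumes "is_rmod M E X" "is_rmod M E Y" "is_rmod M E Z"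
  shows "fhom F X Z \<cdot> compE M E X Y Z =
    compE M E' (fob F X) (fob F Y) (fob F Z) \<cdot> (fhom F Y Z \<boxtimes> fhom F X Y)"
  using enriched assms by (auto simp: M_functor_def)

text \<open>The action of \<open>F\<close> on \<open>K\<close>-indexed families of maps, that is, on maps \<open>K \<otimes> X \<rightarrow> Y\<close>.\<close>

definition fext :: "'o \<Rightarrow> ('o, 'a) rmod \<Rightarrow> ('o, 'a) rmod \<Rightarrow> 'a \<Rightarrow> 'a" where
  "fext K X Y f = uncurE M E' (fob F X) (fob F Y) (fhom F X Y \<cdot> curE M E K X Y f)"

context
  fixes X Y :: "('o, 'a) rmod"
  assumes X [simp]: "is_rmod M E X" and Y [simp]: "is_rmod M E Y"
begin

lemma mod_map_fext:
  assumes "E.mod_map K X Y f"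
  shows "E'.mod_map K (fob F X) (fob F Y) (fext K X Y f)"
  using E'.mod_map_uncurE[of "fob F X" "fob F Y" "fhom F X Y \<cdot> curE M E K X Y f"] assms
  by (simp add: fext_def)

lemma fext_arr [simp]:
  assumes "E.mod_map K X Y f"
  shows "fext K X Y f \<in> Ar M" "src M (fext K X Y f) = K \<otimes> car (fob F X)"
    "tgt M (fext K X Y f) = car (fob F Y)"
  using E'.mod_map_arr[OF mod_map_fext[OF assms]] by auto

lemma fext_cmp:
  assumes f: "E.mod_map K X Y f" and k: "k \<in> Ar M" "tgt M k = K"
  shows "fext (src M k) X Y (f \<cdot> (k \<boxtimes> idt M (car X))) = fext K X Y f \<cdot> (k \<boxtimes> idt M (car (fob F X)))"
  using f k by (simp add: fext_def E'.uncurE_cmp flip: E.curE_cmp E'.uncurE_cmp)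

end

text \<open>The composition axiom \<open>fhom_compE\<close> evaluated at the generalized elements
  given by \<open>g\<close> and \<open>f\<close>.\<close>

lemma fext_comp:
  assumes [simp]: "is_rmod M E X" "is_rmod M E Y" "is_rmod M E Z"
    and g [simp]: "E.mod_map L Y Z g" and f [simp]: "E.mod_map K X Y f"
  shows "fext (L \<otimes> K) X Z (g \<cdot> ((idt M L \<boxtimes> f) \<cdot> asc M L K (car X))) =
    fext L Y Z g \<cdot> ((idt M L \<boxtimes> fext K X Y f) \<cdot> asc M L K (car (fob F X)))"
proof -
  note [simp] = E.mod_map_arr(1)[OF g] E.mod_map_arr(1)[OF f]
  have "fhom F X Z \<cdot> (compE M E X Y Z \<cdot> (curE M E L Y Z g \<boxtimes> curE M E K X Y f)) =
      compE M E' (fob F X) (fob F Y) (fob F Z) \<cdot>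
        ((fhom F Y Z \<cdot> curE M E L Y Z g) \<boxtimes> (fhom F X Y \<cdot> curE M E K X Y f))"
    by (subst E.cmp_cmp_eq[OF fhom_compE]) (simp_all add: E.merge)
  then show ?thesis
    by (simp add: fext_def E.curE_comp[OF g f] E'.uncurE_compE)
qed

lemma fmap_simps [simp]:
  "msrc (fmap M E E' F f) = fob F (msrc f)" "mtgt (fmap M E E' F f) = fob F (mtgt f)"
  by (simp_all add: fmap_def unnameE_def)

lemma marr_fmap:
  "marr (fmap M E E' F d) = fext (unt M) (msrc d) (mtgt d) (marr d \<cdot> lun M (car (msrc d))) \<cdot>
    inv_arr M (lun M (car (fob F (msrc d))))"
  by (simp add: fmap_def unnameE_def nameE_def fext_def)

text \<open>The map \<open>d\<close> is a family indexed by the unit, so composing gives a family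
  indexed by \<open>S \<otimes> K\<close>; naturality along \<open>lun M K\<close> removes the extra
  \<open>S\<close>.\<close>

lemma fmap_fext:
  assumes [simp]: "is_rmod M E X" "is_rmod M E Y" and f [simp]: "E.mod_map K X Y f"
    and d: "d \<in> Ar (Mod_cat M E)" "msrc d = Y"
  shows "marr (fmap M E E' F d) \<cdot> fext K X Y f = fext K X (mtgt d) (marr d \<cdot> f)"
proof -
  have [simp]: "is_rmod M E (mtgt d)" "marr d \<in> Ar M" "src M (marr d) = car Y" "tgt M (marr d) = car (mtgt d)"
    using d by (auto simp: E.Ar_Mod_cat)
  note [simp] = E.mod_map_arr(1,4-6)[OF f]
  have dl [simp]: "E.mod_map (unt M) Y (mtgt d) (marr d \<cdot> lun M (car Y))"
    using E.mod_map_lun[OF d(1)] d(2) by simp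
  have df [simp]: "E.mod_map K X (mtgt d) (marr d \<cdot> f)"
    by (rule E.mod_map_post[OF f d])
  let ?FX = "car (fob F X)" and ?FY = "car (fob F Y)" and ?S = "unt M"
  have fd: "marr (fmap M E E' F d) = fext ?S Y (mtgt d) (marr d \<cdot> lun M (car Y)) \<cdot> inv_arr M (lun M ?FY)"
    using d(2) by (simp add: marr_fmap)
  have "marr (fmap M E E' F d) \<cdot> fext K X Y f \<cdot> (lun M K \<boxtimes> idt M ?FX) =
      marr (fmap M E E' F d) \<cdot> (fext K X Y f \<cdot> lun M (K \<otimes> ?FX) \<cdot> asc M ?S K ?FX)"
    by (simp add: fd E.lun_asc)
  also have "\<dots> = marr (fmap M E E' F d) \<cdot> (lun M ?FY \<cdot> ((idt M ?S \<boxtimes> fext K X Y f) \<cdot> asc M ?S K ?FX))"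
    by (simp add: fd E.cmp_cmp_eq[OF E.lun_nat_arr])
  also have "\<dots> = fext ?S Y (mtgt d) (marr d \<cdot> lun M (car Y)) \<cdot> ((idt M ?S \<boxtimes> fext K X Y f) \<cdot> asc M ?S K ?FX)"
    by (simp add: fd)
  also have "\<dots> = fext (?S \<otimes> K) X (mtgt d)
      (marr d \<cdot> lun M (car Y) \<cdot> ((idt M ?S \<boxtimes> f) \<cdot> asc M ?S K (car X)))"
    by (rule fext_comp[symmetric]) simp_all
  also have "marr d \<cdot> lun M (car Y) \<cdot> ((idt M ?S \<boxtimes> f) \<cdot> asc M ?S K (car X)) =
      marr d \<cdot> f \<cdot> (lun M K \<boxtimes> idt M (car X))"
    by (simp add: E.cmp_cmp_eq[OF E.lun_nat_arr] E.lun_asc)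
  also have "fext (?S \<otimes> K) X (mtgt d) (marr d \<cdot> f \<cdot> (lun M K \<boxtimes> idt M (car X))) =
      fext K X (mtgt d) (marr d \<cdot> f) \<cdot> (lun M K \<boxtimes> idt M ?FX)"
    using fext_cmp[of X "mtgt d" K "marr d \<cdot> f" "lun M K"] by simp
  finally show ?thesis
    by (rule E.iso_cancel_right[rotated -1]) (simp_all add: fd)
qed

end

section \<open>The comparison map of a strict covariant functor\<close>

locale strict_functor = enriched_functor M E E' F
  for M :: "('o, 'a) csmc" (structure) and E E' F +
  assumes colimits: "has_finite_colimits M"
    and strict: "\<lbrakk>K \<in> Ob M; is_rmod M E X\<rbrakk> \<Longrightarrow> is_iso (Mod_cat M E') (str_map M E E' F K X)"
    and coeq: "preserves_coequalizers M E E' F"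
begin

abbreviation "R \<equiv> reg_mod E"
abbreviation "FE \<equiv> fob F R"

text \<open>The left action of \<open>E\<close> on \<open>FE\<close>: the functor applied to the
  family of left multiplications.\<close>

definition lam :: 'a where
  "lam = fext (mon_car E) R R (mon_mul E)"

lemma str_map_simps:
  "msrc (str_map M E E' F K X) = ten_mod M E' K (fob F X)"
  "mtgt (str_map M E E' F K X) = fob F (ten_mod M E K X)"
  "marr (str_map M E E' F K X) = fext K X (ten_mod M E K X) (idt M (K \<otimes> car X))"
  by (simp_all add: str_map_def fext_def Let_def)

lemma fun_bimod:
  "bcar (fun_bimod M E E' F) = car FE" "lact (fun_bimod M E E' F) = lam" "ract (fun_bimod M E E' F) = act FE"
  by (simp_all add: fun_bimod_def lam_def fext_def yonE_def Let_def)

context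
  fixes X :: "('o, 'a) rmod"
  assumes X [simp]: "is_rmod M E X"
begin

text \<open>With \<open>act1\<close>, the pair that defines \<open>X \<otimes>\<^sub>E FE\<close>,
  as arrows of \<open>E'\<close>-modules. The formulas are those of the bar resolution with
  \<open>FE\<close> for the last factor and \<open>lam\<close> for the multiplication.\<close>

definition act0 :: "('o, 'a) mhom" where
  "act0 = MHom (ten_mod M E' (car X \<otimes> mon_car E) FE) (act X \<boxtimes> idt M (car FE)) (ten_mod M E' (car X) FE)"

definition act1 :: "('o, 'a) mhom" where
  "act1 = MHom (ten_mod M E' (car X \<otimes> mon_car E) FE)
    ((idt M (car X) \<boxtimes> lam) \<cdot> asc M (car X) (mon_car E) (car FE)) (ten_mod M E' (car X) FE)"

lemma lam_map: "E'.mod_map (mon_car E) FE FE lam"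
  unfolding lam_def by (rule mod_map_fext) simp_all

lemmas lam_arr [simp] = E'.mod_map_arr(4-6)[OF lam_map]

lemma act_arr: "act0 \<in> Ar (Mod_cat M E')" "act1 \<in> Ar (Mod_cat M E')"
proof -
  have "E'.mod_map (car X \<otimes> mon_car E) FE (ten_mod M E' (car X) FE) (act X \<boxtimes> idt M (car FE))"
    using E'.mod_map_cmp[OF E'.mod_map_ten[of "car X" FE], of "act X"] by simp
  then show "act0 \<in> Ar (Mod_cat M E')" by (simp add: E'.mod_map_iff act0_def)
  have "E'.mod_map (car X \<otimes> mon_car E) FE (ten_mod M E' (car X) FE)
      ((idt M (car X) \<boxtimes> lam) \<cdot> asc M (car X) (mon_car E) (car FE))"
    using E'.mod_map_comp[OF E'.mod_map_ten[of "car X" FE] lam_map] by simp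
  then show "act1 \<in> Ar (Mod_cat M E')" by (simp add: E'.mod_map_iff act1_def)
qed

lemma coequalizer_F:
  "is_coequalizer (Mod_cat M E') act0 act1
    (MHom (ten_mod M E' (car X) FE) (fext (car X) R X (act X)) (fob F X))"
proof -
  let ?XR = "ten_mod M E (car X) R"
  let ?i = "str_map M E E' F (car X) R" and ?j = "str_map M E E' F (car X \<otimes> mon_car E) R"
  note bar = E.bar_arr[OF X]
  have src [simp]: "msrc (E.bar0 X) = ten_mod M E (car X \<otimes> mon_car E) R" "mtgt (E.bar0 X) = ?XR"
     "msrc (E.bar1 X) = ten_mod M E (car X \<otimes> mon_car E) R" "mtgt (E.bar1 X) = ?XR"
     "msrc (E.bar_proj X) = ?XR" "mtgt (E.bar_proj X) = X"
    by (simp_all add: E.bar0_def E.bar1_def E.bar_proj_def)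
  have "is_coequalizer (Mod_cat M E') (fmap M E E' F (E.bar0 X)) (fmap M E E' F (E.bar1 X))
      (fmap M E E' F (E.bar_proj X))"
    using coeq E.bar_coequalizer[OF X] by (auto simp: preserves_coequalizers_def)
  then have "is_coequalizer (Mod_cat M E') act0 act1 (fmap M E E' F (E.bar_proj X) \<cdot>\<^bsub>Mod_cat M E'\<^esub> ?i)"
  proof (rule E'.Mod.coequalizer_transport)
    \<comment> \<open>\<open>bar0\<close> is the universal family at \<open>X\<close> reindexed
      along \<open>act X\<close>, so naturality in the index turns it into
      \<open>act0\<close>.\<close>
    have "marr (fmap M E E' F (E.bar0 X)) \<cdot> marr ?j = fext (car X \<otimes> mon_car E) R ?XR (act X \<boxtimes> idt M (mon_car E))"
      by (simp add: str_map_simps fmap_fext bar) (simp add: E.bar0_def)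
    also have "\<dots> = marr ?i \<cdot> marr act0"
      using fext_cmp[of R ?XR "car X" "idt M (car X \<otimes> mon_car E)" "act X"]
      by (simp add: str_map_simps act0_def)
    finally show "?i \<cdot>\<^bsub>Mod_cat M E'\<^esub> act0 = fmap M E E' F (E.bar0 X) \<cdot>\<^bsub>Mod_cat M E'\<^esub> ?j"
      by (simp add: str_map_simps act0_def)
    \<comment> \<open>\<open>bar1\<close> is the universal family at \<open>X\<close> composed with
      the multiplication of \<open>E\<close>; applying \<open>F\<close> to the two factors
      separately leaves the strength map after \<open>lam\<close>.\<close>
    have "marr (fmap M E E' F (E.bar1 X)) \<cdot> marr ?j =
        fext (car X \<otimes> mon_car E) R ?XR ((idt M (car X) \<boxtimes> mon_mul E) \<cdot> asc M (car X) (mon_car E) (mon_car E))"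
      by (simp add: str_map_simps fmap_fext bar) (simp add: E.bar1_def)
    also have "\<dots> = marr ?i \<cdot> marr act1"
      using fext_comp[of R R ?XR "car X" "idt M (car X \<otimes> mon_car E)" "mon_car E" "mon_mul E"]
      by (simp add: str_map_simps act1_def lam_def)
    finally show "?i \<cdot>\<^bsub>Mod_cat M E'\<^esub> act1 = fmap M E E' F (E.bar1 X) \<cdot>\<^bsub>Mod_cat M E'\<^esub> ?j"
      by (simp add: str_map_simps act1_def)
  qed (simp_all add: strict act_arr str_map_simps, simp_all add: act0_def act1_def)
  moreover have "marr (fmap M E E' F (E.bar_proj X)) \<cdot> marr ?i = fext (car X) R X (act X)"
    by (simp add: str_map_simps fmap_fext bar) (simp add: E.bar_proj_def)
  ultimately show ?thesis by (simp add: str_map_simps)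
qed

theorem tau_iso: "is_iso (Mod_cat M E') (tau_map M E E' F X)"
proof -
  let ?q = "tenE_proj M E X (fun_bimod M E E' F)" and ?s = "fext (car X) R X (act X)"
  let ?T = "tenE_mod M E E' X (fun_bimod M E E' F)"
  have q: "is_coequalizer M (marr act0) (marr act1) ?q"
    unfolding tenE_proj_def fun_bimod act0_def act1_def mhom.sel
    by (rule E.has_coequalizers[OF colimits]) simp_all
  note q1 = E.coequalizer_arr[OF q]
  have [simp]: "src M ?q = car X \<otimes> car FE" "?q \<in> Ar M" using q1 by (auto simp: act0_def)
  have T: "?T = RMod (tgt M ?q) (THE a. a \<in> hom M (tgt M ?q \<otimes> mon_car E') (tgt M ?q) \<and>
      a \<cdot> (?q \<boxtimes> idt M (mon_car E')) = ?q \<cdot> act (mtgt act0))"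
    by (simp add: tenE_mod_def fun_bimod act0_def Let_def)
  have "is_coequalizer (Mod_cat M E') act0 act1 (MHom (mtgt act0) ?q ?T)"
    unfolding T by (rule E'.coequalizer_Mod[OF act_arr _ _ q]) (simp_all add: act0_def act1_def)
  from E'.Mod.coequalizers_iso[OF this coequalizer_F]
  obtain t where t: "is_iso (Mod_cat M E') t" "msrc t = ?T" "mtgt t = fob F X" "marr t \<cdot> ?q = ?s"
    by auto
  have "marr t \<in> hom M (car ?T) (car (fob F X))"
    using E'.Mod.is_iso_arr[OF t(1)] t by (auto simp: E.Ar_Mod_cat)
  \<comment> \<open>Since \<open>?q\<close> is epi, the comparison of the two coequalizers is the
    only map that meets the description in \<open>tau_map\<close>.\<close>
  then have "(THE t. t \<in> hom M (car ?T) (car (fob F X)) \<and> t \<cdot> ?q = ?s) = marr t"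
    using t(4) E.coequalizer_epi[OF q] by (intro the_equality) (auto simp: T)
  then have "tau_map M E E' F X = t"
    using t by (intro E.mhom_eqI) (simp_all add: tau_map_def Let_def fext_def yonE_def)
  then show ?thesis using t by simp
qed

end

end

section \<open>Contravariant functors\<close>

locale contra_functor = two_monoids M E E' for M :: "('o, 'a) csmc" (structure) and E E' +
  fixes F :: "('o, 'a) mfun"
  assumes enriched: "contra_M_functor M E E' F"
begin

lemma fob_rmod [simp]: "is_rmod M E X \<Longrightarrow> is_rmod M E' (fob F X)"
  using enriched by (auto simp: contra_M_functor_def)

lemma fhom_arr [simp]:
  assumes "is_rmod M E X" "is_rmod M E Y"
  shows "fhom F X Y \<in> Ar M" "src M (fhom F X Y) = homE M E X Y"
    "tgt M (fhom F X Y) = homE M E' (fob F Y) (fob F X)"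
  using enriched assms by (auto simp: contra_M_functor_def)

lemma fhom_compE:
  assumes "is_rmod M E X" "is_rmod M E Y" "is_rmod M E Z"
  shows "fhom F X Z \<cdot> compE M E X Y Z =
    compE M E' (fob F Z) (fob F Y) (fob F X) \<cdot> (fhom F X Y \<boxtimes> fhom F Y Z) \<cdot>
      sym M (homE M E Y Z) (homE M E X Y)"
  using enriched assms by (auto simp: contra_M_functor_def)

text \<open>\<open>F\<close> exchanges \<open>X\<close> and \<open>Y\<close>, but the dependence on
  the index object \<open>K\<close> keeps its direction.\<close>

definition fext :: "'o \<Rightarrow> ('o, 'a) rmod \<Rightarrow> ('o, 'a) rmod \<Rightarrow> 'a \<Rightarrow> 'a" where
  "fext K X Y f = uncurE M E' (fob F Y) (fob F X) (fhom F X Y \<cdot> curE M E K X Y f)"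

context
  fixes X Y :: "('o, 'a) rmod"
  assumes X [simp]: "is_rmod M E X" and Y [simp]: "is_rmod M E Y"
begin

lemma fext_arr [simp]:
  assumes "E.mod_map K X Y f"
  shows "fext K X Y f \<in> Ar M" "src M (fext K X Y f) = K \<otimes> car (fob F Y)"
    "tgt M (fext K X Y f) = car (fob F X)"
  using assms by (simp_all add: fext_def)

lemma fext_cmp:
  assumes f: "E.mod_map K X Y f" and k: "k \<in> Ar M" "tgt M k = K"
  shows "fext (src M k) X Y (f \<cdot> (k \<boxtimes> idt M (car X))) = fext K X Y f \<cdot> (k \<boxtimes> idt M (car (fob F Y)))"
  using f k by (simp add: fext_def E'.uncurE_cmp flip: E.curE_cmp E'.uncurE_cmp)

end

text \<open>The symmetry in the contravariant composition axiom becomes an exchange of the two index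
  objects.\<close>

lemma fext_comp:
  assumes [simp]: "is_rmod M E X" "is_rmod M E Y" "is_rmod M E Z"
    and g [simp]: "E.mod_map L Y Z g" and f [simp]: "E.mod_map K X Y f"
  shows "fext (L \<otimes> K) X Z (g \<cdot> ((idt M L \<boxtimes> f) \<cdot> asc M L K (car X))) =
    fext K X Y f \<cdot> ((idt M K \<boxtimes> fext L Y Z g) \<cdot> (asc M K L (car (fob F Z)) \<cdot>
      (sym M L K \<boxtimes> idt M (car (fob F Z)))))"
proof -
  note [simp] = E.mod_map_arr(1)[OF g] E.mod_map_arr(1)[OF f]
  let ?h = "compE M E' (fob F Z) (fob F Y) (fob F X) \<cdot>
        ((fhom F X Y \<cdot> curE M E K X Y f) \<boxtimes> (fhom F Y Z \<cdot> curE M E L Y Z g))"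
  have "fhom F X Z \<cdot> (compE M E X Y Z \<cdot> (curE M E L Y Z g \<boxtimes> curE M E K X Y f)) = ?h \<cdot> sym M L K"
    by (subst E.cmp_cmp_eq[OF fhom_compE]) (simp_all add: E.sym_nats E.merge)
  moreover have "uncurE M E' (fob F Z) (fob F X) (?h \<cdot> sym M L K) =
      uncurE M E' (fob F Z) (fob F X) ?h \<cdot> (sym M L K \<boxtimes> idt M (car (fob F Z)))"
    by (rule E'.uncurE_cmp) simp_all
  ultimately show ?thesis
    by (simp add: fext_def E.curE_comp[OF g f] E'.uncurE_compE)
qed

text \<open>Preservation of identities, in uncurried form. It makes the unit of \<open>E\<close> act
  trivially on \<open>FE\<close>.\<close>

lemma fext_lun:
  assumes X [simp]: "is_rmod M E X"
  shows "fext (unt M) X X (lun M (car X)) = lun M (car (fob F X))"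
proof -
  let ?id = "MHom (fob F X) (idt M (car (fob F X))) (fob F X)"
  have "?id \<in> Ar (Mod_cat M E')"
    using E'.Mod.idt_arr(1)[of "fob F X"] by simp
  from E'.mod_map_lun[OF this]
  have "E'.mod_map (unt M) (fob F X) (fob F X) (lun M (car (fob F X)))" by simp
  moreover have "fhom F X X \<cdot> idE M E X = idE M E' (fob F X)"
    using enriched by (auto simp: contra_M_functor_def)
  ultimately show ?thesis by (simp add: fext_def idE_def E'.uncurE_curE)
qed

lemma contra_fmap_simps [simp]:
  "msrc (contra_fmap M E E' F f) = fob F (mtgt f)" "mtgt (contra_fmap M E E' F f) = fob F (msrc f)"
  by (simp_all add: contra_fmap_def unnameE_def)

lemma marr_contra_fmap:
  "marr (contra_fmap M E E' F d) = fext (unt M) (msrc d) (mtgt d) (marr d \<cdot> lun M (car (msrc d))) \<cdot>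
    inv_arr M (lun M (car (fob F (mtgt d))))"
  by (simp add: contra_fmap_def unnameE_def nameE_def fext_def)

lemma contra_fmap_arr [simp]:
  assumes d: "d \<in> Ar (Mod_cat M E)"
  shows "marr (contra_fmap M E E' F d) \<in> Ar M" "src M (marr (contra_fmap M E E' F d)) = car (fob F (mtgt d))"
    "tgt M (marr (contra_fmap M E E' F d)) = car (fob F (msrc d))"
proof -
  have [simp]: "is_rmod M E (msrc d)" "is_rmod M E (mtgt d)" using d by (auto simp: E.Ar_Mod_cat)
  note [simp] = E.mod_map_lun[OF d]
  show "marr (contra_fmap M E E' F d) \<in> Ar M" "src M (marr (contra_fmap M E E' F d)) = car (fob F (mtgt d))"
    "tgt M (marr (contra_fmap M E E' F d)) = car (fob F (msrc d))"
    by (simp_all add: marr_contra_fmap)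
qed

lemma fext_fmap:
  assumes [simp]: "is_rmod M E X" "is_rmod M E Y" and f [simp]: "E.mod_map K X Y f"
    and d: "d \<in> Ar (Mod_cat M E)" "msrc d = Y"
  shows "fext K X Y f \<cdot> (idt M K \<boxtimes> marr (contra_fmap M E E' F d)) = fext K X (mtgt d) (marr d \<cdot> f)"
proof -
  have [simp]: "is_rmod M E (mtgt d)" "marr d \<in> Ar M" "src M (marr d) = car Y" "tgt M (marr d) = car (mtgt d)"
    using d by (auto simp: E.Ar_Mod_cat)
  note [simp] = E.mod_map_arr(1,4-6)[OF f]
  have dl [simp]: "E.mod_map (unt M) Y (mtgt d) (marr d \<cdot> lun M (car Y))"
    using E.mod_map_lun[OF d(1)] d(2) by simp
  have df [simp]: "E.mod_map K X (mtgt d) (marr d \<cdot> f)"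
    by (rule E.mod_map_post[OF f d])
  let ?FZ = "car (fob F (mtgt d))" and ?FY = "car (fob F Y)" and ?S = "unt M"
  let ?d = "marr (contra_fmap M E E' F d)"
  have [simp]: "?d \<in> Ar M" "src M ?d = ?FZ" "tgt M ?d = ?FY" using d by simp_all
  have fd: "?d \<cdot> lun M ?FZ = fext ?S Y (mtgt d) (marr d \<cdot> lun M (car Y))"
    using d(2) by (simp add: marr_contra_fmap)
  \<comment> \<open>Writing \<open>lun M K\<close> as \<open>run M K\<close> after the symmetry lets
    the triangle produce the exchanged order of indices that \<open>fext_comp\<close>
    expects.\<close>
  have "fext K X Y f \<cdot> (idt M K \<boxtimes> ?d) \<cdot> (lun M K \<boxtimes> idt M ?FZ) =
      fext K X Y f \<cdot> ((idt M K \<boxtimes> ?d) \<cdot> ((run M K \<boxtimes> idt M ?FZ) \<cdot> (sym M ?S K \<boxtimes> idt M ?FZ)))"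
    by (simp add: E.merge E.run_sym)
  also have "\<dots> = fext K X Y f \<cdot> ((idt M K \<boxtimes> (?d \<cdot> lun M ?FZ)) \<cdot> (asc M K ?S ?FZ \<cdot> (sym M ?S K \<boxtimes> idt M ?FZ)))"
    by (simp add: E.triangle[symmetric]) (simp add: E.merge)
  also have "\<dots> = fext (?S \<otimes> K) X (mtgt d)
      (marr d \<cdot> lun M (car Y) \<cdot> ((idt M ?S \<boxtimes> f) \<cdot> asc M ?S K (car X)))"
    unfolding fd by (rule fext_comp[symmetric]) simp_all
  also have "marr d \<cdot> lun M (car Y) \<cdot> ((idt M ?S \<boxtimes> f) \<cdot> asc M ?S K (car X)) =
      marr d \<cdot> f \<cdot> (lun M K \<boxtimes> idt M (car X))"
    by (simp add: E.cmp_cmp_eq[OF E.lun_nat_arr] E.lun_asc)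
  also have "fext (?S \<otimes> K) X (mtgt d) (marr d \<cdot> f \<cdot> (lun M K \<boxtimes> idt M (car X))) =
      fext K X (mtgt d) (marr d \<cdot> f) \<cdot> (lun M K \<boxtimes> idt M ?FZ)"
    using fext_cmp[of X "mtgt d" K "marr d \<cdot> f" "lun M K"] by simp
  finally show ?thesis
    by (rule E.iso_cancel_right[rotated -1]) simp_all
qed

end

section \<open>The comparison map of a strict contravariant functor\<close>

locale strict_contra_functor = contra_functor M E E' F
  for M :: "('o, 'a) csmc" (structure) and E E' F +
  assumes strict: "\<lbrakk>K \<in> Ob M; is_rmod M E X\<rbrakk> \<Longrightarrow> is_iso (Mod_cat M E') (contra_str_map M E E' F K X)"
    and coeq: "coequalizers_to_equalizers M E E' F"
begin

abbreviation "R \<equiv> reg_mod E"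
abbreviation "FE \<equiv> fob F R"

definition lam :: 'a where
  "lam = fext (mon_car E) R R (mon_mul E)"

definition actE :: 'a where
  "actE = lam \<cdot> sym M (car FE) (mon_car E)"

lemma lam_arr [simp]:
  "lam \<in> Ar M" "src M lam = mon_car E \<otimes> car FE" "tgt M lam = car FE"
  by (simp_all add: lam_def)

lemma actE_arr [simp]:
  "actE \<in> Ar M" "src M actE = car FE \<otimes> mon_car E" "tgt M actE = car FE"
  by (simp_all add: actE_def)

lemma str_map_simps:
  "msrc (contra_str_map M E E' F K X) = fob F (ten_mod M E K X)"
  "mtgt (contra_str_map M E E' F K X) = ihom_mod M E' K (fob F X)"
  "marr (contra_str_map M E E' F K X) = cur M (car (fob F (ten_mod M E K X))) K (car (fob F X))
     (fext K X (ten_mod M E K X) (idt M (K \<otimes> car X)) \<cdot> sym M (car (fob F (ten_mod M E K X))) K)"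
  by (simp_all add: contra_str_map_def fext_def Let_def)

lemma car_ihom_mod [simp]: "car (ihom_mod M E' K Y) = ihom M K (car Y)"
  by (simp add: ihom_mod_def)

lemma contra_fun_mod:
  "car (contra_fun_mod M E E' F) = car FE"
  "act (contra_fun_mod M E E' F) = act FE \<cdot> ((actE \<boxtimes> idt M (mon_car E')) \<cdot>
     inv_arr M (asc M (car FE) (mon_car E) (mon_car E')))"
  by (simp_all add: contra_fun_mod_def actE_def lam_def fext_def yonE_def Let_def)

text \<open>The unit of \<open>E\<close> acts trivially because \<open>F\<close> preserves
  identities. An equality of modules, not merely an isomorphism, is what allows rewriting inside
  \<open>homE_mod\<close>.\<close>

lemma restrict_snd: "restrict_snd M E E' (contra_fun_mod M E E' F) = FE"
proof -
  let ?e = "mon_car E" and ?e' = "mon_car E'" and ?u = "mon_unit E"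
  have "lam \<cdot> (?u \<boxtimes> idt M (car FE)) = fext (unt M) R R (mon_mul E \<cdot> (?u \<boxtimes> idt M (car R)))"
    using fext_cmp[of R R ?e "mon_mul E" ?u] by (simp add: lam_def)
  also have "\<dots> = fext (unt M) R R (lun M (car R))"
    by (simp add: E.mon_lunit)
  also have "\<dots> = lun M (car FE)"
    by (rule fext_lun) simp
  finally have lu: "lam \<cdot> (?u \<boxtimes> idt M (car FE)) = lun M (car FE)" .
  have au: "actE \<cdot> (idt M (car FE) \<boxtimes> ?u) = run M (car FE)"
    by (simp add: actE_def E.sym_nats E.cmp_cmp_eq[OF lu] E.lun_sym)
  have "act (contra_fun_mod M E E' F) \<cdot> (idt M (car FE) \<boxtimes> ((?u \<boxtimes> idt M ?e') \<cdot> inv_arr M (lun M ?e'))) =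
      act FE \<cdot> ((actE \<boxtimes> idt M ?e') \<cdot> (inv_arr M (asc M (car FE) ?e ?e') \<cdot>
        ((idt M (car FE) \<boxtimes> (?u \<boxtimes> idt M ?e')) \<cdot> (idt M (car FE) \<boxtimes> inv_arr M (lun M ?e')))))"
    by (simp add: contra_fun_mod E.merge)
  also have "\<dots> = act FE \<cdot> ((run M (car FE) \<boxtimes> idt M ?e') \<cdot>
      (inv_arr M (asc M (car FE) (unt M) ?e') \<cdot> (idt M (car FE) \<boxtimes> inv_arr M (lun M ?e'))))"
    by (simp add: E.inv_asc_nats) (simp add: E.merge au)
  also have "\<dots> = act FE"
    by (simp add: E.triangle[symmetric]) (simp add: E.merge)
  finally show ?thesis
    by (simp add: restrict_snd_def contra_fun_mod(1))
qed

text \<open>The unit of \<open>E'\<close> acts trivially by the unit law of \<open>FE\<close>, which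
  leaves the action of \<open>E\<close> alone.\<close>

lemma restrict_fst: "restrict_fst M E E' (contra_fun_mod M E E' F) = RMod (car FE) actE"
proof -
  let ?e = "mon_car E" and ?e' = "mon_car E'" and ?u = "mon_unit E'"
  have "act (contra_fun_mod M E E' F) \<cdot> (idt M (car FE) \<boxtimes> ((idt M ?e \<boxtimes> ?u) \<cdot> inv_arr M (run M ?e))) =
      act FE \<cdot> ((actE \<boxtimes> idt M ?e') \<cdot> (inv_arr M (asc M (car FE) ?e ?e') \<cdot>
        ((idt M (car FE) \<boxtimes> (idt M ?e \<boxtimes> ?u)) \<cdot> (idt M (car FE) \<boxtimes> inv_arr M (run M ?e)))))"
    by (simp add: contra_fun_mod E.merge)
  also have "\<dots> = act FE \<cdot> ((idt M (car FE) \<boxtimes> ?u) \<cdot> ((actE \<boxtimes> idt M (unt M)) \<cdot>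
      (inv_arr M (asc M (car FE) ?e (unt M)) \<cdot> (idt M (car FE) \<boxtimes> inv_arr M (run M ?e)))))"
    by (simp add: E.inv_asc_nats) (simp add: E.merge)
  also have "\<dots> = run M (car FE) \<cdot> ((actE \<boxtimes> idt M (unt M)) \<cdot>
      (inv_arr M (asc M (car FE) ?e (unt M)) \<cdot> (idt M (car FE) \<boxtimes> inv_arr M (run M ?e))))"
    using E.cmp_cmp_eq[OF E.rmod_unit[of E' FE]] by simp
  also have "\<dots> = actE \<cdot> (run M (car FE \<otimes> ?e) \<cdot>
      (inv_arr M (asc M (car FE) ?e (unt M)) \<cdot> (idt M (car FE) \<boxtimes> inv_arr M (run M ?e))))"
    by (simp add: E.cmp_cmp_eq[OF E.run_nat_arr])
  also have "\<dots> = actE"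
    by (simp add: E.run_asc[symmetric] E.merge)
  finally show ?thesis
    by (simp add: restrict_fst_def contra_fun_mod(1))
qed

abbreviation "Y \<equiv> RMod (car FE) actE"

lemma pre_Y [simp]: "E.pre_rmod Y"
  by (simp add: E.pre_rmod_def del: E.pre_rmod_arr)

context
  fixes X :: "('o, 'a) rmod"
  assumes X [simp]: "is_rmod M E X"
begin

text \<open>With \<open>coact1\<close>, the pair whose equalizer in \<open>M\<close> is
  \<open>Hom\<^sub>E(X, FE)\<close>, placed between \<open>E'\<close>-modules.\<close>

definition coact0 :: "('o, 'a) mhom" where
  "coact0 = MHom (ihom_mod M E' (car X) FE) (E.homE0 X Y) (ihom_mod M E' (car X \<otimes> mon_car E) FE)"

definition coact1 :: "('o, 'a) mhom" where
  "coact1 = MHom (ihom_mod M E' (car X) FE) (E.homE1 X Y) (ihom_mod M E' (car X \<otimes> mon_car E) FE)"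

definition adj :: 'a where
  "adj = cur M (car (fob F X)) (car X) (car FE) (fext (car X) R X (act X) \<cdot> sym M (car (fob F X)) (car X))"

text \<open>The three claims are proved together because linearity of the pair comes from the same
  two squares \<open>fx\<close> and \<open>gx\<close> that carry the equalizer across the strength
  isomorphisms.\<close>

lemma equalizer_F:
  "coact0 \<in> Ar (Mod_cat M E')" "coact1 \<in> Ar (Mod_cat M E')"
  "is_equalizer (Mod_cat M E') coact0 coact1 (MHom (fob F X) adj (ihom_mod M E' (car X) FE))"
proof -
  let ?e = "mon_car E" and ?XE = "car X \<otimes> mon_car E"
  let ?XR = "ten_mod M E (car X) R" and ?XRR = "ten_mod M E ?XE R"
  let ?i = "contra_str_map M E E' F (car X) R" and ?j = "contra_str_map M E E' F ?XE R"
  let ?f = "contra_fmap M E E' F (E.bar0 X)" and ?g = "contra_fmap M E E' F (E.bar1 X)"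
    and ?q = "contra_fmap M E E' F (E.bar_proj X)"
  note bar [simp] = E.bar_arr[OF X]
  have src [simp]: "msrc (E.bar0 X) = ?XRR" "mtgt (E.bar0 X) = ?XR"
     "msrc (E.bar1 X) = ?XRR" "mtgt (E.bar1 X) = ?XR"
     "msrc (E.bar_proj X) = ?XR" "mtgt (E.bar_proj X) = X"
    by (simp_all add: E.bar0_def E.bar1_def E.bar_proj_def)
  have eq: "is_equalizer (Mod_cat M E') ?f ?g ?q"
    using coeq E.bar_coequalizer[OF X] by (auto simp: coequalizers_to_equalizers_def)
  note fg = E'.Mod.equalizer_arr[OF eq]
  have ij: "is_iso (Mod_cat M E') ?i" "is_iso (Mod_cat M E') ?j" by (simp_all add: strict)
  let ?FX = "car (fob F ?XR)"
  let ?x = "fext (car X) R ?XR (idt M ?XE)" and ?y = "fext ?XE R ?XRR (idt M (?XE \<otimes> ?e))"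
  have [simp]: "?x \<in> Ar M" "src M ?x = car X \<otimes> ?FX" "tgt M ?x = car FE"
      "?y \<in> Ar M" "src M ?y = ?XE \<otimes> car (fob F ?XRR)" "tgt M ?y = car FE"
    by simp_all
  have marr: "marr ?i = cur M ?FX (car X) (car FE) (?x \<cdot> sym M ?FX (car X))"
    "marr ?j = cur M (car (fob F ?XRR)) ?XE (car FE) (?y \<cdot> sym M (car (fob F ?XRR)) ?XE)"
    by (simp_all add: str_map_simps)
  have fx: "E.homE0 X Y \<cdot> marr ?i = marr ?j \<cdot> marr ?f"
  proof -
    have "E.homE0 X Y \<cdot> marr ?i = cur M ?FX ?XE (car FE) (?x \<cdot> ((act X \<boxtimes> idt M ?FX) \<cdot> sym M ?FX ?XE))"
      by (simp add: marr E.homE0_def E.cur_cmp E.merge E.ev_cur_tena E.sym_nats)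
    also have "?x \<cdot> ((act X \<boxtimes> idt M ?FX) \<cdot> sym M ?FX ?XE) = fext ?XE R ?XR (act X \<boxtimes> idt M ?e) \<cdot> sym M ?FX ?XE"
      using fext_cmp[of R ?XR "car X" "idt M ?XE" "act X"] by simp
    also have "fext ?XE R ?XR (act X \<boxtimes> idt M ?e) = ?y \<cdot> (idt M ?XE \<boxtimes> marr ?f)"
      by (simp add: fext_fmap) (simp add: E.bar0_def)
    also have "cur M ?FX ?XE (car FE) (?y \<cdot> (idt M ?XE \<boxtimes> marr ?f) \<cdot> sym M ?FX ?XE) = marr ?j \<cdot> marr ?f"
      by (simp add: marr E.cur_cmp E.sym_nats)
    finally show ?thesis .
  qed
  have gx: "E.homE1 X Y \<cdot> marr ?i = marr ?j \<cdot> marr ?g"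
  proof -
    let ?s = "inv_arr M (asc M ?FX (car X) ?e)"
    have "E.homE1 X Y \<cdot> marr ?i = cur M ?FX ?XE (car FE)
        (actE \<cdot> (((?x \<cdot> sym M ?FX (car X)) \<boxtimes> idt M ?e) \<cdot> ?s))"
      by (simp add: marr E.homE1_def E.cur_cmp E.inv_asc_nats E.merge E.ev_cur)
    also have "actE \<cdot> (((?x \<cdot> sym M ?FX (car X)) \<boxtimes> idt M ?e) \<cdot> ?s) =
        lam \<cdot> ((idt M ?e \<boxtimes> ?x) \<cdot> ((idt M ?e \<boxtimes> sym M ?FX (car X)) \<cdot> sym M (?FX \<otimes> car X) ?e) \<cdot> ?s)"
      by (simp add: actE_def E.sym_nats E.merge)
    \<comment> \<open>The symmetry inside \<open>actE\<close> has moved \<open>E\<close> past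
      \<open>F(X \<otimes> E) \<otimes> X\<close>; \<open>sym_ten\<close> rearranges this into the
      index exchange that \<open>fext_comp\<close> produces.\<close>
    also have "\<dots> = lam \<cdot> ((idt M ?e \<boxtimes> ?x) \<cdot> (asc M ?e (car X) ?FX \<cdot> (sym M (car X) ?e \<boxtimes> idt M ?FX))) \<cdot> sym M ?FX ?XE"
      by (simp add: E.sym_ten[symmetric])
    also have "lam \<cdot> ((idt M ?e \<boxtimes> ?x) \<cdot> (asc M ?e (car X) ?FX \<cdot> (sym M (car X) ?e \<boxtimes> idt M ?FX))) =
        fext ?XE R ?XR ((idt M (car X) \<boxtimes> mon_mul E) \<cdot> asc M (car X) ?e ?e)"
      using fext_comp[of R R ?XR "car X" "idt M ?XE" ?e "mon_mul E"] by (simp add: lam_def)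
    also have "\<dots> = ?y \<cdot> (idt M ?XE \<boxtimes> marr ?g)"
      by (simp add: fext_fmap) (simp add: E.bar1_def)
    also have "cur M ?FX ?XE (car FE) (?y \<cdot> (idt M ?XE \<boxtimes> marr ?g) \<cdot> sym M ?FX ?XE) = marr ?j \<cdot> marr ?g"
      by (simp add: marr E.cur_cmp E.sym_nats)
    finally show ?thesis .
  qed
  have qx: "marr ?i \<cdot> marr ?q = adj"
  proof -
    have "marr ?i \<cdot> marr ?q = cur M (car (fob F X)) (car X) (car FE)
        (?x \<cdot> (idt M (car X) \<boxtimes> marr ?q) \<cdot> sym M (car (fob F X)) (car X))"
      by (simp add: marr E.cur_cmp E.sym_nats)
    also have "?x \<cdot> (idt M (car X) \<boxtimes> marr ?q) = fext (car X) R X (act X)"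
      by (simp add: fext_fmap) (simp add: E.bar_proj_def)
    finally show ?thesis by (simp add: adj_def)
  qed
  \<comment> \<open>Precomposed with the invertible \<open>?i\<close>, the parallel maps become
    these composites of module maps, from which they inherit linearity.\<close>
  have h: "?j \<cdot>\<^bsub>Mod_cat M E'\<^esub> ?f \<in> Ar (Mod_cat M E')" "?j \<cdot>\<^bsub>Mod_cat M E'\<^esub> ?g \<in> Ar (Mod_cat M E')"
    using fg E'.Mod.is_iso_arr[OF ij(2)] by (intro E'.Mod.cmp_arr; simp add: str_map_simps)+
  show c: "coact0 \<in> Ar (Mod_cat M E')" "coact1 \<in> Ar (Mod_cat M E')"
    using E'.Mod_lift_right[OF ij(1) h(1), of "E.homE0 X Y"] fx
      E'.Mod_lift_right[OF ij(1) h(2), of "E.homE1 X Y"] gx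
    by (simp_all add: coact0_def coact1_def str_map_simps)
  have "is_equalizer (Mod_cat M E') coact0 coact1 (?i \<cdot>\<^bsub>Mod_cat M E'\<^esub> ?q)"
    by (rule E'.Mod.equalizer_transport[OF eq ij(1) _ ij(2)])
      (simp_all add: c str_map_simps(1,2), simp_all add: coact0_def coact1_def fx gx)
  then show "is_equalizer (Mod_cat M E') coact0 coact1 (MHom (fob F X) adj (ihom_mod M E' (car X) FE))"
    using qx by (simp add: str_map_simps)
qed

theorem contra_tau_iso: "is_iso (Mod_cat M E') (contra_tau_map M E E' F X)"
proof -
  let ?i = "homE_incl M E X Y" and ?H = "homE M E X Y" and ?e' = "mon_car E'"
  let ?A = "ihom_mod M E' (car X) FE"
  have i: "is_equalizer M (marr coact0) (marr coact1) ?i"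
    using E.homE_equalizer[of X Y] by (simp add: coact0_def coact1_def)
  obtain a where a: "a \<in> hom M (?H \<otimes> ?e') ?H" "?i \<cdot> a = act ?A \<cdot> (?i \<boxtimes> idt M ?e')"
    and eq: "is_equalizer (Mod_cat M E') coact0 coact1 (MHom (RMod ?H a) ?i ?A)"
    using E'.equalizer_Mod[OF equalizer_F(1,2) _ _ i] by (auto simp: coact0_def coact1_def)
  \<comment> \<open>Composing with the inclusion turns the action supplied by the equalizer into the
    adjoint of the formula in \<open>homE_mod\<close>, so \<open>a\<close> is the action of that
    module.\<close>
  have "?i \<cdot> a = cur M (?H \<otimes> ?e') (car X) (car FE)
      (act FE \<cdot> (evE M E X Y \<boxtimes> idt M ?e') \<cdot> swap M ?H ?e' (car X))"
    using a(2) by (simp add: ihom_mod_def E.cur_cmp E.swap_nat E.merge evE_def)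
  then have "curE M E (?H \<otimes> ?e') X Y (act FE \<cdot> (evE M E X Y \<boxtimes> idt M ?e') \<cdot> swap M ?H ?e' (car X)) = a"
    using a(1) by (intro E.curE_eqI) simp_all
  then have H: "homE_mod M E E' X (contra_fun_mod M E E' F) = RMod ?H a"
    by (simp only: homE_mod_def restrict_fst restrict_snd Let_def)
  from E'.Mod.equalizers_iso[OF equalizer_F(3) eq]
  obtain t where t: "is_iso (Mod_cat M E') t" "msrc t = fob F X" "mtgt t = RMod ?H a" "?i \<cdot> marr t = adj"
    by auto
  have m: "marr t \<in> Ar M" "src M (marr t) = car (fob F X)" "tgt M (marr t) = ?H"
    using E'.Mod.is_iso_arr[OF t(1)] t by (auto simp: E.Ar_Mod_cat)
  \<comment> \<open>The isomorphism of equalizers factors \<open>adj\<close> through the inclusion,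
    which is exactly what the \<open>curE\<close> in \<open>contra_tau_map\<close> asks for.\<close>
  have "curE M E (car (fob F X)) X Y (fext (car X) R X (act X) \<cdot> sym M (car (fob F X)) (car X)) = marr t"
    by (rule E.curE_eqI) (use m t(4) in \<open>simp_all add: adj_def\<close>)
  then have "contra_tau_map M E E' F X = t"
    using t H by (intro E.mhom_eqI) (simp_all add: contra_tau_map_def Let_def restrict_fst fext_def yonE_def)
  then show ?thesis using t by simp
qed

end

end

theorem theorem2p3:
  fixes M :: "('o, 'a) csmc" and E E' :: "('o, 'a) mon"
  assumes "closed_symmetric_monoidal_category M"
    and "has_finite_colimits M" and "has_finite_limits M"
    and "is_monoid M E" and "is_monoid M E'"
  shows "(\<forall>F. strict_M_functor M E E' F \<and> preserves_coequalizers M E E' F \<longrightarrow>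
            (\<forall>X \<in> Ob (Mod_cat M E). is_iso (Mod_cat M E') (tau_map M E E' F X))) \<and>
         (\<forall>F. strict_contra_M_functor M E E' F \<and> coequalizers_to_equalizers M E E' F \<longrightarrow>
            (\<forall>X \<in> Ob (Mod_cat M E). is_iso (Mod_cat M E') (contra_tau_map M E E' F X)))"
proof (intro conjI allI impI ballI)
  interpret csmc M using assms(1) by (rule csmc.intro)
  interpret two_monoids M E E'
    using assms by unfold_locales
  fix F X assume X: "X \<in> Ob (Mod_cat M E)"
  {
    assume F: "strict_M_functor M E E' F \<and> preserves_coequalizers M E E' F"
    then interpret strict_functor M E E' F
      using assms by unfold_locales (auto simp: strict_M_functor_def)
    show "is_iso (Mod_cat M E') (tau_map M E E' F X)" using tau_iso X by simp
  next
    assume F: "strict_contra_M_functor M E E' F \<and> coequalizers_to_equalizers M E E' F"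
    then interpret strict_contra_functor M E E' F
      by unfold_locales (auto simp: strict_contra_M_functor_def)
    show "is_iso (Mod_cat M E') (contra_tau_map M E E' F X)" using contra_tau_iso X by simp
  }
qed

end
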